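(* Let $X=(X_n)_{n\in\mathbb Z_+}$ be a Markov chain on a countable state space $D\cup\{\partial\}$ with $\partial$ absorbing. Assume that $X$ is aperiodic, that there exists $x_0\in D$ with $\mathbb P_{x_0}(\exists n\ge1,\ X_n=x_0)>0$, and that there exists $V:D\to[1,\infty)$ such that $\{x\in D:\ V(x)\le c\}$ is finite for every $c>0$ and \[\frac{\mathbb E_x(V(X_1)\mathbbm 1_{1<\tau_\partial})}{V(x)}\xrightarrow[V(x)\to+\infty]{}0.\] Then the semigroup of $X$ satisfies Assumption (A) with $W_S=V$; in particular $X$ admits a quasi-stationary distribution. In addition, $\mathbb P_{x_0}(X_n\in\cdot\mid n<\tau_\partial)$ converges in $\mathcal M(V)$ as $n\to\infty$ to a quasi-stationary distribution of $X$.
   Context: $\tau_\partial=\inf\{n:X_n=\partial\}$; $S_nf(x)=\mathbb E_x(f(X_n)\mathbbm 1_{n<\tau_\partial})$; functions are extended by $0$ at $\partial$. $X$ is aperiodic if every state of $D$ is aperiodic, a state $x$ with $\mathbb P_x(X_n=x\text{ for some }n\ge1)=0$ being considered aperiodic. A quasi-stationary distribution is a probability measure $\nu$ on $D$ with $\mathbb P_\nu(X_n\in\cdot\mid n<\tau_\partial)=\nu$ for all $n$. $\mathcal M(V)$ is the space of finite signed measures $\mu$ on $D$ with $|\mu|(V)<\infty$, normed by $|\mu|(V)$; $L^\infty(W)$ is the set of $f$ with $\|f\|_W=\sup|f|/W<\infty$. Definitions: $\theta_{0,S}=\sup_{x\in D}\inf\{\theta\ge0:\liminf_n\theta^{-n}S_n\mathbbm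 1_D(x)=0\}$; $j_S(x)=\inf\{\ell\ge0:\liminf_n n^{-\ell}\theta_{0,S}^{-n}S_n\mathbbm 1_D(x)=0\}$ (with $\inf\emptyset=0$). Assumption (A): $\theta_{0,S}\in(0,1]$, $j_S$ integer valued, and there exist $W_S:D\to[1,\infty)$, a finite or countable set $I_S$, probability measures $\nu_{S,i}\in\mathcal M(W_S)$, non-identically zero nonnegative $\eta_{S,i}\in L^\infty(W_S)$ with $\sum_i\eta_{S,i}\nu_{S,i}(W_S)\in L^\infty(W_S)$, and $\alpha_{S,n}\to0$, such that for all $f\in L^\infty(W_S)$, $n\ge1$, $x\in D$: $\big|\theta_{0,S}^{-n}n^{-j_S(x)}S_nf(x)-\sum_i\eta_{S,i}(x)\nu_{S,i}(f)\big|\le\alpha_{S,n}W_S(x)\|f\|_{W_S}$.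
   Formalization: It is additionally assumed that E_x(V(X_1)1_{1<τ_∂}) is finite for every x in D, not only for large V(x); if it is infinite at some x, Assumption (A) with W_S=V fails at n=1, f=V. *)

theory Defs
  imports "HOL-Analysis.Analysis"
begin

text \<open>A Markov chain on a countable space D + {cemetery} with absorbing cemetery is
  represented by its sub-stochastic transition kernel P on D (type 'a); the
  killing probability from x is 1 - sum_y P x y.  Functions are extended by 0
  at the cemetery, so the sub-Markov semigroup is given by the kernel powers.\<close>

definition sub_stochastic :: "('a \<Rightarrow> 'a \<Rightarrow> real) \<Rightarrow> bool" where
  "sub_stochastic P \<longleftrightarrow> (\<forall>x y. 0 \<le> P x y) \<and>
     (\<forall>x. P x summable_on UNIV \<and> (\<Sum>\<^sub>\<infinity>y. P x y) \<le> 1)"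

fun kpow :: "('a \<Rightarrow> 'a \<Rightarrow> real) \<Rightarrow> nat \<Rightarrow> 'a \<Rightarrow> 'a \<Rightarrow> real" where
  "kpow P 0 x y = (if x = y then 1 else 0)"
| "kpow P (Suc n) x y = (\<Sum>\<^sub>\<infinity>z. P x z * kpow P n z y)"

definition semigrp :: "('a \<Rightarrow> 'a \<Rightarrow> real) \<Rightarrow> nat \<Rightarrow> ('a \<Rightarrow> real) \<Rightarrow> 'a \<Rightarrow> real" where
  "semigrp P n f x = (\<Sum>\<^sub>\<infinity>y. kpow P n x y * f y)"

definition aperiodic_state :: "('a \<Rightarrow> 'a \<Rightarrow> real) \<Rightarrow> 'a \<Rightarrow> bool" where
  "aperiodic_state P x \<longleftrightarrow>
     (let R = {n::nat. n \<ge> 1 \<and> kpow P n x x > 0} in R = {} \<or> Gcd R = 1)"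

definition theta0 :: "('a \<Rightarrow> 'a \<Rightarrow> real) \<Rightarrow> real" where
  "theta0 P = Sup (range (\<lambda>x. Inf {\<theta>::real. \<theta> > 0 \<and>
       liminf (\<lambda>n. ereal (inverse \<theta> ^ n * semigrp P n (\<lambda>_. 1) x)) = 0}))"

definition jS :: "('a \<Rightarrow> 'a \<Rightarrow> real) \<Rightarrow> 'a \<Rightarrow> real" where
  "jS P x = (let L = {l::real. l \<ge> 0 \<and>
       liminf (\<lambda>n. ereal (real n powr (- l) * inverse (theta0 P) ^ n
                          * semigrp P n (\<lambda>_. 1) x)) = 0}
     in if L = {} then 0 else Inf L)"

definition Linf :: "('a \<Rightarrow> real) \<Rightarrow> ('a \<Rightarrow> real) \<Rightarrow> bool" where
  "Linf W f \<longleftrightarrow> (\<exists>C. \<forall>x. \<bar>f x\<bar> \<le> C * W x)"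

definition wnorm :: "('a \<Rightarrow> real) \<Rightarrow> ('a \<Rightarrow> real) \<Rightarrow> real" where
  "wnorm W f = Sup (range (\<lambda>x. \<bar>f x\<bar> / W x))"

text \<open>Measures on the countable set D are given by their point masses.\<close>
definition integ :: "('a \<Rightarrow> real) \<Rightarrow> ('a \<Rightarrow> real) \<Rightarrow> real" where
  "integ \<nu> f = (\<Sum>\<^sub>\<infinity>y. \<nu> y * f y)"

definition prob_in_MV :: "('a \<Rightarrow> real) \<Rightarrow> ('a \<Rightarrow> real) \<Rightarrow> bool" where
  "prob_in_MV W \<nu> \<longleftrightarrow> (\<forall>y. 0 \<le> \<nu> y) \<and> \<nu> summable_on UNIV \<and> (\<Sum>\<^sub>\<infinity>y. \<nu> y) = 1
      \<and> (\<lambda>y. \<nu> y * W y) summable_on UNIV"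

text \<open>Assumption (A) with weight W (countable index sets are taken inside nat).\<close>
definition assumption_A :: "('a \<Rightarrow> 'a \<Rightarrow> real) \<Rightarrow> ('a \<Rightarrow> real) \<Rightarrow> bool" where
  "assumption_A P W \<longleftrightarrow>
     0 < theta0 P \<and> theta0 P \<le> 1 \<and> (\<forall>x. jS P x \<in> \<nat>) \<and> (\<forall>x. W x \<ge> 1) \<and>
     (\<forall>f n x. Linf W f \<longrightarrow> (\<lambda>y. kpow P n x y * f y) summable_on UNIV) \<and>
     (\<exists>(I::nat set) (\<nu>::nat \<Rightarrow> 'a \<Rightarrow> real) (\<eta>::nat \<Rightarrow> 'a \<Rightarrow> real) (\<alpha>::nat \<Rightarrow> real).
        (\<forall>i\<in>I. prob_in_MV W (\<nu> i)) \<and>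
        (\<forall>i\<in>I. (\<forall>x. 0 \<le> \<eta> i x) \<and> (\<exists>x. \<eta> i x \<noteq> 0) \<and> Linf W (\<eta> i)) \<and>
        (\<forall>x. (\<lambda>i. \<eta> i x * integ (\<nu> i) W) summable_on I) \<and>
        Linf W (\<lambda>x. \<Sum>\<^sub>\<infinity>i\<in>I. \<eta> i x * integ (\<nu> i) W) \<and>
        \<alpha> \<longlonglongrightarrow> 0 \<and>
        (\<forall>f n x. Linf W f \<and> n \<ge> 1 \<longrightarrow>
           \<bar>inverse (theta0 P) ^ n * real n powr (- jS P x) * semigrp P n f x
             - (\<Sum>\<^sub>\<infinity>i\<in>I. \<eta> i x * integ (\<nu> i) f)\<bar> \<le> \<alpha> n * W x * wnorm W f))"

definition is_QSD :: "('a \<Rightarrow> 'a \<Rightarrow> real) \<Rightarrow> ('a \<Rightarrow> real) \<Rightarrow> bool" where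
  "is_QSD P \<nu> \<longleftrightarrow> (\<forall>y. 0 \<le> \<nu> y) \<and> \<nu> summable_on UNIV \<and> (\<Sum>\<^sub>\<infinity>y. \<nu> y) = 1 \<and>
     (\<forall>n. integ \<nu> (semigrp P n (\<lambda>_. 1)) > 0 \<and>
        (\<forall>y. integ \<nu> (\<lambda>x. kpow P n x y) / integ \<nu> (semigrp P n (\<lambda>_. 1)) = \<nu> y))"

definition cond_law :: "('a \<Rightarrow> 'a \<Rightarrow> real) \<Rightarrow> 'a \<Rightarrow> nat \<Rightarrow> 'a \<Rightarrow> real" where
  "cond_law P x n y = kpow P n x y / semigrp P n (\<lambda>_. 1) x"

end

theory Submission
  imports Defs
begin

text \<open>Outside a finite set K the kernel contracts V by a small factor e, so the generating functions of
  the paths that avoid K have radius of convergence at least 1/e, uniformly with respect to V. Adding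
  the states of K one at a time gives all generating functions as rational expressions in these, with
  geometric series 1/(1 - F) for the return times. Such a series has to diverge at its radius of
  convergence if that is below 1/e; hence F = 1 there, F converges beyond, and by aperiodicity the
  renewal theorem gives the exact exponential growth of the return probabilities. A path between states
  of different classes leaves the class of its starting point once, so convolution produces the
  asymptotics c l^n n^j. Finally every path is an excursion into K, a path between two states of K and
  an excursion out of K, and the geometric tails of the excursions make the convergence uniform.\<close>

section \<open>Nonnegative power series and their points of convergence\<close>

text \<open>The constant \<open>e\<close> is the resolution of the whole argument: excursions
  outside K are known only up to rate \<open>e\<close>, so growth at rates up to \<open>e\<close> is
  never resolved and everything of interest has to grow faster. The returns of \<open>x0\<close>
  guarantee this: with \<open>e\<close> a quarter of a return probability (capped at 1), the
  survival probability from \<open>x0\<close> must have a rate above \<open>e\<close>, and so must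
  \<open>theta0\<close>. The obstacle is reducibility. Starting points may differ in rate and in
  polynomial order, and \<open>theta0\<close> is a supremum that may exceed the rate of
  \<open>x0\<close>. The convergence theorem therefore keeps the rate and the set of starting points
  as parameters. It is applied at rate \<open>theta0\<close> to all states for Assumption (A), where
  states of smaller rate get order 0 and limit 0, and at the rate of \<open>x0\<close> to
  \<open>x0\<close> alone for the conditional laws. Nonnegative coefficients exclude cancellation.
  Hence the dichotomy "nothing above rate \<open>e\<close>, or exact asymptotics with a positive
  constant" survives sums and products, and convergence of a product is inherited by its nonzero
  factors.\<close>

definition nonneg_fps :: "real fps \<Rightarrow> bool" where
  "nonneg_fps a \<longleftrightarrow> (\<forall>n. 0 \<le> fps_nth a n)"

definition fps_summable :: "real fps \<Rightarrow> real \<Rightarrow> bool" where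
  "fps_summable a t \<longleftrightarrow> summable (\<lambda>n. fps_nth a n * t ^ n)"

definition fps_sum :: "real fps \<Rightarrow> real \<Rightarrow> real" where
  "fps_sum a t = (\<Sum>n. fps_nth a n * t ^ n)"

lemma nonneg_fpsD: "nonneg_fps a \<Longrightarrow> 0 \<le> fps_nth a n"
  by (simp add: nonneg_fps_def)

lemma nonneg_fps_0 [simp]: "nonneg_fps 0" and nonneg_fps_1 [simp]: "nonneg_fps 1"
  by (simp_all add: nonneg_fps_def)

lemma nonneg_fps_add: "nonneg_fps a \<Longrightarrow> nonneg_fps b \<Longrightarrow> nonneg_fps (a + b)"
  by (simp add: nonneg_fps_def)

lemma nonneg_fps_mult: "nonneg_fps a \<Longrightarrow> nonneg_fps b \<Longrightarrow> nonneg_fps (a * b)"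
  by (auto simp: nonneg_fps_def fps_mult_nth intro!: sum_nonneg)

lemma nonneg_fps_sum: "(\<And>x. x \<in> S \<Longrightarrow> nonneg_fps (f x)) \<Longrightarrow> nonneg_fps (sum f S)"
  by (auto simp: nonneg_fps_def fps_sum_nth intro!: sum_nonneg)

lemma nonneg_fps_nonzeroD:
  assumes "nonneg_fps a" "a \<noteq> 0"
  obtains k where "fps_nth a k > 0"
  using assms by (metis fps_nonzero_nth nonneg_fps_def order_le_less)

lemma fps_mult_nth_ge:
  assumes "nonneg_fps a" "nonneg_fps b"
  shows "fps_nth a i * fps_nth b j \<le> fps_nth (a * b) (i + j)"
proof -
  have "fps_nth a i * fps_nth b (i + j - i) \<le> (\<Sum>k=0..i+j. fps_nth a k * fps_nth b (i + j - k))"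
    by (rule member_le_sum) (use assms in \<open>auto simp: nonneg_fps_def\<close>)
  then show ?thesis by (simp add: fps_mult_nth)
qed

lemma fps_mult_nth_pow:
  "fps_nth (a * b) n * t ^ n = (\<Sum>i\<le>n. (fps_nth a i * t ^ i) * (fps_nth b (n - i) * (t::real) ^ (n - i)))"
proof -
  have "fps_nth a i * fps_nth b (n - i) * t ^ n =
      (fps_nth a i * t ^ i) * (fps_nth b (n - i) * t ^ (n - i))" if "i \<le> n" for i
    using that by (simp add: power_add [symmetric] mult_ac)
  then show ?thesis
    by (auto simp: fps_mult_nth sum_distrib_right atMost_atLeast0 intro!: sum.cong)
qed

lemma fps_summable_le:
  assumes "\<And>n. \<bar>fps_nth a n\<bar> \<le> fps_nth b n" "fps_summable b t" "0 \<le> t"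
  shows "fps_summable a t"
  unfolding fps_summable_def
proof (rule summable_comparison_test'[of "\<lambda>n. fps_nth b n * t ^ n" 0])
  show "summable (\<lambda>n. fps_nth b n * t ^ n)" using assms(2) by (simp add: fps_summable_def)
  show "norm (fps_nth a n * t ^ n) \<le> fps_nth b n * t ^ n" for n
    using mult_right_mono[OF assms(1)[of n], of "t ^ n"] assms(3) by (simp add: abs_mult)
qed

lemma fps_summable_mono:
  assumes "nonneg_fps a" "fps_summable a t" "0 \<le> s" "s \<le> t"
  shows "fps_summable a s"
  unfolding fps_summable_def
proof (rule summable_comparison_test'[of "\<lambda>n. fps_nth a n * t ^ n" 0])
  show "summable (\<lambda>n. fps_nth a n * t ^ n)" using assms(2) by (simp add: fps_summable_def)
  fix n
  show "norm (fps_nth a n * s ^ n) \<le> fps_nth a n * t ^ n"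
    using mult_left_mono[OF power_mono[OF assms(4,3), of n] nonneg_fpsD[OF assms(1), of n]]
      nonneg_fpsD[OF assms(1), of n] assms(3) by (simp add: abs_mult)
qed

lemma fps_summable_0: "fps_summable a 0"
  unfolding fps_summable_def by (rule summable_finite[of "{0}"]) auto

lemma fps_summable_add: "fps_summable a t \<Longrightarrow> fps_summable b t \<Longrightarrow> fps_summable (a + b) t"
  unfolding fps_summable_def by (drule (1) summable_add) (simp add: algebra_simps)

lemma fps_summable_abs:
  assumes "nonneg_fps a" "fps_summable a t" "0 \<le> t"
  shows "summable (\<lambda>n. norm (fps_nth a n * t ^ n))"
  using assms by (simp add: fps_summable_def nonneg_fps_def abs_mult)

lemma
  assumes "nonneg_fps a" "nonneg_fps b" "fps_summable a t" "fps_summable b t" "0 \<le> t"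
  shows fps_summable_mult: "fps_summable (a * b) t"
    and fps_sum_mult: "fps_sum (a * b) t = fps_sum a t * fps_sum b t"
proof -
  note ab = fps_summable_abs[OF assms(1,3,5)] fps_summable_abs[OF assms(2,4,5)]
  show "fps_summable (a * b) t"
    using summable_Cauchy_product[OF ab] by (simp only: fps_summable_def fps_mult_nth_pow)
  show "fps_sum (a * b) t = fps_sum a t * fps_sum b t"
    using Cauchy_product[OF ab] by (simp only: fps_sum_def fps_mult_nth_pow)
qed

lemma fps_sum_ge_nth:
  assumes "nonneg_fps a" "fps_summable a t" "0 \<le> t"
  shows "fps_nth a k * t ^ k \<le> fps_sum a t"
  using sum_le_suminf[of "\<lambda>n. fps_nth a n * t ^ n" "{k}"] assms
  by (auto simp: fps_sum_def fps_summable_def nonneg_fps_def)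

text \<open>Where \<open>fps_nth b k > 0\<close>, the coefficient of \<open>a * b\<close> at
  \<open>n + k\<close> dominates a fixed multiple of that of \<open>a\<close> at \<open>n\<close>,
  because nothing cancels.\<close>

lemma fps_summable_mult_factor:
  assumes "nonneg_fps a" "nonneg_fps b" "fps_summable (a * b) t" "0 < t" "b \<noteq> 0"
  shows "fps_summable a t"
proof -
  obtain k where k: "fps_nth b k > 0" using assms nonneg_fps_nonzeroD by blast
  have *: "summable (\<lambda>n. fps_nth (a * b) (n + k) * t ^ (n + k))"
    using assms(3) summable_iff_shift[of "\<lambda>n. fps_nth (a * b) n * t ^ n" k] by (simp add: fps_summable_def)
  have "summable (\<lambda>n. (fps_nth b k * t ^ k) * (fps_nth a n * t ^ n))"
  proof (rule summable_comparison_test'[OF *, of 0])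
    fix n
    have "fps_nth a n * fps_nth b k * t ^ (n + k) \<le> fps_nth (a * b) (n + k) * t ^ (n + k)"
      using assms by (intro mult_right_mono fps_mult_nth_ge) auto
    then show "norm (fps_nth b k * t ^ k * (fps_nth a n * t ^ n)) \<le> fps_nth (a * b) (n + k) * t ^ (n + k)"
      using assms k by (simp add: nonneg_fpsD power_add mult_ac abs_mult)
  qed
  then show ?thesis using k assms by (simp add: fps_summable_def)
qed

section \<open>Geometric series and the renewal equation\<close>

lemma one_minus_fps_unit:
  fixes f :: "real fps"
  assumes "fps_nth f 0 = 0" shows "(1 - f) * inverse (1 - f) = 1"
  using assms by (simp add: inverse_mult_eq_1')

lemma geom_fps_rec:
  fixes f u :: "real fps"
  assumes "(1 - f) * u = 1" shows "u = 1 + f * u"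
  using assms by (simp add: algebra_simps)

lemma fps_nth_rec:
  fixes f u :: "real fps"
  assumes "(1 - f) * u = 1" "fps_nth f 0 = 0"
  shows "fps_nth u n = (if n = 0 then 1 else \<Sum>i=0..n. fps_nth f i * fps_nth u (n - i))"
  by (subst geom_fps_rec[OF assms(1)]) (auto simp: fps_mult_nth assms)

lemma geom_fps_nonneg:
  assumes "nonneg_fps f" "fps_nth f 0 = 0" "(1 - f) * u = 1"
  shows "nonneg_fps u"
proof -
  have "0 \<le> fps_nth u n" for n
  proof (induction n rule: less_induct)
    case (less n)
    have "0 \<le> fps_nth f i * fps_nth u (n - i)" if "i \<le> n" "n \<noteq> 0" for i
      using less[of "n - i"] assms that by (cases "i = 0") (auto simp: nonneg_fps_def)
    then show ?case
      by (subst fps_nth_rec[OF assms(3,2)]) (auto intro!: sum_nonneg)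
  qed
  then show ?thesis by (simp add: nonneg_fps_def)
qed

lemma geom_fps_ge:
  assumes "nonneg_fps f" "fps_nth f 0 = 0" "(1 - f) * u = 1"
  shows "fps_nth f n \<le> fps_nth u n"
proof -
  have "nonneg_fps u" using geom_fps_nonneg assms by blast
  moreover have "fps_nth u 0 = 1" using fps_nth_rec[OF assms(3,2), of 0] by simp
  ultimately have "fps_nth f n \<le> fps_nth (f * u) n"
    using fps_mult_nth_ge[of f u n 0] assms by simp
  then have "fps_nth f n \<le> fps_nth (1 + f * u) n" using assms(2) by (cases "n = 0") auto
  also have "1 + f * u = u" by (rule geom_fps_rec[OF assms(3), symmetric])
  finally show ?thesis .
qed

text \<open>Evaluating \<open>u = 1 + f * u\<close> at \<open>t\<close> gives (1 - f(t)) u(t) = 1,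
  and u(t) \<ge> 1 forces f(t) < 1. Conversely the partial sums U of \<open>u\<close> satisfy U
  \<le> 1 + f(t) U, so they are bounded by 1 / (1 - f(t)).\<close>

lemma geom_fps_summable_iff:
  assumes "nonneg_fps f" "fps_nth f 0 = 0" "(1 - f) * u = 1" "0 \<le> t"
  shows "fps_summable u t \<longleftrightarrow> fps_summable f t \<and> fps_sum f t < 1"
proof
  have u: "nonneg_fps u" using geom_fps_nonneg assms by blast
  have u0: "fps_nth u 0 = 1" using fps_nth_rec[OF assms(3,2), of 0] by simp
  {
    assume ut: "fps_summable u t"
    have ft: "fps_summable f t"
      by (rule fps_summable_le[OF _ ut assms(4)])
         (use geom_fps_ge[OF assms(1,2,3)] assms in \<open>auto simp: nonneg_fps_def\<close>)
    have "fps_sum u t = fps_sum (1 + f * u) t"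
      by (rule arg_cong[OF geom_fps_rec[OF assms(3)]])
    also have "\<dots> = 1 + fps_sum (f * u) t"
      using suminf_add[of "\<lambda>n. fps_nth 1 n * t ^ n" "\<lambda>n. fps_nth (f * u) n * t ^ n"]
        fps_summable_mult[OF assms(1) u ft ut assms(4)]
        summable_finite[of "{0}" "\<lambda>n. fps_nth 1 n * t ^ n"] suminf_finite[of "{0}" "\<lambda>n. fps_nth 1 n * t ^ n"]
      by (auto simp: fps_sum_def fps_summable_def algebra_simps)
    also have "\<dots> = 1 + fps_sum f t * fps_sum u t"
      using fps_sum_mult[OF assms(1) u ft ut assms(4)] by simp
    finally have "(1 - fps_sum f t) * fps_sum u t = 1" by (simp add: algebra_simps)
    moreover have "fps_sum u t \<ge> 1"
      using fps_sum_ge_nth[OF u ut assms(4), of 0] u0 by simp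
    ultimately have "fps_sum f t < 1"
      using mult_nonpos_nonneg[of "1 - fps_sum f t" "fps_sum u t"] by linarith
    then show "fps_summable f t \<and> fps_sum f t < 1" using ft by simp
  }
  {
    assume *: "fps_summable f t \<and> fps_sum f t < 1"
    let ?U = "\<lambda>N. \<Sum>n\<le>N. fps_nth u n * t ^ n"
    have pos: "0 \<le> fps_nth u n * t ^ n" "0 \<le> fps_nth f n * t ^ n" for n
      using u assms by (auto simp: nonneg_fps_def)
    have bound: "?U N \<le> 1 + fps_sum f t * ?U N" for N
    proof -
      have "?U N = (\<Sum>n\<le>N. fps_nth (1 + f * u) n * t ^ n)"
        by (rule arg_cong[OF geom_fps_rec[OF assms(3)]])
      also have "\<dots> = 1 + (\<Sum>n\<le>N. fps_nth (f * u) n * t ^ n)"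
      proof -
        have "(\<Sum>n\<le>N. fps_nth (1 :: real fps) n * t ^ n) = (\<Sum>n\<in>{0}. fps_nth 1 n * t ^ n)"
          by (rule sum.mono_neutral_right) auto
        then show ?thesis by (simp add: algebra_simps sum.distrib)
      qed
      also have "(\<Sum>n\<le>N. fps_nth (f * u) n * t ^ n) =
          (\<Sum>n\<le>N. \<Sum>i\<le>n. (fps_nth f i * t ^ i) * (fps_nth u (n - i) * t ^ (n - i)))"
        by (simp only: fps_mult_nth_pow)
      also have "\<dots> = (\<Sum>(i, j)\<in>{(i, j). i + j \<le> N}. (fps_nth f i * t ^ i) * (fps_nth u j * t ^ j))"
        by (rule sum.triangle_reindex_eq [symmetric])
      \<comment> \<open>The triangle \<open>i + j \<le> N\<close> is enlarged to a square, on which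
        the double sum factorises.\<close>
      also have "\<dots> \<le> (\<Sum>(i, j)\<in>{..N} \<times> {..N}. (fps_nth f i * t ^ i) * (fps_nth u j * t ^ j))"
        by (rule sum_mono2) (auto intro!: mult_nonneg_nonneg pos)
      also have "\<dots> = (\<Sum>i\<le>N. fps_nth f i * t ^ i) * ?U N"
        by (simp add: sum_product sum.cartesian_product)
      also have "\<dots> \<le> fps_sum f t * ?U N"
        using * pos unfolding fps_sum_def fps_summable_def
        by (intro mult_right_mono sum_le_suminf sum_nonneg) auto
      finally show ?thesis by simp
    qed
    have "?U N \<le> 1 / (1 - fps_sum f t)" for N
      using bound[of N] * by (simp add: field_simps)
    then show "fps_summable u t"
      unfolding fps_summable_def
      by (intro bounded_imp_summable[where B = "1 / (1 - fps_sum f t)"] pos)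
  }
qed

text \<open>Nonnegative series whose domain of convergence inside [0, r) is relatively open: they have
  to diverge at their radius of convergence if it is smaller than r. Unlike meromorphy, this
  property passes through sums, products and geometric series without complex analysis.\<close>

definition open_conv :: "real \<Rightarrow> real fps \<Rightarrow> bool" where
  "open_conv r a \<longleftrightarrow> nonneg_fps a \<and>
     (\<forall>t. 0 \<le> t \<and> t < r \<and> fps_summable a t \<longrightarrow> (\<exists>t'>t. fps_summable a t'))"

lemma open_convD: "open_conv r a \<Longrightarrow> 0 \<le> t \<Longrightarrow> t < r \<Longrightarrow> fps_summable a t \<Longrightarrow> \<exists>t'>t. fps_summable a t'"
  and open_conv_nonneg: "open_conv r a \<Longrightarrow> nonneg_fps a"
  by (auto simp: open_conv_def)

lemma open_conv_radius:
  assumes "nonneg_fps a" "\<And>t. 0 \<le> t \<Longrightarrow> t < r \<Longrightarrow> fps_summable a t"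
  shows "open_conv r a"
  unfolding open_conv_def
proof (intro conjI allI impI)
  fix t assume t: "0 \<le> t \<and> t < r \<and> fps_summable a t"
  then obtain t' where "t < t'" "t' < r" using dense by blast
  then show "\<exists>t'>t. fps_summable a t'" using assms(2)[of t'] t by auto
qed (rule assms)

lemma open_conv_common:
  assumes "open_conv r a" "open_conv r b" "0 \<le> t" "t < r" "fps_summable a t" "fps_summable b t"
  obtains t' where "t' > t" "fps_summable a t'" "fps_summable b t'"
proof -
  obtain s where s: "s > t" "fps_summable a s" using assms open_convD by blast
  obtain v where v: "v > t" "fps_summable b v" using assms open_convD by blast
  have "fps_summable a (min s v)"
    by (rule fps_summable_mono[OF open_conv_nonneg[OF assms(1)] s(2)]) (use s v assms in auto)
  moreover have "fps_summable b (min s v)"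
    by (rule fps_summable_mono[OF open_conv_nonneg[OF assms(2)] v(2)]) (use s v assms in auto)
  moreover have "min s v > t" using s v by simp
  ultimately show ?thesis using that by blast
qed

lemma open_conv_0: "open_conv r 0"
  by (rule open_conv_radius) (auto simp: fps_summable_def)

lemma open_conv_add:
  assumes "open_conv r a" "open_conv r b"
  shows "open_conv r (a + b)"
  unfolding open_conv_def
proof (intro conjI allI impI)
  note nn = assms[THEN open_conv_nonneg]
  show "nonneg_fps (a + b)" using nn nonneg_fps_add by blast
  fix t assume t: "0 \<le> t \<and> t < r \<and> fps_summable (a + b) t"
  have "fps_summable a t" "fps_summable b t"
    using t nn by (auto intro!: fps_summable_le[of _ "a + b"] simp: nonneg_fps_def)
  then obtain t' where "t' > t" "fps_summable a t'" "fps_summable b t'"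
    using open_conv_common assms t by blast
  then show "\<exists>t'>t. fps_summable (a + b) t'" using fps_summable_add by blast
qed

text \<open>A product of nonzero nonnegative series converges at \<open>t > 0\<close> exactly when
  both factors do. A zero factor is split off, since the product then says nothing about the other
  factor.\<close>

lemma open_conv_mult:
  assumes "open_conv r a" "open_conv r b"
  shows "open_conv r (a * b)"
proof (cases "a = 0 \<or> b = 0")
  case True then show ?thesis by (auto simp: open_conv_0)
next
  case False
  note nn = assms[THEN open_conv_nonneg]
  show ?thesis unfolding open_conv_def
  proof (intro conjI allI impI)
    show "nonneg_fps (a * b)" using nn nonneg_fps_mult by blast
    fix t assume t: "0 \<le> t \<and> t < r \<and> fps_summable (a * b) t"
    have "fps_summable a t \<and> fps_summable b t"
    proof (cases "t = 0")
      case True then show ?thesis by (simp add: fps_summable_0)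
    next
      case F: False
      then show ?thesis
        using fps_summable_mult_factor[OF nn] fps_summable_mult_factor[OF nn(2,1)] t False
        by (simp add: mult.commute)
    qed
    then obtain t' where "t' > t" "fps_summable a t'" "fps_summable b t'"
      using open_conv_common assms t by blast
    then show "\<exists>t'>t. fps_summable (a * b) t'"
      using fps_summable_mult[OF nn] t by (meson order_trans less_imp_le)
  qed
qed

lemma isCont_fps_sum:
  assumes "fps_summable a s" "0 \<le> t" "t < s"
  shows "isCont (fps_sum a) t"
  using isCont_powser[of "fps_nth a" s t] assms
  unfolding fps_summable_def fps_sum_def by simp

text \<open>Convergence of \<open>u\<close> at \<open>t\<close> means that \<open>f\<close>
  converges there with f(t) < 1. The strict inequality persists slightly to the right of
  \<open>t\<close>, because \<open>f\<close> converges beyond \<open>t\<close> and is therefore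
  continuous at \<open>t\<close>.\<close>

lemma open_conv_geom:
  assumes "open_conv r f" "fps_nth f 0 = 0" "(1 - f) * u = 1"
  shows "open_conv r u"
  unfolding open_conv_def
proof (intro conjI allI impI)
  have nn: "nonneg_fps f" using assms open_conv_nonneg by blast
  note iff = geom_fps_summable_iff[OF nn assms(2,3)]
  show "nonneg_fps u" using geom_fps_nonneg nn assms by blast
  fix t assume t: "0 \<le> t \<and> t < r \<and> fps_summable u t"
  then have ft: "fps_summable f t" "fps_sum f t < 1" using iff by auto
  then obtain s where s: "s > t" "fps_summable f s" using assms open_convD t by blast
  have "eventually (\<lambda>v. fps_sum f v < 1) (at t)"
    using isCont_fps_sum[OF s(2)] t s ft(2)
    by (auto simp: isCont_def intro: order_tendstoD)
  then have "eventually (\<lambda>v. fps_sum f v < 1) (at_right t)"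
    by (rule filter_leD[OF at_le, rotated]) auto
  moreover have "eventually (\<lambda>v. v < s) (at_right t)" "eventually (\<lambda>v. t < v) (at_right t)"
    using s by (auto intro: eventually_at_right_less order_tendstoD(2)[OF tendsto_ident_at])
  ultimately have "eventually (\<lambda>v. fps_sum f v < 1 \<and> v < s \<and> t < v) (at_right t)"
    by eventually_elim auto
  then obtain v where v: "fps_sum f v < 1" "v < s" "t < v"
    using eventually_happens'[of "at_right t"] by force
  then have "fps_summable u v"
    using iff[of v] fps_summable_mono[OF nn s(2), of v] t by auto
  then show "\<exists>t'>t. fps_summable u t'" using v by blast
qed

text \<open>\<open>\<rho>\<close> is the supremum of the points where \<open>u\<close> converges.
  Openness makes \<open>u\<close> diverge at \<open>\<rho>\<close> itself, so f(\<rho>) < 1 is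
  impossible, while the bound by 1 survives in the limit from the left. Openness of \<open>f\<close>
  supplies \<open>s > \<rho>\<close>, the exponential moment that the renewal theorem needs.\<close>

lemma geom_fps_critical:
  assumes f: "open_conv r f" "fps_nth f 0 = 0" "(1 - f) * u = 1"
    and "0 \<le> t" "t < r" "\<not> fps_summable u t"
  obtains \<rho> s where "0 < \<rho>" "\<rho> \<le> t" "\<rho> < s" "fps_summable f s" "fps_sum f \<rho> = 1"
proof -
  have nn: "nonneg_fps f" using f open_conv_nonneg by blast
  note iff = geom_fps_summable_iff[OF nn f(2,3)]
  have ou: "open_conv r u" using open_conv_geom f by blast
  then have nu: "nonneg_fps u" by (rule open_conv_nonneg)
  define S where "S = {v. 0 \<le> v \<and> fps_summable u v}"
  define \<rho> where "\<rho> = Sup S"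
  have S0: "0 \<in> S" by (simp add: S_def fps_summable_0)
  have St: "v < t" if "v \<in> S" for v
    using that assms fps_summable_mono[OF nu] by (force simp: S_def)
  then have bdd: "bdd_above S" by (auto simp: bdd_above_def intro!: exI[of _ t] less_imp_le)
  have \<rho>t: "\<rho> \<le> t" unfolding \<rho>_def using S0 St by (intro cSup_least) (auto intro: less_imp_le)
  have \<rho>0: "0 \<le> \<rho>" unfolding \<rho>_def using S0 bdd by (rule cSup_upper)
  have not: "\<not> fps_summable u \<rho>"
  proof
    assume "fps_summable u \<rho>"
    then obtain v where "v > \<rho>" "fps_summable u v"
      using open_convD[OF ou \<rho>0] \<rho>t assms by force
    then have "v \<in> S" "v > \<rho>" using \<rho>0 by (auto simp: S_def)
    then show False unfolding \<rho>_def using cSup_upper[OF _ bdd] by force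
  qed
  then have "\<rho> > 0" using \<rho>0 fps_summable_0[of u] by (cases "\<rho> = 0") auto
  have less: "fps_summable u v" if v: "0 \<le> v" "v < \<rho>" for v
  proof -
    obtain w where "w \<in> S" "v < w"
      using less_cSup_iff[of S v] S0 bdd v unfolding \<rho>_def by auto
    then show ?thesis using fps_summable_mono[OF nu, of w v] v by (auto simp: S_def)
  qed
  have pos: "0 \<le> fps_nth f n * v ^ n" if "0 \<le> v" for n v
    using nn that by (simp add: nonneg_fps_def)
  \<comment> \<open>Finite partial sums are polynomials, so the bound by 1 valid to the left of
    \<open>\<rho>\<close> extends to \<open>\<rho>\<close>.\<close>
  have partial: "(\<Sum>n<N. fps_nth f n * \<rho> ^ n) \<le> 1" for N
  proof (rule tendsto_upperbound)
    show "((\<lambda>v. \<Sum>n<N. fps_nth f n * v ^ n) \<longlongrightarrow> (\<Sum>n<N. fps_nth f n * \<rho> ^ n)) (at_left \<rho>)"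
      by (intro tendsto_intros)
    have "eventually (\<lambda>v. v \<in> {0<..<\<rho>}) (at_left \<rho>)"
      using eventually_at_left_real[OF \<open>\<rho> > 0\<close>] .
    then show "eventually (\<lambda>v. (\<Sum>n<N. fps_nth f n * v ^ n) \<le> 1) (at_left \<rho>)"
    proof eventually_elim
      case (elim v)
      then have "fps_summable f v" "fps_sum f v < 1" using less[of v] iff[of v] by auto
      moreover have "(\<Sum>n<N. fps_nth f n * v ^ n) \<le> fps_sum f v"
        using pos[of v] elim calculation unfolding fps_sum_def fps_summable_def
        by (intro sum_le_suminf) auto
      ultimately show ?case by simp
    qed
  qed auto
  have f\<rho>: "fps_summable f \<rho>" unfolding fps_summable_def
  proof (rule bounded_imp_summable[where B = 1])
    show "(\<Sum>k\<le>n. fps_nth f k * \<rho> ^ k) \<le> 1" for n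
      using partial[of "Suc n"] by (simp only: lessThan_Suc_atMost)
  qed (use pos \<rho>0 in auto)
  then have "fps_sum f \<rho> \<le> 1" unfolding fps_sum_def fps_summable_def
    using suminf_le_const[OF _ partial] by blast
  moreover have "\<not> fps_sum f \<rho> < 1" using not iff f\<rho> \<rho>0 by blast
  ultimately have "fps_sum f \<rho> = 1" by simp
  moreover obtain s where "s > \<rho>" "fps_summable f s"
    using open_convD[OF f(1) \<rho>0 _ f\<rho>] \<rho>t assms by auto
  ultimately show ?thesis using that \<open>\<rho> > 0\<close> \<rho>t by blast
qed

section \<open>The renewal theorem\<close>

text \<open>The least positive difference \<open>d\<close> of two members of \<open>S\<close>
  divides every member, so it is 1. With \<open>a\<close> and \<open>a + 1\<close> both in
  \<open>S\<close>, every large \<open>n\<close> is a sum of copies of these two.\<close>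

lemma additive_set_eventually_all:
  fixes S :: "nat set"
  assumes add: "\<And>m n. m \<in> S \<Longrightarrow> n \<in> S \<Longrightarrow> m + n \<in> S" and gcd: "Gcd S = 1"
  shows "\<exists>N. \<forall>n\<ge>N. n \<in> S"
proof -
  have mult: "k * m \<in> S" if "m \<in> S" "k > 0" for k m
    using that(2,1) by (induction k rule: nat_induct_non_zero) (auto intro: add)
  have ex: "\<exists>m\<in>S. m > 0"
  proof (rule ccontr)
    assume "\<not> ?thesis"
    then have "S \<subseteq> {0}" by auto
    then have "Gcd S = 0" by (simp add: Gcd_0_iff)
    then show False using gcd by simp
  qed
  then obtain m0 where m0: "m0 \<in> S" "m0 > 0" by blast
  define D where "D = {d. d > 0 \<and> (\<exists>a\<in>S. a + d \<in> S)}"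
  have "m0 \<in> D" using m0 add[of m0 m0] by (auto simp: D_def)
  define d where "d = (LEAST d. d \<in> D)"
  have dD: "d \<in> D" unfolding d_def using \<open>m0 \<in> D\<close> by (rule LeastI)
  have dmin: "d \<le> e" if "e \<in> D" for e unfolding d_def using that by (rule Least_le)
  obtain a where a: "a \<in> S" "a + d \<in> S" "d > 0" using dD by (auto simp: D_def)
  have "d dvd n" if n: "n \<in> S" for n
  proof (rule ccontr)
    assume "\<not> d dvd n"
    then have r: "0 < n mod d" "n mod d < d" using a by (auto simp: mod_greater_zero_iff_not_dvd)
    define q where "q = n div d"
    have "n = q * d + n mod d" by (simp add: q_def)
    \<comment> \<open>Two members of \<open>S\<close> at distance \<open>d - n mod d\<close>, which
      is positive and smaller than \<open>d\<close>: a contradiction to minimality.\<close>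
    then have "(q + 1) * (a + d) + a = ((q + 1) * a + n + a) + (d - n mod d)"
      using r by (simp add: algebra_simps)
    moreover have "(q + 1) * (a + d) + a \<in> S" "(q + 1) * a + n + a \<in> S"
      using a n by (auto intro!: add mult simp del: mult_Suc)
    ultimately have "d - n mod d \<in> D" using r by (auto simp: D_def)
    then show False using dmin[of "d - n mod d"] r by simp
  qed
  then have "d dvd Gcd S" by (rule Gcd_greatest)
  then have d1: "d = 1" using gcd by simp
  have "n \<in> S" if n: "n \<ge> (a + 1) * (a + 1)" for n
  proof -
    show ?thesis
    proof (cases "a = 0")
      case True
      then show ?thesis using mult[of 1 n] a d1 n by simp
    next
      case False
      define k where "k = n div a"
      define l where "l = n mod a"
      have "l < a" "n = k * a + l" using False by (auto simp: k_def l_def)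
      have "k \<ge> a" unfolding k_def using n False
        by (simp add: less_eq_div_iff_mult_less_eq)
      then have kl: "k - l > 0" using \<open>l < a\<close> by simp
      \<comment> \<open>Of the \<open>k\<close> summands \<open>a\<close> in
        \<open>n = k * a + l\<close>, \<open>l\<close> are raised to \<open>a + 1\<close>; this is
        possible because \<open>l < a \<le> k\<close>.\<close>
      have n_eq: "n = (k - l) * a + l * (a + 1)"
      proof -
        have "(k - l) * a + l * a = k * a" using kl by (simp add: add_mult_distrib [symmetric])
        then show ?thesis using \<open>n = k * a + l\<close> by (simp add: algebra_simps)
      qed
      have "(k - l) * a \<in> S" using mult[of a "k - l"] kl a by blast
      moreover have "l = 0 \<or> l * (a + 1) \<in> S" using mult[of "a + 1" l] a d1 by (cases "l = 0") auto
      ultimately show ?thesis using add n_eq by (metis add.right_neutral mult_zero_left)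
    qed
  qed
  then show ?thesis by blast
qed

lemma eventually_gt_nat:
  "filterlim g at_top F \<Longrightarrow> eventually (\<lambda>i. g i > (n :: nat)) F"
  by (simp add: filterlim_at_top eventually_mono Suc_le_eq [symmetric])

text \<open>Erdos-Feller-Pollard: along a subsequence that realises the upper limit, a weighted average
  can only be extremal if each of its terms is.\<close>

lemma renewal_extremal_shift:
  fixes f v :: "nat \<Rightarrow> real"
  assumes f: "\<And>n. 0 \<le> f n" "f sums 1" "f m > 0"
    and v: "\<And>n. \<bar>v n\<bar> \<le> M" "\<And>n. n > 0 \<Longrightarrow> v n = (\<Sum>i\<le>n. f i * v (n - i))"
    and up: "\<And>e. e > 0 \<Longrightarrow> eventually (\<lambda>n. v n < L + e) sequentially"
    and g: "filterlim g at_top sequentially" "(\<lambda>i. v (g i)) \<longlonglongrightarrow> L"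
  shows "(\<lambda>i. v (g i - m)) \<longlonglongrightarrow> L"
proof (rule tendstoI)
  fix e :: real assume "e > 0"
  have M: "0 \<le> M" using v(1)[of 0] by linarith
  \<comment> \<open>Four losses add up to \<open>d * C\<close>: \<open>d\<close> from
    \<open>v n > L - d\<close>, \<open>d\<close> from the head terms being only below
    \<open>L + d\<close>, \<open>d\<close> times |L| from the weight missing in the head, and
    \<open>d * M\<close> from the tail.\<close>
  define C where "C = \<bar>L\<bar> + 2 + M"
  have C: "C > 0" using M by (simp add: C_def)
  define d where "d = min 1 (e / 2 * f m / C)"
  have d: "d > 0" "d \<le> 1" "d * C < e * f m"
  proof -
    show "d > 0" "d \<le> 1" using \<open>e > 0\<close> f C by (auto simp: d_def)
    have "d * C \<le> e / 2 * f m" using C by (simp add: d_def min_def field_simps)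
    also have "\<dots> < e * f m" using \<open>e > 0\<close> f by simp
    finally show "d * C < e * f m" .
  qed
  have "eventually (\<lambda>N. (\<Sum>i\<le>N. f i) > 1 - d) sequentially"
    using f(2) d(1) by (auto simp: sums_def_le intro: order_tendstoD)
  moreover have "eventually (\<lambda>N. N \<ge> m) sequentially" by (rule eventually_ge_at_top)
  ultimately have "eventually (\<lambda>N. (\<Sum>i\<le>N. f i) > 1 - d \<and> N \<ge> m) sequentially"
    by (rule eventually_conj)
  then obtain N where N: "(\<Sum>i\<le>N. f i) > 1 - d" "N \<ge> m"
    using eventually_happens'[OF sequentially_bot] by blast
  obtain n0 where n0: "\<And>n. n \<ge> n0 \<Longrightarrow> v n < L + d"
    using up[OF d(1)] by (auto simp: eventually_sequentially)
  have part: "(\<Sum>i\<in>A. f i) \<le> 1" if "finite A" for A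
    using f sum_le_suminf[of f A] that by (auto simp: sums_iff)
  \<comment> \<open>The term \<open>f m * v (n - m)\<close> is isolated in the recursion. The other
    values in the head are at most \<open>L + d\<close> and the tail has weight at most
    \<open>d\<close>, so \<open>v (n - m)\<close> cannot fall far below \<open>L\<close>.\<close>
  have key: "v (n - m) > L - e" if n: "n > n0 + N" "v n > L - d" for n
  proof -
    let ?r = "\<Sum>i\<in>{N<..n}. f i" and ?t = "\<Sum>i\<in>{N<..n}. f i * v (n - i)"
    let ?s = "\<Sum>i\<in>{..N} - {m}. f i * v (n - i)"
    define \<sigma> where "\<sigma> = (\<Sum>i\<in>{..N} - {m}. f i)"
    have sp: "(\<Sum>i\<le>N. f i) = f m + \<sigma>"
      unfolding \<sigma>_def using N by (subst sum.remove[of _ m]) auto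
    have s1: "f m + \<sigma> \<le> 1" using part[of "{..N}"] sp by simp
    have s2: "f m + \<sigma> > 1 - d" using N sp by simp
    have s0: "0 \<le> \<sigma>" unfolding \<sigma>_def using f by (intro sum_nonneg) auto
    have split: "{..n} = {..N} \<union> {N<..n}" using n by auto
    have "v n = (\<Sum>i\<le>N. f i * v (n - i)) + ?t"
    proof -
      have "v n = (\<Sum>i\<in>{..N} \<union> {N<..n}. f i * v (n - i))"
        using v(2)[of n] n split by simp
      then show ?thesis by (subst (asm) sum.union_disjoint) auto
    qed
    also have "(\<Sum>i\<le>N. f i * v (n - i)) = f m * v (n - m) + ?s"
      using N by (subst sum.remove[of _ m]) auto
    also have "?s \<le> (\<Sum>i\<in>{..N} - {m}. f i * (L + d))"
      using f n0 n by (intro sum_mono mult_left_mono) (auto intro: less_imp_le)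
    also have "\<dots> = \<sigma> * (L + d)" by (simp add: \<sigma>_def sum_distrib_right)
    also have "?t \<le> (\<Sum>i\<in>{N<..n}. f i * M)"
      using f v(1) by (intro sum_mono mult_left_mono) (auto intro: abs_le_D1)
    also have "\<dots> = ?r * M" by (simp add: sum_distrib_right)
    also have "\<dots> \<le> d * M"
    proof (rule mult_right_mono[OF _ M])
      have "(\<Sum>i\<le>N. f i) + ?r = (\<Sum>i\<le>n. f i)"
        unfolding split by (subst sum.union_disjoint) auto
      then show "?r \<le> d" using part[of "{..n}"] N by simp
    qed
    finally have 1: "v n \<le> f m * v (n - m) + \<sigma> * (L + d) + d * M" by simp
    have 2: "\<sigma> * L \<le> (1 - f m) * L + d * \<bar>L\<bar>"
    proof -
      have "(\<sigma> - (1 - f m)) * L \<le> \<bar>\<sigma> - (1 - f m)\<bar> * \<bar>L\<bar>" by (metis abs_ge_self abs_mult)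
      also have "\<dots> \<le> d * \<bar>L\<bar>" using s1 s2 by (intro mult_right_mono) auto
      finally show ?thesis by (simp add: algebra_simps)
    qed
    have "\<sigma> \<le> 1" using s1 f(1)[of m] by simp
    then have 3: "\<sigma> * d \<le> d" using d(1) by (simp add: mult_left_le_one_le s0)
    have "f m * (L - v (n - m)) \<le> d * C"
      using 1 2 3 n(2) by (simp add: C_def algebra_simps)
    also have "\<dots> < f m * e" using d by (simp add: mult.commute)
    finally show ?thesis using f(3) by (simp add: mult_less_cancel_left_pos)
  qed
  have "eventually (\<lambda>i. g i > n0 + N + m) sequentially"
    using g(1) by (rule eventually_gt_nat)
  moreover have "eventually (\<lambda>i. v (g i) > L - d) sequentially"
    using g(2) d(1) by (auto intro: order_tendstoD)
  moreover have "eventually (\<lambda>n. v n < L + e) sequentially" using up \<open>e > 0\<close> .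
  then obtain n1 where n1: "\<And>n. n \<ge> n1 \<Longrightarrow> v n < L + e" by (auto simp: eventually_sequentially)
  have "eventually (\<lambda>i. g i > n1 + m) sequentially"
    using g(1) by (rule eventually_gt_nat)
  ultimately show "eventually (\<lambda>i. dist (v (g i - m)) L < e) sequentially"
  proof eventually_elim
    case (elim i)
    then have "v (g i - m) > L - e" "v (g i - m) < L + e"
      using key[of "g i"] n1[of "g i - m"] by auto
    then show ?case by (simp add: dist_real_def abs_less_iff)
  qed
qed

text \<open>The upper limit is attained along \<open>g\<close>. If \<open>u n > 0\<close>, then
  \<open>n\<close> is a sum of steps \<open>k\<close> with \<open>f k > 0\<close>, and
  \<open>renewal_extremal_shift\<close> carries the limit over one step after the other.
  \<open>v\<close> is kept apart from \<open>u\<close> so that the lemma serves both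
  \<open>u\<close> and \<open>- u\<close>, that is, the upper and the lower limit.\<close>

lemma renewal_limsup:
  fixes f u v :: "nat \<Rightarrow> real"
  assumes f: "\<And>n. 0 \<le> f n" "f sums 1"
    and v: "\<And>n. \<bar>v n\<bar> \<le> M" "\<And>n. n > 0 \<Longrightarrow> v n = (\<Sum>i\<le>n. f i * v (n - i))"
    and u: "u 0 > 0" "\<And>n. n > 0 \<Longrightarrow> u n = (\<Sum>i\<le>n. f i * u (n - i))" "\<And>n. 0 \<le> u n" "f 0 = 0"
    and N: "\<And>n. n \<ge> N \<Longrightarrow> u n > 0"
  obtains L g where "limsup (\<lambda>n. ereal (v n)) = ereal L" "filterlim g at_top sequentially"
    "\<And>n. n \<ge> N \<Longrightarrow> (\<lambda>i. v (g i - n)) \<longlonglongrightarrow> L"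
proof -
  obtain g where g: "strict_mono g" "((\<lambda>n. ereal (v n)) \<circ> g) \<longlonglongrightarrow> limsup (\<lambda>n. ereal (v n))"
    using limsup_subseq_lim by blast
  have vb: "ereal (v n) \<le> ereal M" "ereal (- M) \<le> ereal (v n)" for n
    using v(1)[of n] by (auto simp: abs_le_iff)
  have "limsup (\<lambda>n. ereal (v n)) \<le> ereal M"
    by (rule Limsup_bounded) (use vb in auto)
  moreover have "ereal (- M) \<le> limsup (\<lambda>n. ereal (v n))"
    by (rule order_trans[OF Liminf_bounded Liminf_le_Limsup]) (use vb in auto)
  ultimately obtain L where L: "limsup (\<lambda>n. ereal (v n)) = ereal L"
    by (cases "limsup (\<lambda>n. ereal (v n))") auto
  have up: "eventually (\<lambda>n. v n < L + e) sequentially" if "e > 0" for e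
    using Limsup_lessD[of sequentially "\<lambda>n. ereal (v n)" "ereal (L + e)"] L that by simp
  have g1: "filterlim g at_top sequentially" using g(1) by (rule filterlim_subseq)
  have g2: "(\<lambda>i. v (g i)) \<longlonglongrightarrow> L" using g(2) L by (simp add: o_def)
  have "(\<lambda>i. v (g i - n)) \<longlonglongrightarrow> L" if "u n > 0" for n
    using that
  proof (induction n rule: less_induct)
    case (less n)
    show ?case
    proof (cases "n = 0")
      case True then show ?thesis using g2 by simp
    next
      case False
      then have "(\<Sum>i\<le>n. f i * u (n - i)) > 0" using u(2)[of n] less by simp
      then obtain k where k: "k \<le> n" "f k * u (n - k) > 0"
        using sum_nonpos[of "{..n}" "\<lambda>i. f i * u (n - i)"] by (force simp: not_le)
      then have kp: "f k > 0" "u (n - k) > 0" "k > 0"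
        using f(1)[of k] u(3)[of "n - k"] u(4) by (auto simp: zero_less_mult_iff intro: gr0I)
      have h: "filterlim (\<lambda>i. g i - (n - k)) at_top sequentially"
        using filterlim_compose[OF filterlim_minus_const_nat_at_top g1] .
      have "(\<lambda>i. v (g i - (n - k) - k)) \<longlonglongrightarrow> L"
        using renewal_extremal_shift[OF f kp(1) v up h] less.IH[of "n - k"] kp k by auto
      then show ?thesis using k by simp
    qed
  qed
  then show ?thesis using that L g1 N by blast
qed

lemma fps_mult_ones_nth: "fps_nth (a * Abs_fps (\<lambda>_. 1 :: real)) n = (\<Sum>i\<le>n. fps_nth a i)"
  by (auto simp: fps_mult_nth atMost_atLeast0 intro!: sum.cong)

text \<open>With \<open>?r n\<close> the tail of \<open>f\<close> after \<open>n\<close>, the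
  renewal equation turns into the conservation law
  \<open>(\<Sum>k\<le>n. ?r k * ?u (n - k)) = 1\<close>. In the limit along a sequence whose late
  shifts all give the same value L, it reads L times \<open>\<mu>\<close> equals 1, with
  \<open>\<mu>\<close> the sum of the tails. Upper and lower limit both satisfy it, so they
  coincide.\<close>

lemma renewal_theorem_critical:
  assumes f: "nonneg_fps f" "fps_nth f 0 = 0" "(1 - f) * u = 1"
    and crit: "fps_summable f s" "1 < s" "fps_sum f 1 = 1"
    and gcd: "Gcd {n. 0 < n \<and> 0 < fps_nth u n} = 1"
  shows "\<exists>c>0. (\<lambda>n. fps_nth u n) \<longlonglongrightarrow> c"
proof -
  let ?f = "fps_nth f" and ?u = "fps_nth u"
  have nu: "nonneg_fps u" using geom_fps_nonneg f by blast
  have u0: "?u 0 = 1" using fps_nth_rec[OF f(3,2), of 0] by simp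
  have urec: "?u n = (\<Sum>i\<le>n. ?f i * ?u (n - i))" if "n > 0" for n
    using fps_nth_rec[OF f(3,2), of n] that by (simp add: atMost_atLeast0)
  have fs: "fps_summable f 1" using fps_summable_mono[OF f(1) crit(1)] crit by simp
  then have fsums: "?f sums 1" using crit(3) by (simp add: fps_summable_def fps_sum_def sums_iff)
  have f0: "0 \<le> ?f n" for n using f by (simp add: nonneg_fps_def)
  have u_nn: "0 \<le> ?u n" for n using nu by (simp add: nonneg_fps_def)
  have part: "(\<Sum>i\<in>A. ?f i) \<le> 1" if "finite A" for A
    using f0 fsums sum_le_suminf[of ?f A] that by (auto simp: sums_iff)
  have u1: "?u n \<le> 1" for n
  proof (induction n rule: less_induct)
    case (less n)
    show ?case
    proof (cases "n = 0")
      case False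
      have "?u n = (\<Sum>i\<le>n. ?f i * ?u (n - i))" using urec False by simp
      also have "\<dots> \<le> (\<Sum>i\<le>n. ?f i * 1)"
      proof (rule sum_mono)
        fix i assume "i \<in> {..n}"
        then show "?f i * ?u (n - i) \<le> ?f i * 1"
          using less.IH[of "n - i"] f0[of i] f(2) by (cases "i = 0") (auto intro: mult_left_le)
      qed
      also have "\<dots> \<le> 1" using part[of "{..n}"] by simp
      finally show ?thesis .
    qed (simp add: u0)
  qed
  let ?S = "{n. 0 < n \<and> 0 < ?u n}"
  \<comment> \<open>The support of \<open>u\<close> is closed under addition: split off a first step
    \<open>k\<close> with \<open>f k > 0\<close> and use induction for the rest.\<close>
  have mult: "0 < ?u (m + n)" if "0 < ?u m" "0 < ?u n" for m n
    using that
  proof (induction m rule: less_induct)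
    case (less m)
    show ?case
    proof (cases "m = 0")
      case False
      have "(\<Sum>i\<le>m. ?f i * ?u (m - i)) > 0" using urec[of m] False less by simp
      then obtain k where k: "k \<le> m" "?f k * ?u (m - k) > 0"
        using sum_nonpos[of "{..m}" "\<lambda>i. ?f i * ?u (m - i)"] by (force simp: not_le)
      have kp: "?f k > 0" "?u (m - k) > 0" "k > 0"
        using k f0[of k] u_nn[of "m - k"] f(2) by (auto simp: zero_less_mult_iff intro: gr0I)
      have "0 < ?f k * ?u (m + n - k)" using less.IH[of "m - k"] kp k less.prems by simp
      also have "\<dots> \<le> (\<Sum>i\<le>m + n. ?f i * ?u (m + n - i))"
        using k f0 u_nn by (intro member_le_sum) auto
      also have "\<dots> = ?u (m + n)" using urec[of "m + n"] False by simp
      finally show ?thesis .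
    qed (use less in simp)
  qed
  have "\<exists>N. \<forall>n\<ge>N. n \<in> ?S"
    using mult by (intro additive_set_eventually_all gcd) auto
  then obtain N where N: "\<And>n. n \<ge> N \<Longrightarrow> ?u n > 0" by auto
  \<comment> \<open>Multiplication by the series of ones forms partial sums, so the coefficients of
    \<open>r\<close> are the tails of \<open>f\<close>, and \<open>r * u\<close> has all
    coefficients 1.\<close>
  define r where "r = (1 - f) * Abs_fps (\<lambda>_. 1 :: real)"
  let ?r = "fps_nth r"
  have r_eq: "?r n = 1 - (\<Sum>i\<le>n. ?f i)" for n
  proof -
    have "(\<Sum>i\<le>n. fps_nth (1 :: real fps) i) = (\<Sum>i\<in>{0}. fps_nth 1 i)"
      by (rule sum.mono_neutral_right) auto
    then show ?thesis unfolding r_def fps_mult_ones_nth by (simp add: sum_subtractf)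
  qed
  have r_nn: "0 \<le> ?r n" for n using part[of "{..n}"] r_eq by simp
  have ru: "(\<Sum>k\<le>n. ?r k * ?u (n - k)) = 1" for n
  proof -
    have "r * u = ((1 - f) * u) * Abs_fps (\<lambda>_. 1)" by (simp add: r_def mult_ac)
    then have "fps_nth (r * u) n = 1" using f(3) by simp
    then show ?thesis by (simp add: fps_mult_nth atMost_atLeast0)
  qed
  \<comment> \<open>Convergence of \<open>f\<close> at \<open>s > 1\<close> bounds
    \<open>?r n * s ^ n\<close> by f(s): the tails decay geometrically and \<open>\<mu>\<close> is
    finite.\<close>
  have "summable ?r"
  proof (rule summable_comparison_test')
    show "summable (\<lambda>n. fps_sum f s * (1 / s) ^ n)" using crit by (intro summable_mult summable_geometric) auto
    fix n :: nat
    have "?r n * s ^ n \<le> fps_sum f s"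
    proof -
      have sh: "(\<lambda>i. ?f (i + Suc n)) sums ?r n"
        using sums_split_initial_segment[OF fsums, of "Suc n"] by (simp add: r_eq lessThan_Suc_atMost)
      have "(\<lambda>i. ?f (i + Suc n) * s ^ n) sums (?r n * s ^ n)" by (intro sums_mult2 sh)
      moreover have sh2: "summable (\<lambda>i. ?f (i + Suc n) * s ^ (i + Suc n))"
        using crit(1) summable_iff_shift[of "\<lambda>i. ?f i * s ^ i" "Suc n"] by (simp add: fps_summable_def)
      moreover have "?f (i + Suc n) * s ^ n \<le> ?f (i + Suc n) * s ^ (i + Suc n)" for i
        using f0 crit by (intro mult_left_mono power_increasing) auto
      ultimately have "?r n * s ^ n \<le> (\<Sum>i. ?f (i + Suc n) * s ^ (i + Suc n))"
        by (metis (no_types, lifting) sums_iff suminf_le)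
      also have "\<dots> \<le> (\<Sum>i. ?f i * s ^ i)"
      proof -
        have "(\<Sum>i. ?f i * s ^ i) = (\<Sum>i. ?f (i + Suc n) * s ^ (i + Suc n)) + (\<Sum>i<Suc n. ?f i * s ^ i)"
          using crit(1) by (intro suminf_split_initial_segment) (simp add: fps_summable_def)
        moreover have "0 \<le> (\<Sum>i<Suc n. ?f i * s ^ i)" using f0 crit by (intro sum_nonneg) auto
        ultimately show ?thesis by simp
      qed
      finally show ?thesis by (simp add: fps_sum_def)
    qed
    then show "norm (?r n) \<le> fps_sum f s * (1 / s) ^ n"
      using r_nn[of n] crit by (simp add: field_simps)
  qed
  define \<mu> where "\<mu> = suminf ?r"
  have "?r 0 = 1" by (simp add: r_eq f(2))
  then have \<mu>: "\<mu> > 0"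
    using sum_le_suminf[OF \<open>summable ?r\<close>, of "{0}"] r_nn by (simp add: \<mu>_def)
  \<comment> \<open>Here \<open>c\<close> is 1 or -1. The conservation law is read at time
    \<open>g i - N\<close>, because only shifts by at least \<open>N\<close> are known to converge;
    \<open>?r\<close> is the summable majorant in Tannery's theorem.\<close>
  have lim: "L * \<mu> = c"
    if v: "\<And>n. v n = c * ?u n" "\<bar>c\<bar> = 1"
      and g: "filterlim g at_top sequentially" "\<And>n. n \<ge> N \<Longrightarrow> (\<lambda>i. v (g i - n)) \<longlonglongrightarrow> L" for v g c L
  proof -
    define a where "a k i = (if k \<le> g i - N then ?r k * v (g i - N - k) else 0)" for k i
    have "(\<lambda>i. \<Sum>k. a k i) \<longlonglongrightarrow> (\<Sum>k. ?r k * L)"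
    proof (rule conjunct2[OF conjunct2[OF tannerys_theorem]])
      fix k
      have "(\<lambda>i. ?r k * v (g i - (N + k))) \<longlonglongrightarrow> ?r k * L" by (intro tendsto_intros g) simp
      moreover have "eventually (\<lambda>i. g i > N + k) sequentially"
        using g(1) by (rule eventually_gt_nat)
      then have "eventually (\<lambda>i. ?r k * v (g i - (N + k)) = a k i) sequentially"
        by eventually_elim (auto simp: a_def)
      ultimately show "(\<lambda>i. a k i) \<longlonglongrightarrow> ?r k * L" by (rule Lim_transform_eventually)
    next
      have "norm (a k i) \<le> ?r k" for k i
        using r_nn[of k] v u1 u_nn by (auto simp: a_def abs_mult intro: mult_left_le)
      then show "eventually (\<lambda>(k, i). norm (a k i) \<le> ?r k) (at_top \<times>\<^sub>F sequentially)"
        by (auto intro!: always_eventually)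
    qed (use \<open>summable ?r\<close> in auto)
    moreover have "(\<Sum>k. a k i) = c" for i
    proof -
      have "(\<Sum>k. a k i) = (\<Sum>k\<le>g i - N. a k i)" by (rule suminf_finite) (auto simp: a_def)
      also have "\<dots> = c * (\<Sum>k\<le>g i - N. ?r k * ?u (g i - N - k))"
        by (auto simp: a_def v sum_distrib_left mult_ac)
      finally show ?thesis by (simp only: ru mult_1_right)
    qed
    ultimately have "(\<lambda>i::nat. c) \<longlonglongrightarrow> (\<Sum>k. ?r k * L)" by simp
    then have "c = (\<Sum>k. ?r k * L)" by (simp add: LIMSEQ_const_iff)
    then show ?thesis using suminf_mult2[OF \<open>summable ?r\<close>, of L] by (simp add: \<mu>_def mult.commute)
  qed
  have ub: "\<bar>?u n\<bar> \<le> 1" "\<bar>- ?u n\<bar> \<le> 1" for n using u1[of n] u_nn[of n] by auto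
  obtain L1 g1 where 1: "limsup (\<lambda>n. ereal (?u n)) = ereal L1" "filterlim g1 at_top sequentially"
    "\<And>n. n \<ge> N \<Longrightarrow> (\<lambda>i. ?u (g1 i - n)) \<longlonglongrightarrow> L1"
    using renewal_limsup[of ?f ?u 1 ?u N] f0 fsums ub urec u_nn u0 f(2) N by auto
  have nrec: "- ?u n = (\<Sum>i\<le>n. ?f i * - ?u (n - i))" if "n > 0" for n
    using urec[OF that] by (simp add: sum_negf)
  obtain L2 g2 where 2: "limsup (\<lambda>n. ereal (- ?u n)) = ereal L2" "filterlim g2 at_top sequentially"
    "\<And>n. n \<ge> N \<Longrightarrow> (\<lambda>i. - ?u (g2 i - n)) \<longlonglongrightarrow> L2"
    using renewal_limsup[of ?f "\<lambda>n. - ?u n" 1 ?u N, OF f0 fsums ub(2) nrec] urec u_nn u0 f(2) N by auto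
  have "L1 * \<mu> = 1" using lim[of ?u 1 g1 L1] 1 by auto
  moreover have "L2 * \<mu> = -1" using lim[of "\<lambda>n. - ?u n" "-1" g2 L2] 2 by auto
  ultimately have L: "L1 = 1 / \<mu>" "L2 = - (1 / \<mu>)" using \<mu> by (auto simp: field_simps)
  have "liminf (\<lambda>n. ereal (?u n)) = - limsup (\<lambda>n. - ereal (?u n))"
    by (subst ereal_Limsup_uminus) (simp add: ereal_uminus_uminus)
  also have "\<dots> = ereal (1 / \<mu>)" using 2(1) L by simp
  finally have "(\<lambda>n. ereal (?u n)) \<longlonglongrightarrow> ereal (1 / \<mu>)"
    using 1(1) L by (intro Liminf_eq_Limsup) auto
  then show ?thesis using \<mu> by (intro exI[of _ "1 / \<mu>"]) auto
qed

text \<open>Substitution of t X for X; with the critical point for \<open>t\<close> it moves that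
  point to 1.\<close>

definition fps_scale :: "real \<Rightarrow> real fps \<Rightarrow> real fps" where
  "fps_scale t a = Abs_fps (\<lambda>n. fps_nth a n * t ^ n)"

lemma fps_scale_nth [simp]: "fps_nth (fps_scale t a) n = fps_nth a n * t ^ n"
  by (simp add: fps_scale_def)

lemma fps_scale_mult: "fps_scale t (a * b) = fps_scale t a * fps_scale t b"
  by (rule fps_ext) (simp only: fps_scale_nth fps_mult_nth_pow, simp add: fps_mult_nth atMost_atLeast0)

lemma fps_scale_one_minus: "fps_scale t (1 - f) = 1 - fps_scale t f"
  by (rule fps_ext) (simp add: algebra_simps)

lemma fps_scale_1: "fps_scale t 1 = 1"
  by (rule fps_ext) simp

theorem renewal_theorem:
  assumes f: "nonneg_fps f" "fps_nth f 0 = 0" "(1 - f) * u = 1"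
    and crit: "fps_summable f s" "0 < \<rho>" "\<rho> < s" "fps_sum f \<rho> = 1"
    and gcd: "Gcd {n. 0 < n \<and> 0 < fps_nth u n} = 1"
  shows "\<exists>c>0. (\<lambda>n. fps_nth u n * \<rho> ^ n) \<longlonglongrightarrow> c"
proof -
  have "\<exists>c>0. (\<lambda>n. fps_nth (fps_scale \<rho> u) n) \<longlonglongrightarrow> c"
  proof (rule renewal_theorem_critical)
    show "nonneg_fps (fps_scale \<rho> f)" using f crit by (simp add: nonneg_fps_def)
    show "fps_nth (fps_scale \<rho> f) 0 = 0" using f by simp
    show "(1 - fps_scale \<rho> f) * fps_scale \<rho> u = 1"
      using f(3) by (simp add: fps_scale_one_minus [symmetric] fps_scale_mult [symmetric] fps_scale_1)
    show "fps_summable (fps_scale \<rho> f) (s / \<rho>)"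
      using crit by (simp add: fps_summable_def power_divide)
    show "1 < s / \<rho>" using crit by simp
    show "fps_sum (fps_scale \<rho> f) 1 = 1" using crit by (simp add: fps_sum_def)
    show "Gcd {n. 0 < n \<and> 0 < fps_nth (fps_scale \<rho> u) n} = 1"
      using gcd crit by (simp add: zero_less_mult_iff)
  qed
  then show ?thesis by simp
qed

section \<open>Convolution and polynomial growth\<close>

abbreviation growth :: "real \<Rightarrow> nat \<Rightarrow> nat \<Rightarrow> real" where
  "growth l j n \<equiv> l ^ n * real n ^ j"

definition asymp_growth :: "real fps \<Rightarrow> real \<Rightarrow> nat \<Rightarrow> real \<Rightarrow> bool" where
  "asymp_growth a l j c \<longleftrightarrow> (\<lambda>n. fps_nth a n / growth l j n) \<longlonglongrightarrow> c"

text \<open>Rates up to \<open>e\<close> stay unresolved on purpose: convergence on all of [0, 1/e)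
  only means being negligible against every rate above \<open>e\<close>. The strict sign of
  \<open>c\<close> together with nonnegativity is what keeps leading terms from cancelling in sums
  and products.\<close>

definition regular_growth :: "real \<Rightarrow> real fps \<Rightarrow> bool" where
  "regular_growth e a \<longleftrightarrow> nonneg_fps a \<and>
     ((\<forall>t. 0 \<le> t \<and> t < 1 / e \<longrightarrow> fps_summable a t) \<or>
      (\<exists>l>e. \<exists>j. \<exists>c>0. asymp_growth a l j c))"

lemma weight_diff_bound:
  fixes x d c B :: real
  assumes "0 \<le> x" "\<bar>d\<bar> \<le> B"
  shows "norm (x * \<bar>d - c\<bar>) \<le> x * (B + \<bar>c\<bar>)"
proof -
  have "\<bar>d - c\<bar> \<le> B + \<bar>c\<bar>" using assms by linarith
  then show ?thesis using assms(1) by (simp add: abs_mult mult_left_mono)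
qed

text \<open>Absolute values inside the sum give an error that depends on the majorant
  \<open>m\<close> alone, not on the weights it dominates.\<close>

lemma tannery_weights:
  fixes m :: "nat \<Rightarrow> real" and D :: "nat \<Rightarrow> nat \<Rightarrow> real"
  assumes m: "summable m" "\<And>k. 0 \<le> m k"
    and D: "\<And>k. D k \<longlonglongrightarrow> c" "\<And>k n. n \<ge> 1 \<Longrightarrow> \<bar>D k n\<bar> \<le> B"
  shows "(\<lambda>n. \<Sum>k. m k * \<bar>D k n - c\<bar>) \<longlonglongrightarrow> 0"
proof -
  let ?f = "\<lambda>k n. m k * \<bar>D k n - c\<bar>" and ?b = "\<lambda>k. m k * (B + \<bar>c\<bar>)"
  have "(\<lambda>n. \<Sum>k. ?f k n) \<longlonglongrightarrow> (\<Sum>k. m k * \<bar>c - c\<bar>)"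
  proof (rule conjunct2[OF conjunct2[OF tannerys_theorem]])
    show "(\<lambda>n. ?f k n) \<longlonglongrightarrow> m k * \<bar>c - c\<bar>" for k
      by (intro tendsto_intros D)
    have "norm (?f k n) \<le> ?b k" if "n \<ge> 1" for k n
      using m(2) D(2)[OF that] by (rule weight_diff_bound)
    then have "eventually (\<lambda>n. \<forall>k. norm (?f k n) \<le> ?b k) sequentially"
      unfolding eventually_sequentially by blast
    then show "eventually (\<lambda>(k, n). norm (?f k n) \<le> ?b k) (at_top \<times>\<^sub>F sequentially)"
      unfolding eventually_prod_filter case_prod_beta fst_conv snd_conv
      by (intro exI[of _ "\<lambda>_. True"] exI[of _ "\<lambda>n. \<forall>k. norm (?f k n) \<le> ?b k"]) auto
    show "summable (\<lambda>k. ?b k)" using m(1) by (rule summable_mult2)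
  qed auto
  then show ?thesis by simp
qed

lemma quot_pow_tendsto_1: "(\<lambda>n. (real (n - k) / real n) ^ j) \<longlonglongrightarrow> 1"
proof -
  have "(\<lambda>n. 1 - real k / real n) \<longlonglongrightarrow> 1 - 0"
    by (intro tendsto_intros tendsto_divide_0[OF tendsto_const] filterlim_at_top_imp_at_infinity filterlim_real_sequentially)
  moreover have "eventually (\<lambda>n. 1 - real k / real n = real (n - k) / real n) sequentially"
    using eventually_gt_at_top[of k] by eventually_elim (auto simp: field_simps of_nat_diff)
  ultimately have "(\<lambda>n. real (n - k) / real n) \<longlonglongrightarrow> 1"
    by (auto intro: Lim_transform_eventually)
  from tendsto_power[OF this, of j] show ?thesis by simp
qed

text \<open>The error bound is uniform in the weights w dominated by C m; this is what makes the limit in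
  Assumption (A) uniform in the starting point and in the test function.\<close>

lemma convolution_uniform_limit:
  fixes b m :: "nat \<Rightarrow> real"
  assumes l: "l > 0" and b: "(\<lambda>n. b n / growth l j n) \<longlonglongrightarrow> c"
    and m: "\<And>k. 0 \<le> m k" "summable (\<lambda>k. m k / l ^ k)"
  shows "\<exists>\<gamma>. \<gamma> \<longlonglongrightarrow> 0 \<and>
    (\<forall>w C j' n. j \<le> j' \<and> (\<forall>k. \<bar>w k\<bar> \<le> C * m k) \<and> n \<ge> 1 \<longrightarrow>
       \<bar>(\<Sum>k\<le>n. w k * b (n - k)) / growth l j' n
          - (if j' = j then c * (\<Sum>k. w k / l ^ k) else 0)\<bar> \<le> C * \<gamma> n)"
proof -
  \<comment> \<open>The exponential is taken at \<open>n - k\<close>, but the polynomial factor at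
    \<open>n\<close>. Thus the convolution divided by \<open>growth l j n\<close> is exactly the sum
    of \<open>w k / l ^ k * D k n\<close>.\<close>
  define D where "D k n = (if k \<le> n then b (n - k) / (l ^ (n - k) * real n ^ j) else 0)" for k n
  obtain B0 where B0: "\<And>n. \<bar>b n / growth l j n\<bar> \<le> B0"
    using convergent_imp_Bseq[of "\<lambda>n. b n / growth l j n"] b
    by (auto simp: Bseq_def convergent_def)
  have B0nn: "B0 \<ge> 0" using B0[of 0] by linarith
  \<comment> \<open>The summand for \<open>b 0\<close> covers \<open>k = n\<close>: for
    \<open>j > 0\<close>, \<open>growth l j 0\<close> is 0 and \<open>B0\<close> says nothing about
    \<open>b 0\<close>.\<close>
  define B where "B = B0 + \<bar>b 0\<bar>"
  have D_bound: "\<bar>D k n\<bar> \<le> B" if n: "n \<ge> 1" for k n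
  proof (cases "k < n")
    case True
    then have "\<bar>b (n - k) / l ^ (n - k)\<bar> \<le> B0 * real (n - k) ^ j"
      using B0[of "n - k"] l by (simp add: field_simps abs_mult)
    also have "\<dots> \<le> B0 * real n ^ j" using B0nn by (intro mult_left_mono power_mono) auto
    finally have "\<bar>b (n - k) / l ^ (n - k)\<bar> / real n ^ j \<le> B0" using n by (subst pos_divide_le_eq) auto
    then show ?thesis using True l by (simp add: D_def B_def abs_mult)
  next
    case False
    then have "\<bar>D k n\<bar> \<le> \<bar>b 0\<bar> / real n ^ j" using n by (auto simp: D_def)
    also have "\<dots> \<le> \<bar>b 0\<bar> / 1" using n by (intro divide_left_mono) auto
    finally show ?thesis using B0nn by (simp add: B_def)
  qed
  have D_lim: "D k \<longlonglongrightarrow> c" for k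
  proof -
    have "(\<lambda>n. b (n - k) / (l ^ (n - k) * real (n - k) ^ j)) \<longlonglongrightarrow> c"
      using b by (rule filterlim_compose[OF _ filterlim_minus_const_nat_at_top])
    from tendsto_mult[OF this quot_pow_tendsto_1[of k j]]
    have "(\<lambda>n. b (n - k) / (l ^ (n - k) * real (n - k) ^ j) * (real (n - k) / real n) ^ j) \<longlonglongrightarrow> c" by simp
    moreover have "eventually (\<lambda>n. b (n - k) / (l ^ (n - k) * real (n - k) ^ j) * (real (n - k) / real n) ^ j = D k n) sequentially"
      using eventually_gt_at_top[of k] by eventually_elim (auto simp: D_def power_divide field_simps)
    ultimately show ?thesis by (rule Lim_transform_eventually)
  qed
  let ?m = "\<lambda>k. m k / l ^ k"
  have m0: "0 \<le> ?m k" for k using m l by simp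
  define g where "g n = (\<Sum>k. ?m k * \<bar>D k n - c\<bar>)" for n
  have g: "g \<longlonglongrightarrow> 0" unfolding g_def by (rule tannery_weights[OF m(2) m0 D_lim D_bound])
  define M where "M = suminf ?m"
  \<comment> \<open>The first summand is the error for \<open>j' = j\<close>. For
    \<open>j' > j\<close> the convolution normalised with \<open>j\<close> is at most
    \<open>C * (\<bar>c\<bar> * M + g n)\<close> and is divided by at least
    \<open>real n\<close>.\<close>
  define \<gamma> where "\<gamma> n = g n + (\<bar>c\<bar> * M + g n) / real n" for n
  have "\<gamma> \<longlonglongrightarrow> 0 + 0"
    unfolding \<gamma>_def
  proof (intro tendsto_add g)
    show "(\<lambda>n. (\<bar>c\<bar> * M + g n) / real n) \<longlonglongrightarrow> 0"
      using g by (intro tendsto_divide_0[of _ "\<bar>c\<bar> * M + 0"] tendsto_intros filterlim_at_top_imp_at_infinity filterlim_real_sequentially)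
  qed
  moreover have "\<bar>(\<Sum>k\<le>n. w k * b (n - k)) / growth l j' n
          - (if j' = j then c * (\<Sum>k. w k / l ^ k) else 0)\<bar> \<le> C * \<gamma> n"
    if j': "j \<le> j'" and w: "\<And>k. \<bar>w k\<bar> \<le> C * m k" and n: "n \<ge> 1" for w C j' n
  proof -
    let ?W = "\<Sum>k. w k / l ^ k" and ?S = "\<Sum>k\<le>n. w k * b (n - k)"
    let ?d = "\<lambda>k. ?m k * \<bar>D k n - c\<bar>" and ?e = "\<lambda>k. w k / l ^ k * (D k n - c)"
    define X where "X = ?S / growth l j n"
    have wm: "\<bar>w k / l ^ k\<bar> \<le> C * ?m k" for k
      using divide_right_mono[OF w[of k], of "l ^ k"] l by simp
    have summ_w: "summable (\<lambda>k. norm (w k / l ^ k))"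
      by (rule summable_norm_comparison_test[OF _ summable_mult[OF m(2), of C]])
         (use wm in \<open>simp only: real_norm_def, blast\<close>)
    have sm: "summable (\<lambda>k. ?d k)"
    proof (rule summable_comparison_test'[OF summable_mult2[OF m(2), of "B + \<bar>c\<bar>"]])
      show "norm (?d k) \<le> ?m k * (B + \<bar>c\<bar>)" for k
        using m0 D_bound[OF n] by (rule weight_diff_bound)
    qed
    have bd: "\<bar>?e k\<bar> \<le> C * (?d k)" for k
      using mult_right_mono[OF wm[of k], of "\<bar>D k n - c\<bar>"] by (simp add: abs_mult mult.assoc)
    have sd: "summable (\<lambda>k. norm (?e k))"
      by (rule summable_norm_comparison_test[OF _ summable_mult[OF sm, of C]]) (use bd in \<open>simp only: real_norm_def, blast\<close>)
    have "(\<Sum>k. w k / l ^ k * D k n) = (\<Sum>k\<le>n. w k / l ^ k * D k n)"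
      by (rule suminf_finite) (auto simp: D_def)
    also have "\<dots> = X"
      unfolding X_def sum_divide_distrib
      by (rule sum.cong) (use l in \<open>auto simp: D_def field_simps simp flip: power_add\<close>)
    finally have X: "X = (\<Sum>k. w k / l ^ k * D k n)" ..
    have sD: "summable (\<lambda>k. w k / l ^ k * D k n)"
      by (rule summable_finite[of "{..n}"]) (auto simp: D_def)
    have "X - c * ?W = (\<Sum>k. ?e k)"
      using suminf_diff[OF sD summable_mult2[OF summable_norm_cancel[OF summ_w], of c]]
        suminf_mult2[OF summable_norm_cancel[OF summ_w], of c]
      unfolding X right_diff_distrib by (simp only: mult.commute[of c])
    also have "\<bar>\<dots>\<bar> \<le> (\<Sum>k. C * (?d k))"
    proof -
      have "\<bar>\<Sum>k. ?e k\<bar> \<le> (\<Sum>k. \<bar>?e k\<bar>)"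
        using summable_norm[OF sd] by simp
      also have "\<dots> \<le> (\<Sum>k. C * (?d k))"
        by (rule suminf_le[OF bd _ summable_mult[OF sm]]) (use sd in simp)
      finally show ?thesis .
    qed
    also have "\<dots> = C * g n" unfolding g_def by (rule suminf_mult[OF sm])
    finally have Xg: "\<bar>X - c * ?W\<bar> \<le> C * g n" .
    have "\<bar>\<Sum>k. w k / l ^ k\<bar> \<le> (\<Sum>k. C * ?m k)"
    proof -
      have "\<bar>\<Sum>k. w k / l ^ k\<bar> \<le> (\<Sum>k. \<bar>w k / l ^ k\<bar>)" using summable_norm[OF summ_w] by simp
      also have "\<dots> \<le> (\<Sum>k. C * ?m k)"
        by (rule suminf_le[OF wm _ summable_mult[OF m(2)]]) (use summ_w in simp)
      finally show ?thesis .
    qed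
    also have "\<dots> = C * M" unfolding M_def by (rule suminf_mult[OF m(2)])
    finally have "\<bar>c * ?W\<bar> \<le> \<bar>c\<bar> * (C * M)"
      by (simp add: abs_mult mult_left_mono)
    then have Xb: "\<bar>X\<bar> \<le> C * (\<bar>c\<bar> * M + g n)" using Xg by (simp add: algebra_simps)
    have err: "0 \<le> C * (\<bar>c\<bar> * M + g n)" using Xb by linarith
    show ?thesis
    proof (cases "j' = j")
      case True
      have "C * g n \<le> C * \<gamma> n"
        using divide_nonneg_nonneg[OF err, of "real n"] by (simp add: \<gamma>_def distrib_left)
      then show ?thesis using Xg True by (simp add: X_def)
    next
      case False
      then have "?S / growth l j' n = X / real n ^ (j' - j)"
        using j' by (simp add: X_def power_add [symmetric])
      also have "\<bar>\<dots>\<bar> \<le> \<bar>X\<bar> / real n ^ 1"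
      proof -
        have "real n ^ 1 \<le> real n ^ (j' - j)" using n False j' by (intro power_increasing) auto
        then show ?thesis using n by (simp add: divide_left_mono)
      qed
      also have "\<dots> \<le> C * (\<bar>c\<bar> * M + g n) / real n" using Xb by (simp add: divide_right_mono)
      also have "\<dots> \<le> C * \<gamma> n"
        using order_trans[OF abs_ge_zero Xg] by (simp add: \<gamma>_def distrib_left)
      finally show ?thesis using False by simp
    qed
  qed
  ultimately show ?thesis by (intro exI[of _ \<gamma>]) auto
qed

lemma asymp_growth_mult_summable:
  assumes "nonneg_fps a" "l > 0" "fps_summable a (1 / l)" "asymp_growth b l j c"
  shows "asymp_growth (a * b) l j (c * fps_sum a (1 / l))"
proof -
  have s: "summable (\<lambda>k. fps_nth a k / l ^ k)"
    using assms(3) by (simp add: fps_summable_def power_divide)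
  obtain \<gamma> where g: "\<gamma> \<longlonglongrightarrow> 0"
    "\<forall>w C j' n. j \<le> j' \<and> (\<forall>k. \<bar>w k\<bar> \<le> C * fps_nth a k) \<and> n \<ge> 1 \<longrightarrow>
       \<bar>(\<Sum>k\<le>n. w k * fps_nth b (n - k)) / growth l j' n
          - (if j' = j then c * (\<Sum>k. w k / l ^ k) else 0)\<bar> \<le> C * \<gamma> n"
    using convolution_uniform_limit[OF assms(2) assms(4)[unfolded asymp_growth_def] nonneg_fpsD[OF assms(1)] s] by blast
  have "\<bar>fps_nth (a * b) n / growth l j n - c * fps_sum a (1 / l)\<bar> \<le> \<gamma> n" if "n \<ge> 1" for n
    using g(2)[rule_format, of j "fps_nth a" 1 n] nonneg_fpsD[OF assms(1)] that
    by (simp add: fps_mult_nth fps_sum_def power_divide atMost_atLeast0)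
  then have "(\<lambda>n. fps_nth (a * b) n / growth l j n - c * fps_sum a (1 / l)) \<longlonglongrightarrow> 0"
    by (intro Lim_null_comparison[OF _ g(1)]) (auto simp: eventually_sequentially)
  then show ?thesis unfolding asymp_growth_def by (rule LIM_zero_cancel)
qed

section \<open>Convolution of sequences with equal exponential rate\<close>

lemma toeplitz:
  fixes \<tau> :: "nat \<Rightarrow> nat \<Rightarrow> real" and x :: "nat \<Rightarrow> real"
  assumes x: "x \<longlonglongrightarrow> 0" and \<tau>: "\<And>n k. k \<le> n \<Longrightarrow> 0 \<le> \<tau> n k" "\<And>n. (\<Sum>k\<le>n. \<tau> n k) \<le> 1"
    "\<And>k. (\<lambda>n. \<tau> n k) \<longlonglongrightarrow> 0"
  shows "(\<lambda>n. \<Sum>k\<le>n. \<tau> n k * x k) \<longlonglongrightarrow> 0"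
proof (rule tendstoI)
  fix e :: real assume e: "e > 0"
  obtain N where N: "\<And>k. k \<ge> N \<Longrightarrow> \<bar>x k\<bar> < e / 2"
    using tendstoD[OF x, of "e / 2"] e by (auto simp: eventually_sequentially dist_real_def)
  have "(\<lambda>n. \<Sum>k<N. \<tau> n k * \<bar>x k\<bar>) \<longlonglongrightarrow> (\<Sum>k<N. 0 * \<bar>x k\<bar>)"
    by (intro tendsto_intros \<tau>)
  then have "eventually (\<lambda>n. (\<Sum>k<N. \<tau> n k * \<bar>x k\<bar>) < e / 2) sequentially"
    by (rule order_tendstoD(2)) (use e in simp)
  moreover have "eventually (\<lambda>n. n \<ge> N) sequentially" by (rule eventually_ge_at_top)
  ultimately show "eventually (\<lambda>n. dist (\<Sum>k\<le>n. \<tau> n k * x k) 0 < e) sequentially"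
  proof eventually_elim
    case (elim n)
    have split: "{..n} = {..<N} \<union> {N..n}" using elim by auto
    have "\<bar>\<Sum>k\<le>n. \<tau> n k * x k\<bar> \<le> (\<Sum>k\<le>n. \<tau> n k * \<bar>x k\<bar>)"
      by (rule order_trans[OF sum_abs]) (auto simp: abs_mult \<tau>)
    also have "\<dots> = (\<Sum>k<N. \<tau> n k * \<bar>x k\<bar>) + (\<Sum>k\<in>{N..n}. \<tau> n k * \<bar>x k\<bar>)"
      unfolding split by (rule sum.union_disjoint) auto
    also have "(\<Sum>k\<in>{N..n}. \<tau> n k * \<bar>x k\<bar>) \<le> (\<Sum>k\<in>{N..n}. \<tau> n k * (e / 2))"
      using N by (intro sum_mono mult_left_mono \<tau>) (auto intro: less_imp_le)
    also have "\<dots> = (\<Sum>k\<in>{N..n}. \<tau> n k) * (e / 2)" by (simp add: sum_distrib_right)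
    also have "\<dots> \<le> 1 * (e / 2)"
    proof (rule mult_right_mono)
      have "(\<Sum>k\<in>{N..n}. \<tau> n k) \<le> (\<Sum>k\<le>n. \<tau> n k)" by (rule sum_mono2) (auto simp: \<tau>)
      then show "(\<Sum>k\<in>{N..n}. \<tau> n k) \<le> 1" using \<tau>(2)[of n] by simp
    qed (use e in simp)
    finally show ?case using elim by simp
  qed
qed

text \<open>Model series with a pole of order \<open>j + 1\<close> at 1: the coefficients behave
  like n^j / j!, and products are again of this form. This makes the convolution weights in
  \<open>poly_convolution\<close> sum to exactly 1.\<close>

definition pole_fps :: "nat \<Rightarrow> real fps" where
  "pole_fps j = inverse ((1 - fps_X) ^ Suc j)"

lemma pole_fps_nth: "fps_nth (pole_fps j) n = real ((n + j) choose j)"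
proof -
  have "pole_fps j = Abs_fps (\<lambda>k. of_nat ((Suc j + k - 1) choose k) * 1 ^ k)"
    using one_minus_const_fps_X_neg_power'[of "Suc j" "1 :: real"] by (simp add: pole_fps_def)
  then have "fps_nth (pole_fps j) n = real ((j + n) choose n)" by simp
  also have "(j + n) choose n = (n + j) choose j"
    using binomial_symmetric[of j "n + j"] by (simp add: add.commute)
  finally show ?thesis .
qed

lemma pole_fps_mult: "pole_fps i * pole_fps j = pole_fps (i + j + 1)"
proof -
  have "Suc (i + j + 1) = Suc i + Suc j" by simp
  then show ?thesis unfolding pole_fps_def by (simp only: power_add fps_inverse_mult)
qed

lemma pole_fps_asymp: "(\<lambda>n. fps_nth (pole_fps j) n / real n ^ j) \<longlonglongrightarrow> 1 / fact j"
proof -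
  have "(n + j) choose j = (j + n) choose n" for n
    using binomial_symmetric[of j "n + j"] by (simp add: add.commute)
  then show ?thesis using fact_binomial_limit[of j, where 'a = real] by (simp add: pole_fps_nth)
qed

lemma pole_fps_pos: "fps_nth (pole_fps j) n > 0"
  by (simp add: pole_fps_nth)

lemma pole_fps_ratio: "(\<lambda>n. fps_nth (pole_fps j) n / fps_nth (pole_fps (i + j + 1)) n) \<longlonglongrightarrow> 0"
proof -
  let ?p = "\<lambda>j. fps_nth (pole_fps j)"
  let ?k = "i + j + 1"
  have "(\<lambda>n. 1 / real n ^ Suc i) \<longlonglongrightarrow> 0"
    by (intro tendsto_divide_0[OF tendsto_const] filterlim_at_top_imp_at_infinity
      filterlim_pow_at_top filterlim_real_sequentially) auto
  then have "(\<lambda>n. (?p j n / real n ^ j) / (?p ?k n / real n ^ ?k) * (1 / real n ^ Suc i))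
     \<longlonglongrightarrow> (1 / fact j) / (1 / fact ?k) * 0"
    by (intro tendsto_mult tendsto_divide pole_fps_asymp) auto
  moreover have "eventually (\<lambda>n. (?p j n / real n ^ j) / (?p ?k n / real n ^ ?k) * (1 / real n ^ Suc i)
      = ?p j n / ?p ?k n) sequentially"
    using eventually_gt_at_top[of 0] by eventually_elim (simp add: power_add field_simps)
  ultimately show ?thesis by (auto intro: Lim_transform_eventually)
qed

lemma pole_fps_shift_ratio: "(\<lambda>n. fps_nth (pole_fps j) (n - k) / fps_nth (pole_fps (i + j + 1)) n) \<longlonglongrightarrow> 0"
proof (rule Lim_null_comparison[OF _ pole_fps_ratio[of j i]], intro always_eventually allI)
  fix n
  have "fps_nth (pole_fps j) (n - k) \<le> fps_nth (pole_fps j) n"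
    by (simp add: pole_fps_nth binomial_right_mono)
  then show "norm (fps_nth (pole_fps j) (n - k) / fps_nth (pole_fps (i + j + 1)) n) \<le>
      fps_nth (pole_fps j) n / fps_nth (pole_fps (i + j + 1)) n"
    using pole_fps_pos[of "i + j + 1" n] pole_fps_pos[of j "n - k"] by (simp add: divide_right_mono)
qed

text \<open>Relative to the coefficients of \<open>pole_fps\<close>, the convolution is an average
  of products with probability weights \<open>\<tau>\<close> whose mass near either end vanishes, so
  both normalised factors may be replaced by their limits. The factorials arise from passing between
  powers of \<open>n\<close> and \<open>pole_fps\<close>.\<close>

lemma poly_convolution:
  fixes a b :: "nat \<Rightarrow> real"
  assumes a: "(\<lambda>n. a n / real n ^ i) \<longlonglongrightarrow> c" and b: "(\<lambda>n. b n / real n ^ j) \<longlonglongrightarrow> d"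
  shows "(\<lambda>n. (\<Sum>k\<le>n. a k * b (n - k)) / real n ^ (i + j + 1)) \<longlonglongrightarrow>
    c * d * fact i * fact j / fact (i + j + 1)"
proof -
  let ?p = "\<lambda>j. fps_nth (pole_fps j)"
  let ?s = "i + j + 1"
  have norm: "(\<lambda>n. x n / ?p j n) \<longlonglongrightarrow> c * fact j"
    if "(\<lambda>n. x n / real n ^ j) \<longlonglongrightarrow> c" for x :: "nat \<Rightarrow> real" and j c
  proof -
    have "(\<lambda>n. (x n / real n ^ j) / (?p j n / real n ^ j)) \<longlonglongrightarrow> c / (1 / fact j)"
      by (intro tendsto_divide that pole_fps_asymp) auto
    moreover have "eventually (\<lambda>n. (x n / real n ^ j) / (?p j n / real n ^ j) = x n / ?p j n) sequentially"
      using eventually_gt_at_top[of 0] by eventually_elim (simp add: field_simps)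
    ultimately show ?thesis by (auto intro: Lim_transform_eventually)
  qed
  define \<alpha> \<beta> where "\<alpha> n = a n / ?p i n" and "\<beta> n = b n / ?p j n" for n
  have \<alpha>: "\<alpha> \<longlonglongrightarrow> c * fact i" and \<beta>: "\<beta> \<longlonglongrightarrow> d * fact j"
    unfolding \<alpha>_def \<beta>_def using norm a b by auto
  obtain M where M: "\<And>n. \<bar>\<beta> n\<bar> \<le> M"
    using convergent_imp_Bseq[of \<beta>] \<beta> by (auto simp: Bseq_def convergent_def)
  define \<tau> where "\<tau> n k = ?p i k * ?p j (n - k) / ?p ?s n" for n k
  have \<tau>_nn: "0 \<le> \<tau> n k" for n k
    using pole_fps_pos by (auto simp: \<tau>_def intro!: divide_nonneg_pos mult_nonneg_nonneg less_imp_le)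
  have \<tau>1: "(\<Sum>k\<le>n. \<tau> n k) = 1" for n
  proof -
    have "(\<Sum>k\<le>n. ?p i k * ?p j (n - k)) = ?p ?s n"
      unfolding pole_fps_mult [symmetric] by (simp add: fps_mult_nth atMost_atLeast0)
    then show ?thesis using pole_fps_pos[of ?s n] by (simp add: \<tau>_def sum_divide_distrib [symmetric])
  qed
  have \<tau>_lim: "(\<lambda>n. \<tau> n k) \<longlonglongrightarrow> 0" for k
    using tendsto_mult_right_zero[OF pole_fps_shift_ratio[of j k i], of "?p i k"] by (simp add: \<tau>_def)
  \<comment> \<open>The upper end of the weights matters because \<open>\<beta>\<close> is evaluated
    at \<open>n - k\<close>.\<close>
  have \<tau>_lim': "(\<lambda>n. \<tau> n (n - k)) \<longlonglongrightarrow> 0" for k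
  proof -
    have "(\<lambda>n. ?p j k * (?p i (n - k) / ?p ?s n)) \<longlonglongrightarrow> 0"
      using tendsto_mult_right_zero[OF pole_fps_shift_ratio[of i k j], of "?p j k"] by (simp add: add_ac)
    moreover have "eventually (\<lambda>n. ?p j k * (?p i (n - k) / ?p ?s n) = \<tau> n (n - k)) sequentially"
      using eventually_ge_at_top[of k] by eventually_elim (simp add: \<tau>_def)
    ultimately show ?thesis by (rule Lim_transform_eventually)
  qed
  let ?a = "\<lambda>k. \<bar>\<alpha> k - c * fact i\<bar>" and ?b = "\<lambda>k. \<bar>\<beta> k - d * fact j\<bar>"
  let ?c = "\<lambda>n. \<Sum>k\<le>n. a k * b (n - k)"
  let ?L = "(c * fact i) * (d * fact j)"
  have A: "(\<lambda>n. \<Sum>k\<le>n. \<tau> n k * ?a k) \<longlonglongrightarrow> 0"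
    using \<alpha> by (intro toeplitz \<tau>_nn \<tau>_lim) (auto simp: \<tau>1 intro: tendsto_rabs_zero LIM_zero)
  have "(\<lambda>n. \<Sum>k\<le>n. \<tau> n (n - k) * ?b k) \<longlonglongrightarrow> 0"
  proof (intro toeplitz \<tau>_nn \<tau>_lim')
    show "(\<lambda>k. ?b k) \<longlonglongrightarrow> 0" using \<beta> by (intro tendsto_rabs_zero LIM_zero)
    show "(\<Sum>k\<le>n. \<tau> n (n - k)) \<le> 1" for n
      using \<tau>1[of n] sum.nat_diff_reindex[of "\<tau> n" "Suc n"] by (simp add: lessThan_Suc_atMost)
  qed
  moreover have "(\<Sum>k\<le>n. \<tau> n (n - k) * ?b k) = (\<Sum>k\<le>n. \<tau> n k * ?b (n - k))" for n
    using sum.nat_diff_reindex[of "\<lambda>k. \<tau> n k * ?b (n - k)" "Suc n"]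
    by (simp add: lessThan_Suc_atMost)
  ultimately have B: "(\<lambda>n. \<Sum>k\<le>n. \<tau> n k * ?b (n - k)) \<longlonglongrightarrow> 0" by simp
  have AB: "(\<lambda>n. (\<Sum>k\<le>n. \<tau> n k * ?a k) * M + \<bar>c * fact i\<bar> * (\<Sum>k\<le>n. \<tau> n k * ?b (n - k))) \<longlonglongrightarrow> 0"
    using tendsto_add[OF tendsto_mult_left_zero[OF A, of M] tendsto_mult_right_zero[OF B, of "\<bar>c * fact i\<bar>"]] by simp
  have "(\<lambda>n. ?c n / ?p ?s n - ?L) \<longlonglongrightarrow> 0"
  proof (rule Lim_null_comparison[OF _ AB], intro always_eventually allI)
    fix n
    have ab: "a k * b (n - k) / ?p ?s n = \<tau> n k * (\<alpha> k * \<beta> (n - k))" for k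
      using pole_fps_pos[of i k] pole_fps_pos[of j "n - k"] by (simp add: \<tau>_def \<alpha>_def \<beta>_def)
    have "?c n / ?p ?s n - ?L = (\<Sum>k\<le>n. \<tau> n k * (\<alpha> k * \<beta> (n - k))) - (\<Sum>k\<le>n. \<tau> n k) * ?L"
      by (simp only: sum_divide_distrib ab \<tau>1 mult_1)
    also have "\<dots> = (\<Sum>k\<le>n. \<tau> n k * (\<alpha> k * \<beta> (n - k) - ?L))"
      by (simp add: sum_distrib_right sum_subtractf [symmetric] right_diff_distrib)
    also have "\<bar>\<dots>\<bar> \<le> (\<Sum>k\<le>n. \<tau> n k * (?a k * M + \<bar>c * fact i\<bar> * ?b (n - k)))"
    proof (rule order_trans[OF sum_abs], rule sum_mono)
      fix k
      have "\<alpha> k * \<beta> (n - k) - ?L = (\<alpha> k - c * fact i) * \<beta> (n - k) + (c * fact i) * (\<beta> (n - k) - d * fact j)"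
        by (simp add: algebra_simps)
      also have "\<bar>\<dots>\<bar> \<le> ?a k * \<bar>\<beta> (n - k)\<bar> + \<bar>c * fact i\<bar> * ?b (n - k)"
        by (rule order_trans[OF abs_triangle_ineq]) (simp only: abs_mult order_refl)
      also have "?a k * \<bar>\<beta> (n - k)\<bar> \<le> ?a k * M"
        by (intro mult_left_mono M) auto
      finally show "\<bar>\<tau> n k * (\<alpha> k * \<beta> (n - k) - ?L)\<bar> \<le> \<tau> n k * (?a k * M + \<bar>c * fact i\<bar> * ?b (n - k))"
        using \<tau>_nn[of n k] by (auto simp: abs_mult intro!: mult_left_mono)
    qed
    also have "\<dots> = (\<Sum>k\<le>n. \<tau> n k * ?a k) * M + \<bar>c * fact i\<bar> * (\<Sum>k\<le>n. \<tau> n k * ?b (n - k))"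
      by (simp add: distrib_left sum.distrib sum_distrib_left sum_distrib_right mult_ac)
    finally show "norm (?c n / ?p ?s n - ?L) \<le> \<dots>" by simp
  qed
  then have "(\<lambda>n. ?c n / ?p ?s n) \<longlonglongrightarrow> ?L" by (rule LIM_zero_cancel)
  from tendsto_mult[OF this pole_fps_asymp[of ?s]]
  have "(\<lambda>n. ?c n / ?p ?s n * (?p ?s n / real n ^ ?s)) \<longlonglongrightarrow> ?L * (1 / fact ?s)" .
  moreover have "(\<lambda>n. ?c n / ?p ?s n * (?p ?s n / real n ^ ?s)) =
      (\<lambda>n. ?c n / real n ^ ?s)"
    using pole_fps_pos[of ?s] by (auto simp: fun_eq_iff less_imp_neq[symmetric])
  ultimately show ?thesis by (simp add: mult_ac)
qed

lemma asymp_growth_mult_same: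
  assumes "l > 0" "asymp_growth a l i c" "asymp_growth b l j d"
  shows "asymp_growth (a * b) l (i + j + 1) (c * d * fact i * fact j / fact (i + j + 1))"
proof -
  have conv: "(\<lambda>n. fps_nth x n / l ^ n / real n ^ k) \<longlonglongrightarrow> e" if "asymp_growth x l k e" for x k e
    using that by (simp add: asymp_growth_def)
  have *: "fps_nth (a * b) n / l ^ n = (\<Sum>k\<le>n. fps_nth a k / l ^ k * (fps_nth b (n - k) / l ^ (n - k)))" for n
  proof -
    have "fps_nth (a * b) n * (1 / l) ^ n = (\<Sum>k\<le>n. (fps_nth a k * (1 / l) ^ k) * (fps_nth b (n - k) * (1 / l) ^ (n - k)))"
      by (rule fps_mult_nth_pow)
    then show ?thesis by (simp add: power_divide)
  qed
  show ?thesis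
    using poly_convolution[OF conv[OF assms(2)] conv[OF assms(3)]]
    unfolding asymp_growth_def * [symmetric] divide_divide_eq_left .
qed

section \<open>Sequences of regular growth\<close>

lemma summable_poly_geometric:
  fixes x :: real assumes "0 \<le> x" "x < 1"
  shows "summable (\<lambda>n. real n ^ j * x ^ n)"
proof -
  have "(\<lambda>n. (1 + 1 / real n) ^ j * x) \<longlonglongrightarrow> (1 + 0) ^ j * x"
    by (intro tendsto_intros tendsto_divide_0[OF tendsto_const] filterlim_at_top_imp_at_infinity filterlim_real_sequentially)
  then have "eventually (\<lambda>n. (1 + 1 / real n) ^ j * x < (1 + x) / 2) sequentially"
    by (rule order_tendstoD(2)) (use assms in simp)
  then obtain N where N: "\<And>n. n \<ge> N \<Longrightarrow> (1 + 1 / real n) ^ j * x < (1 + x) / 2"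
    by (auto simp: eventually_sequentially)
  show ?thesis
  proof (rule summable_ratio_test[of "(1 + x) / 2" "Suc N"])
    show "(1 + x) / 2 < 1" using assms by simp
    fix n assume n: "n \<ge> Suc N"
    have "real (Suc n) ^ j * x ^ Suc n = ((1 + 1 / real n) ^ j * x) * (real n ^ j * x ^ n)"
    proof -
      have "real (Suc n) = (1 + 1 / real n) * real n" using n by (simp add: field_simps)
      then show ?thesis by (simp only: power_mult_distrib power_Suc mult_ac)
    qed
    also have "\<dots> \<le> (1 + x) / 2 * (real n ^ j * x ^ n)"
      using N[of n] n assms by (intro mult_right_mono) auto
    finally show "norm (real (Suc n) ^ j * x ^ Suc n) \<le> (1 + x) / 2 * norm (real n ^ j * x ^ n)"
      using assms by simp
  qed
qed

abbreviation dominated :: "real \<Rightarrow> nat \<Rightarrow> real \<Rightarrow> nat \<Rightarrow> bool" where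
  "dominated l j m k \<equiv> (\<lambda>n. growth l j n / growth m k n) \<longlonglongrightarrow> 0"

lemma growth_ratio_less:
  assumes "0 < \<mu>" "\<mu> < (l::real)"
  shows "dominated \<mu> k l j"
proof (rule Lim_null_comparison)
  let ?q = "\<lambda>n. growth \<mu> k n / growth l j n" and ?b = "\<lambda>n. real n ^ k * (\<mu> / l) ^ n"
  show "(\<lambda>n. ?b n) \<longlonglongrightarrow> 0"
    by (rule summable_LIMSEQ_zero, rule summable_poly_geometric) (use assms in auto)
  have "norm (?q n) \<le> ?b n" if "n > 0" for n
  proof -
    have "?q n = (?b n) / real n ^ j"
      by (simp add: power_divide mult_ac)
    also have "\<dots> \<le> (?b n) / 1"
      using that assms by (intro divide_left_mono) auto
    finally show ?thesis using assms by simp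
  qed
  then show "eventually (\<lambda>n. norm (?q n) \<le> ?b n) sequentially"
    by (rule eventually_mono[OF eventually_gt_at_top])
qed

lemma growth_ratio_eq:
  assumes "0 < (l::real)" "k < j"
  shows "dominated l k l j"
proof -
  have "(\<lambda>n. 1 / real n ^ (j - k)) \<longlonglongrightarrow> 0"
    using assms(2)
    by (intro tendsto_divide_0[OF tendsto_const] filterlim_at_top_imp_at_infinity
      filterlim_pow_at_top filterlim_real_sequentially) auto
  moreover have "eventually (\<lambda>n. 1 / real n ^ (j - k) = growth l k n / growth l j n) sequentially"
    using eventually_gt_at_top[of 0]
  proof eventually_elim
    case (elim n)
    have "real n ^ j = real n ^ k * real n ^ (j - k)" using assms(2) by (simp add: power_add [symmetric])
    then show ?case using elim assms by simp
  qed
  ultimately show ?thesis by (rule Lim_transform_eventually)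
qed

lemma asymp_growth_bounded:
  assumes "asymp_growth a l j c" "0 < l"
  obtains B where "\<And>n. n \<ge> 1 \<Longrightarrow> \<bar>fps_nth a n\<bar> \<le> B * growth l j n"
proof -
  have "Bseq (\<lambda>n. fps_nth a n / growth l j n)"
    using assms(1) unfolding asymp_growth_def by (intro convergent_imp_Bseq convergentI)
  then obtain B where B: "\<And>n. \<bar>fps_nth a n / growth l j n\<bar> \<le> B" by (auto simp: Bseq_def)
  have "\<bar>fps_nth a n\<bar> \<le> B * growth l j n" if "n \<ge> 1" for n
    using B[of n] assms(2) that by (simp add: abs_mult pos_divide_le_eq)
  then show ?thesis by (rule that)
qed

lemma asymp_growth_summable:
  assumes "asymp_growth a l j c" "l > 0" "0 \<le> t" "t * l < 1"
  shows "fps_summable a t"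
proof -
  obtain B where B: "\<And>n. n \<ge> 1 \<Longrightarrow> \<bar>fps_nth a n\<bar> \<le> B * growth l j n"
    using asymp_growth_bounded[OF assms(1,2)] by blast
  show ?thesis unfolding fps_summable_def
  proof (rule summable_comparison_test')
    show "summable (\<lambda>n. B * (real n ^ j * (t * l) ^ n))"
      using assms by (intro summable_mult summable_poly_geometric) auto
    fix n :: nat assume n: "n \<ge> 1"
    have "\<bar>fps_nth a n\<bar> * t ^ n \<le> B * growth l j n * t ^ n"
      using assms by (intro mult_right_mono B n) auto
    then show "norm (fps_nth a n * t ^ n) \<le> B * (real n ^ j * (t * l) ^ n)"
      using assms by (simp add: abs_mult power_mult_distrib mult_ac)
  qed
qed

lemma asymp_growth_trans:
  assumes "asymp_growth a \<mu> k c" "\<mu> > 0" "dominated \<mu> k l j"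
  shows "asymp_growth a l j 0"
proof -
  have "(\<lambda>n. fps_nth a n / growth \<mu> k n * (growth \<mu> k n / growth l j n)) \<longlonglongrightarrow> c * 0"
    using assms unfolding asymp_growth_def by (intro tendsto_mult)
  moreover have "eventually (\<lambda>n. fps_nth a n / growth \<mu> k n * (growth \<mu> k n / growth l j n)
      = fps_nth a n / growth l j n) sequentially"
    using eventually_gt_at_top[of 0] by eventually_elim (use assms(2) in simp)
  ultimately show ?thesis unfolding asymp_growth_def by (auto intro: Lim_transform_eventually)
qed

lemma asymp_growth_null_summable:
  assumes "nonneg_fps a" "l > 0" "fps_summable a (1 / l)"
  shows "asymp_growth a l j 0"
  unfolding asymp_growth_def
proof (rule Lim_null_comparison)
  let ?q = "\<lambda>n. fps_nth a n / growth l j n" and ?b = "\<lambda>n. fps_nth a n * (1 / l) ^ n"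
  show "(\<lambda>n. ?b n) \<longlonglongrightarrow> 0"
    using assms(3) unfolding fps_summable_def by (rule summable_LIMSEQ_zero)
  have "norm (?q n) \<le> ?b n" if "n > 0" for n
  proof -
    have "?q n = (fps_nth a n / l ^ n) / real n ^ j" by simp
    also have "\<dots> \<le> (fps_nth a n / l ^ n) / 1"
      using that assms nonneg_fpsD[OF assms(1), of n] by (intro divide_left_mono) auto
    finally show ?thesis using assms nonneg_fpsD[OF assms(1), of n] by (simp add: power_divide)
  qed
  then show "eventually (\<lambda>n. norm (?q n) \<le> ?b n) sequentially"
    by (rule eventually_mono[OF eventually_gt_at_top])
qed

lemma regular_growth_nonneg: "regular_growth e a \<Longrightarrow> nonneg_fps a"
  by (simp add: regular_growth_def)

lemma regular_growthI_summable:
  "nonneg_fps a \<Longrightarrow> (\<And>t. 0 \<le> t \<Longrightarrow> t < 1 / e \<Longrightarrow> fps_summable a t) \<Longrightarrow> regular_growth e a"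
  by (auto simp: regular_growth_def)

lemma regular_growthI_asymp:
  "nonneg_fps a \<Longrightarrow> e < l \<Longrightarrow> 0 < c \<Longrightarrow> asymp_growth a l j c \<Longrightarrow> regular_growth e a"
  by (auto simp: regular_growth_def)

lemma regular_growth_cases:
  assumes "regular_growth e a"
  obtains (small) "\<And>t. 0 \<le> t \<Longrightarrow> t < 1 / e \<Longrightarrow> fps_summable a t"
  | (asymp) l j c where "e < l" "0 < c" "asymp_growth a l j c"
  using assms unfolding regular_growth_def by blast

text \<open>Resolved growth is ordered lexicographically by rate and degree, and an unresolved
  sequence is null against every rate above \<open>e\<close>. So a reference growth either
  normalises the sequence to a finite limit or is strictly dominated by it.\<close>

lemma regular_growth_compare:
  assumes a: "regular_growth e a" and l: "0 < e" "e < l"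
  shows "(\<exists>c\<ge>0. asymp_growth a l j c) \<or>
    (\<exists>\<mu> k c. e < \<mu> \<and> 0 < c \<and> asymp_growth a \<mu> k c \<and>
       dominated l j \<mu> k)"
  using a
proof (cases rule: regular_growth_cases)
  case small
  then have "fps_summable a (1 / l)" using l by (simp add: divide_strict_left_mono)
  then show ?thesis
    using asymp_growth_null_summable[OF regular_growth_nonneg[OF a]] l by (meson order.strict_trans order_refl)
next
  case (asymp \<mu> k c)
  have pos: "\<mu> > 0" "l > 0" using asymp l by auto
  consider "\<mu> < l \<or> \<mu> = l \<and> k < j" | "\<mu> = l" "k = j" | "l < \<mu> \<or> \<mu> = l \<and> j < k" by linarith
  then show ?thesis
  proof cases
    case 1
    then have "dominated \<mu> k l j"
      using growth_ratio_less growth_ratio_eq pos by auto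
    then have "asymp_growth a l j 0" using asymp pos asymp_growth_trans by blast
    then show ?thesis by auto
  next
    case 2
    then show ?thesis using asymp by (auto intro: less_imp_le)
  next
    case 3
    then have "dominated l j \<mu> k"
      using growth_ratio_less growth_ratio_eq pos by auto
    then show ?thesis using asymp by blast
  qed
qed

lemma regular_growth_0: "regular_growth e 0"
  by (rule regular_growthI_summable) (auto simp: fps_summable_def)

lemma asymp_growth_add:
  "asymp_growth a l j c \<Longrightarrow> asymp_growth b l j d \<Longrightarrow> asymp_growth (a + b) l j (c + d)"
  unfolding asymp_growth_def by (drule (1) tendsto_add) (simp add: add_divide_distrib)

lemma regular_growth_add_dominant:
  assumes "0 < e" "e < l" "0 < c" "asymp_growth a l j c" "nonneg_fps a" "regular_growth e b"
  shows "regular_growth e (a + b)"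
  using regular_growth_compare[OF assms(6,1,2), of j]
proof (elim disjE exE conjE)
  fix d assume "0 \<le> d" "asymp_growth b l j d"
  then show ?thesis
    using asymp_growth_add assms regular_growth_nonneg nonneg_fps_add
    by (intro regular_growthI_asymp[of _ e l "c + d"]) auto
next
  fix \<mu> k d
  assume *: "e < \<mu>" "0 < d" "asymp_growth b \<mu> k d"
    "dominated l j \<mu> k"
  then have "asymp_growth a \<mu> k 0" using asymp_growth_trans[OF assms(4)] assms by auto
  then have "asymp_growth (a + b) \<mu> k (0 + d)" using * asymp_growth_add by blast
  then show ?thesis using * assms regular_growth_nonneg nonneg_fps_add
    by (intro regular_growthI_asymp[of _ e \<mu> d]) auto
qed

lemma regular_growth_add:
  assumes "0 < e" "regular_growth e a" "regular_growth e b"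
  shows "regular_growth e (a + b)"
  using assms(2)
proof (cases rule: regular_growth_cases)
  case a: small
  show ?thesis using assms(3)
  proof (cases rule: regular_growth_cases)
    case small
    with a show ?thesis using assms regular_growth_nonneg
      by (intro regular_growthI_summable nonneg_fps_add fps_summable_add)
  next
    case (asymp l j c)
    have "regular_growth e (b + a)"
      using regular_growth_add_dominant[OF assms(1) asymp regular_growth_nonneg[OF assms(3)] assms(2)] .
    then show ?thesis by (simp add: add.commute)
  qed
next
  case (asymp l j c)
  show ?thesis
    using regular_growth_add_dominant[OF assms(1) asymp regular_growth_nonneg[OF assms(2)] assms(3)] .
qed

lemma regular_growth_sum:
  assumes "0 < e" "\<And>x. x \<in> S \<Longrightarrow> regular_growth e (f x)"
  shows "regular_growth e (sum f S)"
  using assms(2)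
  by (induction S rule: infinite_finite_induct) (auto intro: regular_growth_0 regular_growth_add[OF assms(1)])

lemma fps_sum_pos:
  assumes "nonneg_fps a" "a \<noteq> 0" "fps_summable a t" "0 < t"
  shows "0 < fps_sum a t"
proof -
  obtain k where "fps_nth a k > 0" using assms nonneg_fps_nonzeroD by blast
  then show ?thesis using fps_sum_ge_nth[OF assms(1,3), of k] assms(4)
    by (smt (verit) zero_less_power mult_pos_pos)
qed

lemma regular_growth_mult_dominant:
  assumes "0 < e" "e < l" "0 < c" "asymp_growth b l j c" "nonneg_fps b" "nonneg_fps a"
    "fps_summable a (1 / l)"
  shows "regular_growth e (a * b)"
proof (cases "a = 0")
  case False
  have "asymp_growth (a * b) l j (c * fps_sum a (1 / l))"
    using asymp_growth_mult_summable assms by auto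
  moreover have "0 < c * fps_sum a (1 / l)" using fps_sum_pos[OF assms(6) False assms(7)] assms by simp
  ultimately show ?thesis using assms nonneg_fps_mult regular_growthI_asymp by blast
qed (simp add: regular_growth_0)

text \<open>The larger rate wins: the other series converges at its reciprocal and contributes only
  a constant. At equal rates the degrees add up and increase by one; this is the origin of the
  polynomial factors and hence of \<open>jS\<close>.\<close>

lemma regular_growth_mult:
  assumes "0 < e" "regular_growth e a" "regular_growth e b"
  shows "regular_growth e (a * b)"
proof -
  note nn = assms(2,3)[THEN regular_growth_nonneg]
  note nn' = nn nonneg_fps_mult[OF nn]
  have lt: "1 / l < 1 / e" "0 \<le> 1 / l" if "e < l" for l
    using that assms(1) by (auto simp: divide_strict_left_mono)
  show ?thesis using assms(2)
  proof (cases rule: regular_growth_cases)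
    case a: small
    show ?thesis using assms(3)
    proof (cases rule: regular_growth_cases)
      case small
      with a nn' show ?thesis by (intro regular_growthI_summable fps_summable_mult)
    next
      case (asymp l j c)
      then show ?thesis using a[OF lt(2,1)] regular_growth_mult_dominant assms(1) nn by blast
    qed
  next
    case a: (asymp l j c)
    show ?thesis using assms(3)
    proof (cases rule: regular_growth_cases)
      case small
      then have "regular_growth e (b * a)"
        using a small[OF lt(2,1)] regular_growth_mult_dominant assms(1) nn by blast
      then show ?thesis by (simp add: mult.commute)
    next
      case b: (asymp \<mu> k d)
      have pos: "l > 0" "\<mu> > 0" using a b assms by auto
      consider "\<mu> < l" | "\<mu> = l" | "l < \<mu>" by linarith
      then show ?thesis
      proof cases
        case 1
        then have "fps_summable b (1 / l)" using asymp_growth_summable[OF b(3)] pos by simp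
        then have "regular_growth e (b * a)"
          using a regular_growth_mult_dominant assms(1) nn by blast
        then show ?thesis by (simp add: mult.commute)
      next
        case 2
        then have "asymp_growth (a * b) l (j + k + 1) (c * d * fact j * fact k / fact (j + k + 1))"
          using a b pos asymp_growth_mult_same by blast
        moreover have "0 < c * d * fact j * fact k / fact (j + k + 1)" using a b by simp
        ultimately show ?thesis using a nn' regular_growthI_asymp by blast
      next
        case 3
        then have "fps_summable a (1 / \<mu>)" using asymp_growth_summable[OF a(3)] pos by simp
        then show ?thesis using b regular_growth_mult_dominant assms(1) nn by blast
      qed
    qed
  qed
qed

text \<open>The upper bound excludes the second alternative of
  \<open>regular_growth_compare\<close>, strict domination. The limit that remains may be 0.\<close>

lemma regular_growth_bounded:
  assumes "regular_growth e a" "0 < e" "e < l"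
    and bd: "\<And>n. n \<ge> 1 \<Longrightarrow> fps_nth a n \<le> M * growth l j n"
  shows "\<exists>c\<ge>0. asymp_growth a l j c"
  using regular_growth_compare[OF assms(1,2,3), of j]
proof (elim disjE exE conjE)
  fix \<mu> k c
  assume *: "e < \<mu>" "0 < c" "asymp_growth a \<mu> k c"
    "dominated l j \<mu> k"
  have "(\<lambda>n. fps_nth a n / growth \<mu> k n) \<longlonglongrightarrow> 0"
  proof (rule Lim_null_comparison)
    let ?q = "\<lambda>n. fps_nth a n / growth \<mu> k n" and ?b = "\<lambda>n. M * (growth l j n / growth \<mu> k n)"
    show "?b \<longlonglongrightarrow> 0"
      using * by (intro tendsto_mult_right_zero)
    have "norm (?q n) \<le> ?b n" if "n \<ge> 1" for n
      using divide_right_mono[OF bd[OF that], of "growth \<mu> k n"] * assms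
        nonneg_fpsD[OF regular_growth_nonneg[OF assms(1)], of n] by simp
    then show "eventually (\<lambda>n. norm (?q n) \<le> ?b n) sequentially"
      by (auto simp: eventually_sequentially)
  qed
  then have "c = 0" using * LIMSEQ_unique unfolding asymp_growth_def by blast
  then show ?thesis using * by simp
qed blast

section \<open>Taboo kernels and first visits\<close>

definition dirac :: "'a \<Rightarrow> 'a \<Rightarrow> real" where
  "dirac y = (\<lambda>z. if z = y then 1 else 0)"

definition kop :: "('a \<Rightarrow> 'a \<Rightarrow> real) \<Rightarrow> ('a \<Rightarrow> real) \<Rightarrow> 'a \<Rightarrow> real" where
  "kop P f x = (\<Sum>\<^sub>\<infinity>y. P x y * f y)"

text \<open>taboo P B f n x is the expectation of f(X_{n+1}) over the paths that start in x and have
  X_1, ..., X_n in B; taboo_fps is its generating function, indexed by the number of steps.\<close>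

primrec taboo :: "('a \<Rightarrow> 'a \<Rightarrow> real) \<Rightarrow> 'a set \<Rightarrow> ('a \<Rightarrow> real) \<Rightarrow> nat \<Rightarrow> 'a \<Rightarrow> real" where
  "taboo P B f 0 = kop P f"
| "taboo P B f (Suc n) = kop P (\<lambda>z. if z \<in> B then taboo P B f n z else 0)"

definition taboo_fps :: "('a \<Rightarrow> 'a \<Rightarrow> real) \<Rightarrow> 'a set \<Rightarrow> ('a \<Rightarrow> real) \<Rightarrow> 'a \<Rightarrow> real fps" where
  "taboo_fps P B f x = fps_X * Abs_fps (\<lambda>n. taboo P B f n x)"

lemma taboo_fps_nth: "fps_nth (taboo_fps P B f x) n = (if n = 0 then 0 else taboo P B f (n - 1) x)"
  by (simp add: taboo_fps_def)

lemma taboo_fps_nth_0 [simp]: "fps_nth (taboo_fps P B f x) 0 = 0"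
  and taboo_fps_nth_Suc [simp]: "fps_nth (taboo_fps P B f x) (Suc n) = taboo P B f n x"
  by (simp_all add: taboo_fps_nth)

text \<open>As the \<open>E x s\<close> have no constant term, coefficient \<open>n\<close> of a
  solution depends only on lower coefficients. This takes the place of inverting a matrix of power
  series.\<close>

lemma fps_system_unique:
  fixes E :: "_ \<Rightarrow> _ \<Rightarrow> real fps"
  assumes d: "\<And>x. x \<in> T \<Longrightarrow> d x = (\<Sum>s\<in>T. E x s * d s)"
    and E: "\<And>x s. x \<in> T \<Longrightarrow> s \<in> T \<Longrightarrow> fps_nth (E x s) 0 = 0" and "x \<in> T"
  shows "d x = 0"
proof -
  have "\<forall>x\<in>T. fps_nth (d x) n = 0" for n
  proof (induction n rule: less_induct)
    case (less n)
    show ?case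
    proof
      fix x assume x: "x \<in> T"
      have "fps_nth (E x s * d s) n = 0" if s: "s \<in> T" for s
        unfolding fps_mult_nth
      proof (rule sum.neutral, rule ballI)
        fix i assume "i \<in> {0..n}"
        then show "fps_nth (E x s) i * fps_nth (d s) (n - i) = 0"
          using E[OF x s] less.IH[of "n - i"] s by (cases "i = 0") auto
      qed
      then show "fps_nth (d x) n = 0" by (subst d[OF x]) (simp add: fps_sum_nth)
    qed
  qed
  then show ?thesis using \<open>x \<in> T\<close> by (intro fps_ext) auto
qed

locale weighted_kernel =
  fixes P :: "'a \<Rightarrow> 'a \<Rightarrow> real" and V :: "'a \<Rightarrow> real" and C0 :: real
  assumes P_nonneg: "\<And>x y. 0 \<le> P x y" and V_ge1: "\<And>x. 1 \<le> V x"
    and PV_summable: "\<And>x. (\<lambda>y. P x y * V y) summable_on UNIV"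
    and PV_le: "\<And>x. kop P V x \<le> C0 * V x"
begin

text \<open>An explicit constant instead of a norm: no supremum has to exist and constants can be
  followed through \<open>kop\<close>. The link to \<open>wnorm\<close> is
  \<open>wbound_wnorm\<close>.\<close>

definition wbound :: "('a \<Rightarrow> real) \<Rightarrow> real \<Rightarrow> bool" where
  "wbound f c \<longleftrightarrow> (\<forall>x. \<bar>f x\<bar> \<le> c * V x)"

lemma V_pos: "0 < V x"
  using V_ge1[of x] by simp

lemma C0_nonneg: "0 \<le> C0"
proof -
  have "0 \<le> kop P V undefined"
    unfolding kop_def using P_nonneg V_pos by (intro infsum_nonneg mult_nonneg_nonneg) (auto intro: less_imp_le)
  then have "0 \<le> C0 * V undefined" using PV_le[of undefined] by simp
  then show ?thesis using V_pos[of undefined] by (simp add: zero_le_mult_iff)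
qed

lemma wbound_nonneg:
  assumes "wbound f c" shows "0 \<le> c"
proof -
  have "\<bar>f undefined\<bar> \<le> c * V undefined" using assms by (simp add: wbound_def)
  then have "0 \<le> c * V undefined" by (rule order_trans[OF abs_ge_zero])
  then show ?thesis using V_pos[of undefined] by (simp add: zero_le_mult_iff)
qed

lemma wbound_V: "wbound V 1"
  using V_pos by (simp add: wbound_def abs_of_pos)

lemma wbound_dirac: "wbound (dirac y) 1"
  unfolding wbound_def dirac_def using V_ge1 V_pos by (simp add: less_imp_le)

lemma wbound_one: "wbound (\<lambda>_. 1) 1"
  using V_ge1 by (simp add: wbound_def)

lemma wbound_restrict:
  assumes "wbound f c" shows "wbound (\<lambda>z. if z \<in> B then f z else 0) c"
proof -
  have "0 \<le> c * V z" for z using wbound_nonneg[OF assms] V_pos[of z] by simp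
  then show ?thesis using assms by (simp add: wbound_def)
qed

lemma wbound_scale: "wbound f c \<Longrightarrow> wbound (\<lambda>z. a * f z) (\<bar>a\<bar> * c)"
  unfolding wbound_def abs_mult mult.assoc by (intro allI mult_left_mono) auto

lemma wbound_add: "wbound f c \<Longrightarrow> wbound g d \<Longrightarrow> wbound (\<lambda>z. f z + g z) (c + d)"
  unfolding wbound_def distrib_right by (intro allI order_trans[OF abs_triangle_ineq] add_mono) auto

lemma wbound_sum: "(\<And>i. i \<in> I \<Longrightarrow> wbound (f i) (c i)) \<Longrightarrow> wbound (\<lambda>z. \<Sum>i\<in>I. f i z) (\<Sum>i\<in>I. c i)"
  unfolding wbound_def sum_distrib_right
  by (intro allI order_trans[OF sum_abs] sum_mono) blast

lemma weighted_abs_summable: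
  assumes "\<And>y. 0 \<le> k y" "(\<lambda>y. k y * V y) summable_on UNIV" "wbound f c"
  shows "(\<lambda>y. norm (k y * f y)) summable_on UNIV"
proof (rule Infinite_Sum.abs_summable_on_comparison_test')
  show "(\<lambda>y. c * (k y * V y)) summable_on UNIV" using assms(2) by (rule summable_on_cmult_right)
  fix y
  have "k y * \<bar>f y\<bar> \<le> k y * (c * V y)"
    using assms(1,3) by (intro mult_left_mono) (auto simp: wbound_def)
  then show "norm (k y * f y) \<le> c * (k y * V y)"
    using assms(1)[of y] by (simp add: abs_mult mult_ac)
qed

lemma weighted_infsum_le:
  assumes "\<And>y. 0 \<le> k y" "(\<lambda>y. k y * V y) summable_on UNIV" "wbound f c"
  shows "\<bar>\<Sum>\<^sub>\<infinity>y. k y * f y\<bar> \<le> c * (\<Sum>\<^sub>\<infinity>y. k y * V y)"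
proof -
  have "\<bar>k y * f y\<bar> \<le> c * (k y * V y)" for y
  proof -
    have "k y * \<bar>f y\<bar> \<le> k y * (c * V y)"
      using assms(1,3) by (intro mult_left_mono) (auto simp: wbound_def)
    then show ?thesis using assms(1)[of y] by (simp add: abs_mult mult_ac)
  qed
  then have "norm (\<Sum>\<^sub>\<infinity>y. k y * f y) \<le> (\<Sum>\<^sub>\<infinity>y. c * (k y * V y))"
    by (intro norm_infsum_le[OF has_sum_infsum[OF abs_summable_summable[OF weighted_abs_summable[OF assms]]]
          has_sum_infsum[OF summable_on_cmult_right[OF assms(2)]]]) simp
  then show ?thesis by (simp only: infsum_cmult_right' real_norm_def)
qed

lemma kop_abs_summable: "wbound f c \<Longrightarrow> (\<lambda>y. norm (P x y * f y)) summable_on UNIV"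
  by (rule weighted_abs_summable[OF P_nonneg PV_summable])

lemma kop_summable: "wbound f c \<Longrightarrow> (\<lambda>y. P x y * f y) summable_on UNIV"
  using kop_abs_summable by (rule abs_summable_summable)

lemma kop_mono:
  assumes "wbound f c" "wbound g d" "\<And>y. f y \<le> g y" shows "kop P f x \<le> kop P g x"
  unfolding kop_def using assms P_nonneg
  by (intro infsum_mono kop_summable) (auto intro: mult_left_mono)

lemma kop_nonneg: "(\<And>y. 0 \<le> f y) \<Longrightarrow> 0 \<le> kop P f x"
  unfolding kop_def using P_nonneg by (intro infsum_nonneg mult_nonneg_nonneg) auto

lemma kop_scale: "kop P (\<lambda>y. a * f y) x = a * kop P f x"
  unfolding kop_def by (simp add: infsum_cmult_right' [symmetric] mult_ac)

lemma kop_add: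
  assumes "wbound f c" "wbound g d"
  shows "kop P (\<lambda>y. f y + g y) x = kop P f x + kop P g x"
  unfolding kop_def distrib_left using assms by (intro infsum_add kop_summable)

lemma kop_sum:
  assumes "\<And>i. i \<in> I \<Longrightarrow> \<exists>c. wbound (f i) c"
  shows "kop P (\<lambda>y. \<Sum>i\<in>I. f i y) x = (\<Sum>i\<in>I. kop P (f i) x)"
  using assms
proof (induction I rule: infinite_finite_induct)
  case (insert i I)
  then obtain c where "\<And>j. j \<in> insert i I \<Longrightarrow> wbound (f j) (c j)"
    using bchoice[of "insert i I" "\<lambda>j c. wbound (f j) c"] by blast
  then have "kop P (\<lambda>y. f i y + (\<Sum>i\<in>I. f i y)) x = kop P (f i) x + kop P (\<lambda>y. \<Sum>i\<in>I. f i y) x"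
    by (intro kop_add[of _ "c i" _ "sum c I"] wbound_sum) auto
  then show ?case using insert by simp
qed (simp_all add: kop_def)

lemma kop_abs_le: "wbound f c \<Longrightarrow> \<bar>kop P f x\<bar> \<le> c * kop P V x"
  unfolding kop_def by (rule weighted_infsum_le[OF P_nonneg PV_summable])

lemma wbound_kop:
  assumes "wbound f c" shows "wbound (kop P f) (c * C0)"
  unfolding wbound_def
proof
  fix x
  have "\<bar>kop P f x\<bar> \<le> c * kop P V x" using assms by (rule kop_abs_le)
  also have "\<dots> \<le> c * (C0 * V x)" using wbound_nonneg[OF assms] by (intro mult_left_mono PV_le)
  finally show "\<bar>kop P f x\<bar> \<le> c * C0 * V x" by (simp add: mult.assoc)
qed

lemma wbound_taboo: "wbound f c \<Longrightarrow> wbound (taboo P B f n) (c * C0 ^ Suc n)"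
proof (induction n)
  case 0 then show ?case by (simp add: wbound_kop)
next
  case (Suc n)
  from wbound_kop[OF wbound_restrict[OF Suc.IH[OF Suc.prems], of B]] show ?case by (simp add: mult_ac)
qed

lemma taboo_nonneg: "(\<And>y. 0 \<le> f y) \<Longrightarrow> 0 \<le> taboo P B f n x"
  by (induction n arbitrary: x) (auto intro!: kop_nonneg)

lemma nonneg_taboo_fps: "(\<And>y. 0 \<le> f y) \<Longrightarrow> nonneg_fps (taboo_fps P B f x)"
  by (simp add: nonneg_fps_def taboo_fps_nth taboo_nonneg)

lemma dirac_nonneg: "0 \<le> dirac y z"
  by (simp add: dirac_def)

text \<open>A path either avoids \<open>T\<close> at all intermediate times or is cut at its first
  visit, at time \<open>i + 1\<close> in \<open>s\<close>. Index \<open>n\<close> of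
  \<open>taboo\<close> means \<open>n + 1\<close> steps, so the remaining path has index
  \<open>n - 1 - i\<close>; the end point is unrestricted and does not count as a visit.\<close>

lemma taboo_first_visit:
  assumes T: "finite T" "B \<inter> T = {}" and f: "wbound f c"
  shows "taboo P (B \<union> T) f n x = taboo P B f n x +
    (\<Sum>s\<in>T. \<Sum>i<n. taboo P B (dirac s) i x * taboo P (B \<union> T) f (n - 1 - i) s)"
proof (induction n arbitrary: x)
  case 0 show ?case by simp
next
  case (Suc n)
  let ?t = "\<lambda>n. taboo P (B \<union> T) f n"
  let ?r = "\<lambda>g z. if z \<in> B then g z else (0::real)"
  let ?g = "\<lambda>s i z. ?t (n - 1 - i) s * ?r (taboo P B (dirac s) i) z"
  let ?h = "\<lambda>s z. ?t n s * dirac s z"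
  have wr: "wbound (?r (taboo P B f n)) (c * C0 ^ Suc n)"
    by (intro wbound_restrict wbound_taboo f)
  have wg: "wbound (?g s i) (\<bar>?t (n - 1 - i) s\<bar> * (1 * C0 ^ Suc i))" for s i
    by (intro wbound_scale wbound_restrict wbound_taboo wbound_dirac)
  have wh: "wbound (?h s) (\<bar>?t n s\<bar> * 1)" for s
    by (intro wbound_scale wbound_dirac)
  \<comment> \<open>After one step the chain is in \<open>B\<close>, where the induction hypothesis
    applies, or in \<open>T\<close>, which is a first visit at time 1.\<close>
  have eq: "(if z \<in> B \<union> T then ?t n z else 0) =
      ?r (taboo P B f n) z + ((\<Sum>s\<in>T. \<Sum>i<n. ?g s i z) + (\<Sum>s\<in>T. ?h s z))" for z
  proof -
    have *: "(\<Sum>s\<in>T. ?h s z) = (if z \<in> T then ?t n z else 0)"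
      using T(1) by (simp add: dirac_def if_distrib sum.delta cong: if_cong)
    show ?thesis
    proof (cases "z \<in> B")
      case True
      then have "z \<notin> T" using T by auto
      then show ?thesis using True Suc[of z] * by (simp add: mult.commute)
    qed (simp add: *)
  qed
  have "?t (Suc n) x = kop P (\<lambda>z. ?r (taboo P B f n) z + ((\<Sum>s\<in>T. \<Sum>i<n. ?g s i z) + (\<Sum>s\<in>T. ?h s z))) x"
    by (simp only: taboo.simps eq)
  also have "\<dots> = kop P (?r (taboo P B f n)) x +
      ((\<Sum>s\<in>T. \<Sum>i<n. kop P (?g s i) x) + (\<Sum>s\<in>T. kop P (?h s) x))"
  proof -
    have wG: "wbound (\<lambda>z. \<Sum>i<n. ?g s i z) (\<Sum>i<n. \<bar>?t (n - 1 - i) s\<bar> * (1 * C0 ^ Suc i))" for s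
      by (intro wbound_sum wg)
    have "kop P (\<lambda>z. \<Sum>s\<in>T. \<Sum>i<n. ?g s i z) x = (\<Sum>s\<in>T. kop P (\<lambda>z. \<Sum>i<n. ?g s i z) x)"
      by (rule kop_sum) (rule exI, rule wG)
    also have "\<dots> = (\<Sum>s\<in>T. \<Sum>i<n. kop P (?g s i) x)"
      by (rule sum.cong[OF refl], rule kop_sum) (rule exI, rule wg)
    finally have 1: "kop P (\<lambda>z. \<Sum>s\<in>T. \<Sum>i<n. ?g s i z) x = (\<Sum>s\<in>T. \<Sum>i<n. kop P (?g s i) x)" .
    have 2: "kop P (\<lambda>z. \<Sum>s\<in>T. ?h s z) x = (\<Sum>s\<in>T. kop P (?h s) x)"
      by (rule kop_sum) (rule exI, rule wh)
    show ?thesis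
      by (subst kop_add[OF wr wbound_add[OF wbound_sum[OF wG] wbound_sum[OF wh]]],
          subst kop_add[OF wbound_sum[OF wG] wbound_sum[OF wh]]) (simp only: 1 2)
  qed
  also have "\<dots> = taboo P B f (Suc n) x +
      (\<Sum>s\<in>T. (\<Sum>i<n. taboo P B (dirac s) (Suc i) x * ?t (n - 1 - i) s) + taboo P B (dirac s) 0 x * ?t n s)"
  proof -
    have "kop P (?g s i) x = taboo P B (dirac s) (Suc i) x * ?t (n - 1 - i) s" for s i
      by (subst kop_scale) (simp only: taboo.simps(2) mult.commute)
    moreover have "kop P (?h s) x = taboo P B (dirac s) 0 x * ?t n s" for s
      by (subst kop_scale) (simp only: taboo.simps(1) mult.commute)
    ultimately show ?thesis by (simp only: sum.distrib taboo.simps(2))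
  qed
  also have "\<dots> = taboo P B f (Suc n) x + (\<Sum>s\<in>T. \<Sum>i<Suc n. taboo P B (dirac s) i x * ?t (Suc n - 1 - i) s)"
    by (simp add: sum.lessThan_Suc_shift add.commute del: taboo.simps sum.lessThan_Suc)
  finally show ?case .
qed

text \<open>The factor \<open>fps_X\<close> in \<open>taboo_fps\<close> makes exponents count steps,
  which absorbs the shift \<open>n - 1 - i\<close> into an ordinary product.\<close>

lemma taboo_fps_first_visit:
  assumes "finite T" "B \<inter> T = {}" "wbound f c"
  shows "taboo_fps P (B \<union> T) f x =
    taboo_fps P B f x + (\<Sum>s\<in>T. taboo_fps P B (dirac s) x * taboo_fps P (B \<union> T) f s)"
proof (rule fps_ext)
  fix n
  have prod: "fps_nth (taboo_fps P B (dirac s) x * taboo_fps P (B \<union> T) f s) (Suc m) =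
      (\<Sum>i<m. taboo P B (dirac s) i x * taboo P (B \<union> T) f (m - 1 - i) s)" for s m
  proof -
    have "taboo_fps P B (dirac s) x * taboo_fps P (B \<union> T) f s =
        fps_X * (fps_X * (Abs_fps (\<lambda>n. taboo P B (dirac s) n x) * Abs_fps (\<lambda>n. taboo P (B \<union> T) f n s)))"
      by (simp add: taboo_fps_def mult_ac)
    then show ?thesis
      by (cases m) (simp_all add: fps_mult_nth[of "Abs_fps _"] lessThan_Suc_atMost atMost_atLeast0)
  qed
  show "fps_nth (taboo_fps P (B \<union> T) f x) n = fps_nth (taboo_fps P B f x +
      (\<Sum>s\<in>T. taboo_fps P B (dirac s) x * taboo_fps P (B \<union> T) f s)) n"
  proof (cases n)
    case 0 then show ?thesis by (simp add: fps_sum_nth)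
  next
    case (Suc m)
    then show ?thesis using taboo_first_visit[OF assms, of m x]
      by (simp add: fps_sum_nth prod del: taboo.simps)
  qed
qed

text \<open>No path is cut at its last visit. The right-hand side is shown to satisfy the
  first-visit equations of the left-hand side; by \<open>fps_system_unique\<close> the two agree on
  \<open>T\<close>, and then at every \<open>x\<close>.\<close>

lemma taboo_fps_last_visit:
  assumes T: "finite T" "B \<inter> T = {}" and f: "wbound f c"
  shows "taboo_fps P (B \<union> T) f x =
    taboo_fps P B f x + (\<Sum>t\<in>T. taboo_fps P (B \<union> T) (dirac t) x * taboo_fps P B f t)"
proof -
  let ?E = "\<lambda>f x. taboo_fps P B f x" and ?A = "\<lambda>f x. taboo_fps P (B \<union> T) f x"
  define D where "D x = ?E f x + (\<Sum>t\<in>T. ?A (dirac t) x * ?E f t)" for x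
  have A_rec: "?A g x = ?E g x + (\<Sum>s\<in>T. ?E (dirac s) x * ?A g s)" if "wbound g c" for g c x
    using taboo_fps_first_visit[OF T that] .
  have D_rec: "D x = ?E f x + (\<Sum>s\<in>T. ?E (dirac s) x * D s)" for x
  proof -
    have "(\<Sum>t\<in>T. ?A (dirac t) x * ?E f t) =
        (\<Sum>t\<in>T. ?E (dirac t) x * ?E f t + (\<Sum>s\<in>T. ?E (dirac s) x * ?A (dirac t) s * ?E f t))"
      by (subst A_rec[OF wbound_dirac]) (simp add: distrib_right sum_distrib_right)
    also have "\<dots> = (\<Sum>s\<in>T. ?E (dirac s) x * ?E f s) +
        (\<Sum>s\<in>T. \<Sum>t\<in>T. ?E (dirac s) x * ?A (dirac t) s * ?E f t)"
      by (simp only: sum.distrib) (subst sum.swap, simp)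
    also have "\<dots> = (\<Sum>s\<in>T. ?E (dirac s) x * D s)"
      by (simp add: D_def distrib_left sum.distrib sum_distrib_left mult.assoc)
    finally show ?thesis unfolding D_def[of x] by simp
  qed
  have "?A f s - D s = 0" if "s \<in> T" for s
  proof (rule fps_system_unique[where d = "\<lambda>s. ?A f s - D s" and T = T and E = "\<lambda>x s. ?E (dirac s) x"])
    show "?A f x - D x = (\<Sum>s\<in>T. ?E (dirac s) x * (?A f s - D s))" for x
      by (subst A_rec[OF f], subst D_rec) (simp add: right_diff_distrib sum_subtractf)
  qed (use that in auto)
  then have "?A f x = D x" by (subst A_rec[OF f], subst D_rec) simp
  then show ?thesis by (simp add: D_def)
qed

section \<open>Kernel powers and the semigroup in terms of taboo kernels\<close>

lemma kpow_Suc_taboo: "kpow P (Suc n) x y = taboo P UNIV (dirac y) n x"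
proof (induction n arbitrary: x)
  case 0 show ?case by (simp add: kop_def dirac_def)
next
  case (Suc n)
  have "kpow P (Suc (Suc n)) x y = (\<Sum>\<^sub>\<infinity>z. P x z * kpow P (Suc n) z y)" by (rule kpow.simps)
  also have "\<dots> = taboo P UNIV (dirac y) (Suc n) x" by (simp only: Suc taboo.simps kop_def UNIV_I if_True)
  finally show ?case .
qed

lemma kpow_nonneg: "0 \<le> kpow P n x y"
  by (cases n) (auto simp: kpow_Suc_taboo dirac_nonneg taboo_nonneg simp del: kpow.simps(2))

text \<open>The joint summability in the last conjunct permits exchanging the two sums when the
  first step is split off; \<open>semigrp_Suc\<close> relies on it again.\<close>

lemma kpow_V:
  "(\<lambda>y. kpow P n x y * V y) summable_on UNIV \<and> (\<Sum>\<^sub>\<infinity>y. kpow P n x y * V y) \<le> C0 ^ n * V x \<and>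
   (n > 0 \<longrightarrow> (\<lambda>(z, y). P x z * (kpow P (n - 1) z y * V y)) summable_on UNIV \<times> UNIV)"
proof (induction n arbitrary: x)
  case 0
  have "(\<lambda>y. kpow P 0 x y * V y) summable_on {x}" by simp
  then have "(\<lambda>y. kpow P 0 x y * V y) summable_on UNIV"
    by (rule summable_on_cong_neutral[THEN iffD1, rotated 3]) auto
  moreover have "(\<Sum>\<^sub>\<infinity>y. kpow P 0 x y * V y) = (\<Sum>\<^sub>\<infinity>y\<in>{x}. kpow P 0 x y * V y)"
    by (rule infsum_cong_neutral) auto
  ultimately show ?case by simp
next
  case (Suc n)
  let ?H = "\<lambda>z y. P x z * (kpow P n z y * V y)"
  let ?F = "\<lambda>(z, y). ?H z y"
  define S where "S z = (\<Sum>\<^sub>\<infinity>y. kpow P n z y * V y)" for z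
  have S0: "0 \<le> S z" for z unfolding S_def
    using kpow_nonneg V_pos by (intro infsum_nonneg mult_nonneg_nonneg) (auto intro: less_imp_le)
  have Sb: "wbound S (C0 ^ n)" using Suc S0 by (simp add: wbound_def S_def)
  have nn: "0 \<le> ?H z y" for z y
    using P_nonneg kpow_nonneg V_pos by (simp add: less_imp_le)
  have abs: "(\<lambda>p. norm (?F p)) summable_on UNIV \<times> UNIV"
    unfolding Infinite_Sum.abs_summable_on_Sigma_iff
  proof (intro conjI ballI)
    fix z
    show "(\<lambda>y. norm (?F (z, y))) summable_on UNIV"
      using Suc[of z] nn by (simp add: summable_on_cmult_right)
  next
    have eq: "(\<Sum>\<^sub>\<infinity>y. norm (?F (z, y))) = P x z * S z" for z
      using nn by (simp add: S_def infsum_cmult_right')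
    show "(\<lambda>z. norm (\<Sum>\<^sub>\<infinity>y. norm (?F (z, y)))) summable_on UNIV"
      unfolding eq by (rule kop_abs_summable[OF Sb])
  qed
  then have summ: "?F summable_on UNIV \<times> UNIV" by (rule abs_summable_summable)
  have k: "(\<Sum>\<^sub>\<infinity>z. ?H z y) = kpow P (Suc n) x y * V y" for y
    by (simp add: infsum_cmult_left' [symmetric] mult.assoc)
  have "(\<lambda>(y, z). ?H z y) summable_on UNIV \<times> UNIV"
    using summ by (subst (asm) summable_on_swap) (simp add: case_prod_unfold)
  then have "(\<lambda>y. \<Sum>\<^sub>\<infinity>z. ?H z y) summable_on UNIV"
    by (rule summable_on_Sigma_banach[of "\<lambda>y z. ?H z y" UNIV "\<lambda>_. UNIV"])
  then have 1: "(\<lambda>y. kpow P (Suc n) x y * V y) summable_on UNIV" by (simp only: k)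
  have "(\<Sum>\<^sub>\<infinity>y. kpow P (Suc n) x y * V y) = (\<Sum>\<^sub>\<infinity>z. \<Sum>\<^sub>\<infinity>y. ?H z y)"
    unfolding k [symmetric] by (rule infsum_swap_banach [symmetric]) (rule summ)
  also have "\<dots> = kop P S x" by (simp add: infsum_cmult_right' S_def kop_def)
  also have "\<dots> \<le> C0 ^ n * kop P V x" using kop_abs_le[OF Sb, of x] by simp
  also have "\<dots> \<le> C0 ^ n * (C0 * V x)" using C0_nonneg by (intro mult_left_mono PV_le) auto
  finally have 2: "(\<Sum>\<^sub>\<infinity>y. kpow P (Suc n) x y * V y) \<le> C0 ^ Suc n * V x" by (simp add: mult_ac)
  show ?case using 1 2 summ by simp
qed

lemma kpow_summable: "wbound f c \<Longrightarrow> (\<lambda>y. kpow P n x y * f y) summable_on UNIV"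
  by (rule abs_summable_summable, rule weighted_abs_summable[OF kpow_nonneg conjunct1[OF kpow_V]])

lemma semigrp_0: "semigrp P 0 f x = f x"
proof -
  have "semigrp P 0 f x = (\<Sum>\<^sub>\<infinity>y\<in>{x}. kpow P 0 x y * f y)"
    unfolding semigrp_def by (rule infsum_cong_neutral) auto
  then show ?thesis by simp
qed

lemma semigrp_Suc:
  assumes "wbound f c" shows "semigrp P (Suc n) f x = kop P (semigrp P n f) x"
proof -
  let ?H = "\<lambda>z y. P x z * (kpow P n z y * f y)"
  have "(\<lambda>p. norm (case p of (z, y) \<Rightarrow> ?H z y)) summable_on UNIV \<times> UNIV"
  proof (rule Infinite_Sum.abs_summable_on_comparison_test')
    show "(\<lambda>p. c * (\<lambda>(z, y). P x z * (kpow P n z y * V y)) p) summable_on UNIV \<times> UNIV"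
      using kpow_V[of "Suc n" x] by (intro summable_on_cmult_right) simp
    fix p :: "'a \<times> 'a"
    obtain z y where p: "p = (z, y)" by (cases p)
    have "(P x z * kpow P n z y) * \<bar>f y\<bar> \<le> (P x z * kpow P n z y) * (c * V y)"
      using assms kpow_nonneg P_nonneg by (intro mult_left_mono mult_nonneg_nonneg) (auto simp: wbound_def)
    then show "norm (case p of (z, y) \<Rightarrow> ?H z y) \<le>
        c * (case p of (z, y) \<Rightarrow> P x z * (kpow P n z y * V y))"
      using kpow_nonneg[of n z y] P_nonneg[of x z] V_pos[of y] by (simp add: p abs_mult mult_ac)
  qed
  then have s: "(\<lambda>(z, y). ?H z y) summable_on UNIV \<times> UNIV"
    by (rule abs_summable_summable)
  have k: "(\<Sum>\<^sub>\<infinity>z. ?H z y) = kpow P (Suc n) x y * f y" for y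
    by (simp add: infsum_cmult_left' [symmetric] mult.assoc)
  have "semigrp P (Suc n) f x = (\<Sum>\<^sub>\<infinity>z. \<Sum>\<^sub>\<infinity>y. ?H z y)"
    unfolding semigrp_def k [symmetric] by (rule infsum_swap_banach [symmetric]) (rule s)
  also have "\<dots> = kop P (semigrp P n f) x" by (simp add: infsum_cmult_right' semigrp_def kop_def)
  finally show ?thesis .
qed

lemma semigrp_Suc_taboo:
  assumes "wbound f c" shows "semigrp P (Suc n) f x = taboo P UNIV f n x"
proof (induction n arbitrary: x)
  case 0 show ?case using semigrp_Suc[OF assms, of 0 x] by (simp add: semigrp_0 [abs_def])
next
  case (Suc n)
  then have "semigrp P (Suc n) f = taboo P UNIV f n" by (simp add: fun_eq_iff)
  then show ?case using semigrp_Suc[OF assms, of "Suc n" x] by simp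
qed

lemma semigrp_taboo_fps:
  assumes "wbound f c" "n \<ge> 1" shows "semigrp P n f x = fps_nth (taboo_fps P UNIV f x) n"
  using semigrp_Suc_taboo[OF assms(1)] assms(2) by (cases n) auto

lemma kpow_taboo_fps: "n \<ge> 1 \<Longrightarrow> kpow P n x y = fps_nth (taboo_fps P UNIV (dirac y) x) n"
  by (cases n) (simp_all add: kpow_Suc_taboo del: kpow.simps(2))

lemma wbound_semigrp:
  assumes "wbound f c" shows "wbound (semigrp P n f) (c * C0 ^ n)"
proof (cases n)
  case 0 then show ?thesis using assms by (simp add: semigrp_0 [abs_def])
next
  case (Suc m)
  then have "semigrp P n f = taboo P UNIV f m" using semigrp_Suc_taboo[OF assms] by (simp add: fun_eq_iff)
  then show ?thesis using wbound_taboo[OF assms, of UNIV m] Suc by simp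
qed

lemma semigrp_add_steps:
  assumes "wbound f c" shows "semigrp P (n + m) f x = semigrp P n (semigrp P m f) x"
proof (induction n arbitrary: x)
  case 0 show ?case by (simp add: semigrp_0)
next
  case (Suc n)
  then have "semigrp P (n + m) f = semigrp P n (semigrp P m f)" by (simp add: fun_eq_iff)
  then show ?case
    using semigrp_Suc[OF assms, of "n + m" x] semigrp_Suc[OF wbound_semigrp[OF assms, of m], of n x] by simp
qed

lemma semigrp_dirac: "semigrp P n (dirac y) x = kpow P n x y"
proof -
  have "semigrp P n (dirac y) x = (\<Sum>\<^sub>\<infinity>z\<in>{y}. kpow P n x z * dirac y z)"
    unfolding semigrp_def by (rule infsum_cong_neutral) (auto simp: dirac_def)
  then show ?thesis by (simp add: dirac_def)
qed

end

section \<open>Growth of transition probabilities on the finite set\<close>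

lemma nonneg_fps_add_eq_0:
  assumes "nonneg_fps a" "nonneg_fps b" "a + b = 0" shows "a = 0"
proof (rule fps_ext)
  fix n
  have "fps_nth a n + fps_nth b n = 0" using assms(3) by (metis fps_add_nth fps_zero_nth)
  then show "fps_nth a n = fps_nth 0 n"
    using nonneg_fpsD[OF assms(1), of n] nonneg_fpsD[OF assms(2), of n] by simp
qed

lemma fps_summable_add_left:
  assumes "nonneg_fps a" "nonneg_fps b" "fps_summable (a + b) t" "0 \<le> t"
  shows "fps_summable a t"
  using assms(3,4) by (rule fps_summable_le[rotated]) (simp add: nonneg_fpsD[OF assms(1)] nonneg_fpsD[OF assms(2)])

locale compact_kernel = weighted_kernel P V C0
  for P :: "'a \<Rightarrow> 'a \<Rightarrow> real" and V C0 +
  fixes e :: real and K :: "'a set"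
  assumes e_pos: "0 < e" and finite_K: "finite K"
    and contract: "\<And>x. x \<notin> K \<Longrightarrow> kop P V x \<le> e * V x"
    and aperiodic: "\<And>x. aperiodic_state P x"
begin

text \<open>Only intermediate states are restricted to \<open>B\<close>: end points of paths in
  \<open>E\<close> may lie in \<open>K\<close>. All these series start at one step, so
  \<open>A x x\<close> does not contain the empty path.\<close>

abbreviation G :: "'a set \<Rightarrow> 'a \<Rightarrow> 'a \<Rightarrow> real fps" where
  "G B x y \<equiv> taboo_fps P B (dirac y) x"

abbreviation A :: "'a \<Rightarrow> 'a \<Rightarrow> real fps" where
  "A \<equiv> G UNIV"

abbreviation E :: "'a \<Rightarrow> 'a \<Rightarrow> real fps" where
  "E \<equiv> G (- K)"

abbreviation full :: "('a \<Rightarrow> real) \<Rightarrow> 'a \<Rightarrow> real fps" where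
  "full \<equiv> taboo_fps P UNIV"

abbreviation avoid :: "('a \<Rightarrow> real) \<Rightarrow> 'a \<Rightarrow> real fps" where
  "avoid \<equiv> taboo_fps P (- K)"

lemma nonneg_G [simp]: "nonneg_fps (G B x y)"
  by (intro nonneg_taboo_fps dirac_nonneg)

text \<open>Each of the \<open>n\<close> intermediate states outside \<open>K\<close> contributes a
  factor \<open>e\<close>; the first step starts anywhere and is left as
  \<open>kop P V x\<close>.\<close>

lemma taboo_outside_bound:
  assumes "wbound f c" shows "\<bar>taboo P (- K) f n x\<bar> \<le> c * e ^ n * kop P V x"
proof (induction n arbitrary: x)
  case 0 show ?case using kop_abs_le[OF assms] by simp
next
  case (Suc n)
  have "wbound (\<lambda>z. if z \<in> - K then taboo P (- K) f n z else 0) (c * e ^ Suc n)"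
    unfolding wbound_def
  proof
    fix z
    have c: "0 \<le> c * e ^ n" using wbound_nonneg[OF assms] e_pos by simp
    have "\<bar>taboo P (- K) f n z\<bar> \<le> c * e ^ n * (e * V z)" if "z \<notin> K"
      using Suc[of z] mult_left_mono[OF contract[OF that] c] by linarith
    moreover have "0 \<le> c * e ^ Suc n * V z"
      using wbound_nonneg[OF assms] e_pos V_pos[of z] by simp
    ultimately show "\<bar>if z \<in> - K then taboo P (- K) f n z else 0\<bar> \<le> c * e ^ Suc n * V z"
      by (simp add: mult_ac)
  qed
  then show ?case using kop_abs_le by simp
qed

text \<open>The first step may start in \<open>K\<close>, where only \<open>C0\<close> is available.
  Dividing by \<open>e\<close> allows the exponent of \<open>e\<close> in
  \<open>outside_fps_bound\<close> to be the full number of steps.\<close>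

definition C1 :: real where "C1 = C0 / e"

lemma C1_nonneg: "0 \<le> C1"
  using C0_nonneg e_pos by (simp add: C1_def)

lemma outside_fps_bound:
  assumes "wbound f c" shows "\<bar>fps_nth (avoid f x) n\<bar> \<le> c * C1 * V x * e ^ n"
proof (cases n)
  case 0
  then show ?thesis using wbound_nonneg[OF assms] C1_nonneg V_pos[of x] by (simp add: taboo_fps_nth_0)
next
  case (Suc m)
  have "0 \<le> c * e ^ m" using wbound_nonneg[OF assms] e_pos by simp
  then have "\<bar>taboo P (- K) f m x\<bar> \<le> c * e ^ m * (C0 * V x)"
    using taboo_outside_bound[OF assms, of m x] mult_left_mono[OF PV_le[of x]] by (meson order_trans)
  also have "\<dots> = c * C1 * V x * e ^ n" using e_pos Suc by (simp add: C1_def)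
  finally show ?thesis using Suc by (simp del: taboo.simps)
qed

lemma outside_fps_summable:
  assumes "wbound f c" "0 \<le> t" "t < 1 / e"
  shows "fps_summable (avoid f x) t"
  unfolding fps_summable_def
proof (rule summable_comparison_test')
  have "e * t < 1" using assms e_pos by (simp add: field_simps)
  then show "summable (\<lambda>n. c * C1 * V x * (e * t) ^ n)"
    using assms e_pos by (intro summable_mult summable_geometric) simp
  fix n
  show "norm (fps_nth (avoid f x) n * t ^ n) \<le> c * C1 * V x * (e * t) ^ n"
    using mult_right_mono[OF outside_fps_bound[OF assms(1), of x n], of "t ^ n"] assms(2)
    by (simp add: abs_mult power_mult_distrib mult.assoc)
qed

lemma outside_regular:
  assumes "wbound f c" "\<And>y. 0 \<le> f y" shows "regular_growth e (avoid f x)"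
  using assms by (intro regular_growthI_summable nonneg_taboo_fps outside_fps_summable)

section \<open>Adding the states of K and the growth of return probabilities\<close>

lemma add_state:
  assumes "s \<notin> B" "wbound f c"
  shows "taboo_fps P (insert s B) f x = taboo_fps P B f x + G B x s * taboo_fps P (insert s B) f s"
  using taboo_fps_first_visit[of "{s}" B f c x] assms by simp

lemma open_conv_taboo:
  assumes "finite T" "T \<subseteq> K" "wbound f c" "\<And>y. 0 \<le> f y"
  shows "open_conv (1 / e) (taboo_fps P (- K \<union> T) f x)"
  using assms
proof (induction T arbitrary: f c x rule: finite_induct)
  case empty
  then show ?case using nonneg_taboo_fps outside_fps_summable by (intro open_conv_radius) auto
next
  case (insert s T)
  let ?B = "- K \<union> T"
  have s: "s \<notin> ?B" using insert by auto
  have ins: "- K \<union> insert s T = insert s ?B" by simp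
  have IH: "open_conv (1 / e) (taboo_fps P ?B g x)" if "wbound g d" "\<And>y. 0 \<le> g y" for g d x
    using insert.IH[OF _ that] insert.prems by auto
  note IHG = IH[OF wbound_dirac dirac_nonneg]
  define u where "u = inverse (1 - G ?B s s)"
  have u: "(1 - G ?B s s) * u = 1"
    unfolding u_def by (rule one_minus_fps_unit) simp
  \<comment> \<open>At \<open>x = s\<close> the equation of \<open>add_state\<close> is linear in
    the unknown series, and multiplication by \<open>u\<close> solves it.\<close>
  have "(1 - G ?B s s) * taboo_fps P (insert s ?B) f s = taboo_fps P ?B f s"
    using add_state[OF s insert.prems(2), of s] by (simp add: algebra_simps)
  then have "u * taboo_fps P ?B f s = ((1 - G ?B s s) * u) * taboo_fps P (insert s ?B) f s"
    by (simp only: mult_ac)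
  then have "taboo_fps P (insert s ?B) f s = u * taboo_fps P ?B f s" using u by simp
  then have eq: "taboo_fps P (insert s ?B) f x = taboo_fps P ?B f x + G ?B x s * (u * taboo_fps P ?B f s)"
    using add_state[OF s insert.prems(2), of x] by simp
  show ?case unfolding ins eq
    by (intro open_conv_add open_conv_mult open_conv_geom[OF IHG _ u] IHG IH[OF insert.prems(2,3)]) auto
qed

lemma first_passage:
  assumes "wbound f c"
  shows "full f x = taboo_fps P (- {s}) f x + G (- {s}) x s * full f s"
  using add_state[of s "- {s}" f c x] assms by (simp add: insert_Diff_single Compl_eq_Diff_UNIV)

lemma return_geom: "(1 - G (- {s}) s s) * (1 + A s s) = 1"
proof -
  have "A s s = G (- {s}) s s + G (- {s}) s s * A s s" by (rule first_passage[OF wbound_dirac])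
  then show ?thesis by (simp add: algebra_simps)
qed

text \<open>\<open>1 + A s s\<close> is the geometric series of the first-return series. If it
  diverges before 1/e, \<open>geom_fps_critical\<close> provides the critical point that the renewal
  theorem needs. Convergence of the first-return series at 1/l is recorded for
  \<open>same_class_regular\<close>.\<close>

lemma diagonal_growth:
  assumes "s \<in> K"
  shows "(\<forall>t. 0 \<le> t \<and> t < 1 / e \<longrightarrow> fps_summable (A s s) t) \<or>
    (\<exists>l>e. \<exists>c>0. asymp_growth (1 + A s s) l 0 c \<and> asymp_growth (A s s) l 0 c \<and>
       fps_summable (G (- {s}) s s) (1 / l))"
proof (cases "\<forall>t. 0 \<le> t \<and> t < 1 / e \<longrightarrow> fps_summable (1 + A s s) t")
  case True
  then show ?thesis
    using fps_summable_add_left[of "A s s" 1] by (auto simp: add.commute)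
next
  case False
  let ?F = "G (- {s}) s s" and ?u = "1 + A s s"
  obtain t where t: "0 \<le> t" "t < 1 / e" "\<not> fps_summable ?u t" using False by auto
  have "- {s} = - K \<union> (K - {s})" using assms by auto
  then have oc: "open_conv (1 / e) ?F"
    using open_conv_taboo[OF _ _ wbound_dirac dirac_nonneg, of "K - {s}" s s] finite_K by simp
  obtain \<rho> r where \<rho>: "0 < \<rho>" "\<rho> \<le> t" "\<rho> < r" "fps_summable ?F r" "fps_sum ?F \<rho> = 1"
    using geom_fps_critical[OF oc _ return_geom t] by auto
  have set_eq: "{n. 0 < n \<and> 0 < fps_nth ?u n} = {n. n \<ge> 1 \<and> kpow P n s s > 0}"
    by (auto simp: kpow_taboo_fps simp del: kpow.simps)
  \<comment> \<open>\<open>aperiodic_state\<close> also admits states without return; divergence at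
    \<open>t\<close> excludes them, so the gcd is 1.\<close>
  have "{n. n \<ge> 1 \<and> kpow P n s s > 0} \<noteq> {}"
  proof
    assume "{n. n \<ge> 1 \<and> kpow P n s s > 0} = {}"
    then have "\<not> kpow P n s s > 0" if "n \<ge> 1" for n using that by blast
    then have "kpow P n s s = 0" if "n \<ge> 1" for n
      using that kpow_nonneg[of n s s] by (simp add: order_less_le)
    then have "fps_nth (A s s) n = 0" for n
      using kpow_taboo_fps[of n s s] by (cases "n \<ge> 1") (simp_all add: not_le)
    then have "A s s = 0" by (intro fps_ext) simp
    moreover have "fps_summable 1 t"
      unfolding fps_summable_def by (rule summable_finite[of "{0}"]) auto
    ultimately show False using t(3) by simp
  qed
  then have "Gcd {n. 0 < n \<and> 0 < fps_nth ?u n} = 1"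
    using aperiodic[of s] unfolding set_eq aperiodic_state_def Let_def by blast
  then obtain c where c: "c > 0" "(\<lambda>n. fps_nth ?u n * \<rho> ^ n) \<longlonglongrightarrow> c"
    using renewal_theorem[OF _ _ return_geom \<rho>(4,1,3,5)] by auto
  have "\<rho> < 1 / e" using \<rho> t by simp
  then have l: "1 / \<rho> > e" using \<rho> e_pos by (simp add: field_simps)
  have a1: "asymp_growth ?u (1 / \<rho>) 0 c"
    using c(2) by (simp add: asymp_growth_def power_divide)
  have "eventually (\<lambda>n. fps_nth ?u n / ((1 / \<rho>) ^ n * real n ^ 0) = fps_nth (A s s) n / ((1 / \<rho>) ^ n * real n ^ 0)) sequentially"
    using eventually_gt_at_top[of 0] by eventually_elim simp
  then have a2: "asymp_growth (A s s) (1 / \<rho>) 0 c"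
    using a1 unfolding asymp_growth_def by (rule Lim_transform_eventually[rotated])
  have "fps_summable ?F \<rho>" by (rule fps_summable_mono[OF nonneg_G \<rho>(4)]) (use \<rho> in auto)
  then show ?thesis using l c a1 a2 by (intro disjI2 exI[of _ "1 / \<rho>"]) auto
qed

text \<open>Paths from \<open>x\<close> to \<open>y\<close> through \<open>s\<close> are among all
  paths from \<open>x\<close> to \<open>y\<close>, and their series is a product. So convergence for
  the start \<open>x\<close> passes on to a state \<open>s\<close> that \<open>x\<close> can
  reach.\<close>

lemma G_prod_summable:
  assumes "s \<notin> B" "fps_summable (taboo_fps P (insert s B) (dirac y) x) t" "0 < t" "G B x s \<noteq> 0"
  shows "fps_summable (G (insert s B) s y) t"
proof -
  have "fps_summable (G B x s * G (insert s B) s y + G B x y) t"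
    using assms(2) add_state[OF assms(1) wbound_dirac, of y x] by (simp add: add.commute)
  then have "fps_summable (G B x s * G (insert s B) s y) t"
    by (rule fps_summable_add_left[rotated 2]) (use assms(3) in \<open>auto intro: nonneg_fps_mult\<close>)
  then show ?thesis
    using fps_summable_mult_factor[of "G (insert s B) s y" "G B x s" t] assms by (simp add: mult.commute)
qed

section \<open>Reachability and communicating classes\<close>

lemma first_passage_nonzero:
  assumes "A t s \<noteq> 0" shows "G (- {s}) t s \<noteq> 0"
proof
  assume "G (- {s}) t s = 0"
  then have "A t s = 0" using first_passage[OF wbound_dirac, of s t s] by simp
  then show False using assms by simp
qed

text \<open>A nonzero series \<open>A x y\<close> expresses that \<open>y\<close> can be reached
  from \<open>x\<close> in at least one step; a vanishing sum of nonnegative series has only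
  vanishing terms.\<close>

lemma reach_trans:
  assumes "A x y \<noteq> 0" "A y z \<noteq> 0" shows "A x z \<noteq> 0"
proof
  assume "A x z = 0"
  then have "G (- {y}) x y * A y z + G (- {y}) x z = 0"
    using first_passage[OF wbound_dirac, of z x y] by (simp add: add.commute)
  then have "G (- {y}) x y * A y z = 0"
    by (rule nonneg_fps_add_eq_0[rotated 2]) (auto intro: nonneg_fps_mult)
  then show False using first_passage_nonzero[OF assms(1)] assms(2) by simp
qed

lemma taboo_reach:
  assumes "G B x y \<noteq> 0" "finite (- B)" shows "A x y \<noteq> 0"
proof
  assume "A x y = 0"
  then have "G B x y + (\<Sum>s\<in>- B. G B x s * A s y) = 0"
    using taboo_fps_first_visit[OF assms(2) _ wbound_dirac, of B y x] by simp
  then have "G B x y = 0"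
    by (rule nonneg_fps_add_eq_0[rotated 2]) (auto intro!: nonneg_fps_sum nonneg_fps_mult)
  then show False using assms by simp
qed

text \<open>Cut at the first visit to \<open>t\<close>:
  \<open>A s t = G (- {t}) s t * (1 + A t t)\<close>. As \<open>t\<close> leads to \<open>s\<close>,
  the first factor times a nonzero series is part of the first-return series of \<open>t\<close>,
  hence converges at 1/l. In the unresolved case, \<open>A t t\<close> itself dominates a nonzero
  series times \<open>A s t\<close>.\<close>

lemma same_class_regular:
  assumes "s \<in> K" "t \<in> K" "A s t \<noteq> 0" "A t s \<noteq> 0"
  shows "regular_growth e (A s t)"
  using diagonal_growth[OF assms(2)]
proof (elim disjE exE conjE)
  assume small: "\<forall>r. 0 \<le> r \<and> r < 1 / e \<longrightarrow> fps_summable (A t t) r"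
  show ?thesis
  proof (rule regular_growthI_summable[OF nonneg_G])
    fix r assume r: "0 \<le> r" "r < 1 / e"
    show "fps_summable (A s t) r"
    proof (cases "r = 0")
      case False
      then show ?thesis
        using G_prod_summable[of s "- {s}" t t r] small r first_passage_nonzero[OF assms(4)]
        by (simp add: insert_Diff_single Compl_eq_Diff_UNIV)
    qed (simp add: fps_summable_0)
  qed
next
  fix l c
  assume l: "e < l" "0 < c" "asymp_growth (1 + A t t) l 0 c" "fps_summable (G (- {t}) t t) (1 / l)"
    "asymp_growth (A t t) l 0 c"
  have F: "fps_summable (G (- {t}) s t) (1 / l)"
  proof (cases "s = t")
    case True then show ?thesis using l by simp
  next
    case False
    let ?B = "- {s, t}"
    have ins: "insert s ?B = - {t}" using False by auto
    \<comment> \<open>\<open>t\<close> can reach \<open>s\<close> before returning to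
      \<open>t\<close>: otherwise \<open>A t s\<close> equals itself times the first-return series,
      and one minus the latter is invertible.\<close>
    have "G ?B t s \<noteq> 0"
    proof
      assume "G ?B t s = 0"
      then have "G (- {t}) t s = 0"
        using add_state[of s ?B "dirac s" 1 t] wbound_dirac by (simp add: ins)
      then have "A t s = G (- {t}) t t * A t s"
        using first_passage[OF wbound_dirac, of s t t] by simp
      then have "(1 - G (- {t}) t t) * A t s = 0" by (simp add: algebra_simps)
      then show False using return_geom[of t] assms(4) by auto
    qed
    then show ?thesis
      using G_prod_summable[of s ?B t t "1 / l"] l e_pos by (simp add: ins)
  qed
  have "A s t = G (- {t}) s t * (1 + A t t)"
    using first_passage[OF wbound_dirac, of t s t] by (simp add: algebra_simps)
  then show ?thesis
    using regular_growth_mult_dominant[OF e_pos l(1,2,3) nonneg_fps_add[OF nonneg_fps_1 nonneg_G] nonneg_G F] by simp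
qed

lemma diagonal_regular: "s \<in> K \<Longrightarrow> regular_growth e (A s s)"
  using diagonal_growth[of s] by (auto simp: regular_growth_def)

text \<open>Induction on the number of states of \<open>K\<close> that \<open>s\<close> can reach.
  Growth within the class of \<open>s\<close> is known. A path that leaves the class meets the rest
  of \<open>K\<close> first in a state from which \<open>s\<close> cannot be reached, and there the
  induction hypothesis applies.\<close>

lemma K_regular:
  assumes "s \<in> K" "t \<in> K" shows "regular_growth e (A s t)"
  using assms
proof (induction "card {w \<in> K. w = s \<or> A s w \<noteq> 0}" arbitrary: s t rule: less_induct)
  case (less s t)
  \<comment> \<open>The class of \<open>s\<close> within \<open>K\<close>; it contains
    \<open>s\<close> even if \<open>s\<close> never returns to itself.\<close>
  define C where "C = {u \<in> K. u = s \<or> A s u \<noteq> 0 \<and> A u s \<noteq> 0}"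
  define T where "T = K - C"
  define B where "B = - K \<union> C"
  have C: "C \<subseteq> K" "finite C" "finite T" "T \<subseteq> K" and sC: "s \<in> C"
    using finite_K less.prems by (auto simp: C_def T_def)
  have BT: "B \<inter> T = {}" "B \<union> T = UNIV" "- B = T" using C by (auto simp: B_def T_def)
  have C_regular: "regular_growth e (A s u)" if "u \<in> C" for u
    using that same_class_regular[of s u] diagonal_regular less.prems by (auto simp: C_def)
  show ?case
  proof (cases "t \<in> C")
    case True then show ?thesis by (rule C_regular)
  next
    case False
    have dec: "A s y = G B s y + (\<Sum>v\<in>T. G B s v * A v y)" for y
      using taboo_fps_first_visit[OF C(3) BT(1) wbound_dirac, of y s] BT by simp
    have reach: "A s v \<noteq> 0" if "G B s v \<noteq> 0" for v
      using taboo_reach[OF that] C BT by simp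
    have noback: "A v s = 0" if "v \<in> T" "G B s v \<noteq> 0" for v
      using that reach[of v] by (auto simp: T_def C_def)
    \<comment> \<open>A path that ends in the class has not visited \<open>T\<close>, since from
      there no way leads back; so the taboo on \<open>T\<close> removes nothing.\<close>
    have GC: "G B s u = A s u" if u: "u \<in> C" for u
    proof -
      have "G B s v * A v u = 0" if v: "v \<in> T" for v
      proof (rule ccontr)
        assume "G B s v * A v u \<noteq> 0"
        then have nz: "G B s v \<noteq> 0" "A v u \<noteq> 0" by auto
        then have "A v s \<noteq> 0" using u reach_trans[OF nz(2)] by (auto simp: C_def)
        then show False using noback[OF v nz(1)] by simp
      qed
      then have "(\<Sum>v\<in>T. G B s v * A v u) = 0" by (rule sum.neutral[OF ballI])
      then show ?thesis using dec[of u] by simp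
    qed
    \<comment> \<open>Cut at the last visit to the class: a path between its states, then an
      excursion outside \<open>K\<close>.\<close>
    have GT: "regular_growth e (G B s v)" for v
    proof -
      have "G B s v = E s v + (\<Sum>u\<in>C. G B s u * E u v)"
        unfolding B_def using C by (intro taboo_fps_last_visit[OF _ _ wbound_dirac]) auto
      also have "\<dots> = E s v + (\<Sum>u\<in>C. A s u * E u v)" using GC by simp
      finally show ?thesis
        using C_regular outside_regular[OF wbound_dirac dirac_nonneg] e_pos
        by (simp add: regular_growth_add regular_growth_sum regular_growth_mult)
    qed
    have "regular_growth e (G B s v * A v t)" if v: "v \<in> T" for v
    proof (cases "G B s v = 0")
      case False
      let ?R = "\<lambda>s. {w \<in> K. w = s \<or> A s w \<noteq> 0}"
      have "?R v \<subseteq> ?R s" using reach_trans[OF reach[OF False]] reach[OF False] by blast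
      \<comment> \<open>The count includes the starting state itself, so losing \<open>s\<close>
        makes it strictly smaller even if \<open>s\<close> never returns.\<close>
      moreover have "s \<in> ?R s" "s \<notin> ?R v"
        using noback[OF v False] less.prems v sC by (auto simp: T_def)
      ultimately have "?R v \<subset> ?R s" by blast
      then have "card (?R v) < card (?R s)" using finite_K by (intro psubset_card_mono) auto
      then have "regular_growth e (A v t)" using less.hyps[of v t] v C less.prems by blast
      then show ?thesis using GT e_pos by (intro regular_growth_mult)
    qed (simp add: regular_growth_0)
    then show ?thesis
      unfolding dec[of t] using GT e_pos by (intro regular_growth_add regular_growth_sum)
  qed
qed

section \<open>Decomposition of paths through K\<close>

lemma decomp_first:
  assumes "wbound f c"
  shows "full f x = avoid f x + (\<Sum>s\<in>K. E x s * full f s)"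
  using taboo_fps_first_visit[OF finite_K _ assms, of "- K" x] by simp

text \<open>The middle sum accounts for paths that visit \<open>K\<close> exactly once, because
  \<open>A s t\<close> counts at least one step.\<close>

lemma decomp:
  assumes "wbound f c"
  shows "full f x = avoid f x + (\<Sum>s\<in>K. E x s * avoid f s)
    + (\<Sum>s\<in>K. \<Sum>t\<in>K. (E x s * avoid f t) * A s t)"
proof -
  have last: "full f s = avoid f s + (\<Sum>t\<in>K. A s t * avoid f t)" for s
    using taboo_fps_last_visit[OF finite_K _ assms, of "- K" s] by simp
  show ?thesis
    unfolding decomp_first[OF assms, of x]
    by (subst last) (simp add: distrib_left sum.distrib sum_distrib_left mult_ac)
qed

lemma taboo_fps_regular:
  assumes "wbound f c" "\<And>y. 0 \<le> f y"
  shows "regular_growth e (full f x)"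
  unfolding decomp[OF assms(1)]
  using outside_regular[OF assms] outside_regular[OF wbound_dirac dirac_nonneg] K_regular e_pos
  by (intro regular_growth_add regular_growth_sum regular_growth_mult) auto

end

section \<open>Uniform convergence\<close>

context weighted_kernel
begin

lemma taboo_mono:
  assumes "wbound f c" "wbound g d" "\<And>y. f y \<le> g y"
  shows "taboo P B f n x \<le> taboo P B g n x"
proof (induction n arbitrary: x)
  case 0 show ?case using kop_mono[OF assms] by simp
next
  case (Suc n)
  show ?case unfolding taboo.simps
    by (rule kop_mono[OF wbound_restrict[OF wbound_taboo[OF assms(1)]] wbound_restrict[OF wbound_taboo[OF assms(2)]]])
       (simp add: Suc)
qed

text \<open>Duality: closeness to \<open>\<Lambda>\<close> uniformly over test functions bounded by
  \<open>V\<close> is closeness in weighted total variation, as seen by testing with the sign of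
  \<open>p n - L\<close> times \<open>V\<close>. That \<open>\<Lambda>\<close> is integration
  against \<open>L\<close> then follows by uniqueness of limits.\<close>

lemma weighted_l1_limit:
  fixes p :: "nat \<Rightarrow> 'a \<Rightarrow> real"
  assumes summable: "\<forall>n f c. wbound f c \<longrightarrow> (\<lambda>y. p n y * f y) summable_on UNIV"
    and close: "\<forall>f c n. wbound f c \<and> n \<ge> 1 \<longrightarrow> \<bar>(\<Sum>\<^sub>\<infinity>y. p n y * f y) - \<Lambda> f\<bar> \<le> a n * c"
    and a: "a \<longlonglongrightarrow> 0"
  defines "L \<equiv> (\<lambda>y. \<Lambda> (dirac y))"
  shows "wbound f c \<Longrightarrow> (\<lambda>y. L y * f y) summable_on UNIV"
    and "wbound f c \<Longrightarrow> \<Lambda> f = (\<Sum>\<^sub>\<infinity>y. L y * f y)"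
    and "n \<ge> 1 \<Longrightarrow> (\<lambda>y. \<bar>p n y - L y\<bar> * V y) summable_on UNIV"
    and "n \<ge> 1 \<Longrightarrow> (\<Sum>\<^sub>\<infinity>y. \<bar>p n y - L y\<bar> * V y) \<le> a n"
    and "(\<lambda>n. p n y) \<longlonglongrightarrow> L y"
proof -
  let ?p = "\<lambda>n f. \<Sum>\<^sub>\<infinity>y. p n y * f y"
  note summ = summable[rule_format] and conv = close[rule_format, OF conjI]
  have lim: "(\<lambda>n. ?p n f) \<longlonglongrightarrow> \<Lambda> f" if f: "wbound f c" for f c
  proof (rule LIM_zero_cancel, rule Lim_null_comparison)
    show "(\<lambda>n. a n * c) \<longlonglongrightarrow> 0" using a by (rule tendsto_mult_left_zero)
    show "eventually (\<lambda>n. norm (?p n f - \<Lambda> f) \<le> a n * c) sequentially"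
      using conv[OF f] by (auto simp: eventually_sequentially)
  qed
  have p_dirac: "(\<Sum>\<^sub>\<infinity>z. p n z * dirac y z) = p n y" for n y
  proof -
    have "(\<Sum>\<^sub>\<infinity>z. p n z * dirac y z) = (\<Sum>\<^sub>\<infinity>z\<in>{y}. p n z * dirac y z)"
      by (rule infsum_cong_neutral) (auto simp: dirac_def)
    then show ?thesis by (simp add: dirac_def)
  qed
  have pL: "(\<lambda>n. p n y) \<longlonglongrightarrow> L y" for y
    using lim[OF wbound_dirac, of y] by (simp add: p_dirac L_def)
  then show "(\<lambda>n. p n y) \<longlonglongrightarrow> L y" .
  have fin: "(\<Sum>y\<in>F. \<bar>p n y - L y\<bar> * V y) \<le> a n" if F: "finite F" and n: "n \<ge> 1" for F n
  proof -
    \<comment> \<open>The extremal test function, cut to a finite set on which pointwise convergence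
      suffices to compute \<open>\<Lambda> h\<close>.\<close>
    define h where "h z = (if z \<in> F then sgn (p n z - L z) * V z else 0)" for z
    have h: "wbound h 1"
      unfolding wbound_def h_def using V_pos by (auto simp: abs_mult abs_sgn_eq abs_of_pos less_imp_le)
    have eq: "(\<Sum>\<^sub>\<infinity>y. p m y * h y) = (\<Sum>y\<in>F. p m y * h y)" for m
    proof -
      have "(\<Sum>\<^sub>\<infinity>y. p m y * h y) = (\<Sum>\<^sub>\<infinity>y\<in>F. p m y * h y)"
        by (rule infsum_cong_neutral) (auto simp: h_def)
      then show ?thesis using F by simp
    qed
    have "(\<lambda>m. \<Sum>y\<in>F. p m y * h y) \<longlonglongrightarrow> (\<Sum>y\<in>F. L y * h y)"
      by (intro tendsto_intros pL)
    then have "\<Lambda> h = (\<Sum>y\<in>F. L y * h y)"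
      using lim[OF h] unfolding eq by (rule LIMSEQ_unique[rotated])
    then have "\<bar>(\<Sum>y\<in>F. p n y * h y) - (\<Sum>y\<in>F. L y * h y)\<bar> \<le> a n * 1"
      using conv[OF h n] by (simp only: eq)
    moreover have "(\<Sum>y\<in>F. p n y * h y) - (\<Sum>y\<in>F. L y * h y) = (\<Sum>y\<in>F. \<bar>p n y - L y\<bar> * V y)"
      unfolding sum_subtractf [symmetric]
    proof (rule sum.cong[OF refl])
      fix y assume "y \<in> F"
      then show "p n y * h y - L y * h y = \<bar>p n y - L y\<bar> * V y"
        by (simp add: h_def left_diff_distrib [symmetric] abs_sgn[of "p n y - L y"])
    qed
    ultimately show ?thesis by linarith
  qed
  let ?d = "\<lambda>n y. \<bar>p n y - L y\<bar> * V y"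
  have nn: "0 \<le> ?d n y" for n y using V_pos[of y] by simp
  show s1: "(\<lambda>y. ?d n y) summable_on UNIV" if n: "n \<ge> 1" for n
  proof (rule nonneg_bdd_above_summable_on)
    show "bdd_above (sum (\<lambda>y. ?d n y) ` {F. F \<subseteq> UNIV \<and> finite F})"
      using fin[OF _ n] by (intro bdd_aboveI2[of _ _ "a n"]) auto
  qed (use nn in auto)
  show s2: "(\<Sum>\<^sub>\<infinity>y. ?d n y) \<le> a n" if n: "n \<ge> 1" for n
    using fin[OF _ n] by (intro infsum_le_finite_sums s1[OF n]) auto
  \<comment> \<open>\<open>L\<close> is dominated by \<open>p 1\<close> plus the difference at
    \<open>n = 1\<close>, the first index for which the estimate is available.\<close>
  have "(\<lambda>y. ?d 1 y + norm (p 1 y * V y)) summable_on UNIV"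
    using s1[of 1] summable_on_iff_abs_summable_on_real[THEN iffD1, OF summ[OF wbound_V, of 1]]
    by (intro summable_on_add) auto
  then have LV: "(\<lambda>y. norm (L y * V y)) summable_on UNIV"
  proof (rule Infinite_Sum.abs_summable_on_comparison_test')
    fix y
    have "\<bar>L y\<bar> \<le> \<bar>p 1 y - L y\<bar> + \<bar>p 1 y\<bar>" by linarith
    then have "\<bar>L y\<bar> * V y \<le> (\<bar>p 1 y - L y\<bar> + \<bar>p 1 y\<bar>) * V y"
      using V_pos[of y] by (intro mult_right_mono) auto
    then show "norm (L y * V y) \<le> ?d 1 y + norm (p 1 y * V y)"
      using V_pos[of y] by (simp add: abs_mult distrib_right)
  qed
  then have "(\<lambda>y. \<bar>L y\<bar> * V y) summable_on UNIV"
    using V_pos by (simp add: abs_mult abs_of_pos)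
  note abs_L = weighted_abs_summable[OF abs_ge_zero this]
  show L_summ: "(\<lambda>y. L y * f y) summable_on UNIV" if "wbound f c" for f c
    by (rule abs_summable_summable) (use abs_L[OF that] in \<open>simp add: abs_mult\<close>)
  show "\<Lambda> f = (\<Sum>\<^sub>\<infinity>y. L y * f y)" if f: "wbound f c" for f c
  proof -
    have "(\<lambda>n. ?p n f) \<longlonglongrightarrow> (\<Sum>\<^sub>\<infinity>y. L y * f y)"
    proof (rule LIM_zero_cancel, rule Lim_null_comparison)
      show "(\<lambda>n. a n * c) \<longlonglongrightarrow> 0" using a by (rule tendsto_mult_left_zero)
      have "norm (?p n f - (\<Sum>\<^sub>\<infinity>y. L y * f y)) \<le> a n * c" if n: "n \<ge> 1" for n
      proof -
        have "?p n f - (\<Sum>\<^sub>\<infinity>y. L y * f y) = (\<Sum>\<^sub>\<infinity>y. p n y * f y + - (L y * f y))"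
          using infsum_add[OF summ[OF f, of n] summable_on_uminus[THEN iffD2, OF L_summ[OF f]]]
          by (simp add: infsum_uminus)
        also have "norm \<dots> \<le> (\<Sum>\<^sub>\<infinity>y. \<bar>p n y - L y\<bar> * \<bar>f y\<bar>)"
        proof -
          have eq: "norm (p n y * f y + - (L y * f y)) = \<bar>p n y - L y\<bar> * \<bar>f y\<bar>" for y
            by (simp add: abs_mult [symmetric] left_diff_distrib)
          have "(\<lambda>y. norm (\<bar>p n y - L y\<bar> * f y)) summable_on UNIV"
            by (rule weighted_abs_summable[OF abs_ge_zero s1[OF n] f])
          then have "(\<lambda>y. norm (p n y * f y + - (L y * f y))) summable_on UNIV"
            unfolding eq by (simp add: abs_mult)
          from norm_infsum_bound[OF this] show ?thesis by (simp only: eq)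
        qed
        also have "\<dots> \<le> c * (\<Sum>\<^sub>\<infinity>y. ?d n y)"
          using weighted_infsum_le[OF abs_ge_zero s1[OF n], of "\<lambda>y. \<bar>f y\<bar>" c] f
          by (simp add: wbound_def)
        also have "\<dots> \<le> c * a n" using wbound_nonneg[OF f] by (intro mult_left_mono s2[OF n])
        finally show ?thesis by (simp add: mult.commute)
      qed
      then show "eventually (\<lambda>n. norm (?p n f - (\<Sum>\<^sub>\<infinity>y. L y * f y)) \<le> a n * c) sequentially"
        by (auto simp: eventually_sequentially)
    qed
    then show ?thesis using lim[OF f] LIMSEQ_unique by blast
  qed
qed

end

context compact_kernel
begin

definition mass :: "'a \<Rightarrow> real fps" where
  "mass = full (\<lambda>_. 1)"

lemma outside_product_bound:
  assumes "wbound f c"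
  shows "\<bar>fps_nth (E x s * avoid f t) k\<bar> \<le> (c * C1\<^sup>2 * V x * V t) * ((real k + 1) * e ^ k)"
proof -
  have "\<bar>fps_nth (E x s * avoid f t) k\<bar> \<le>
      (\<Sum>i=0..k. \<bar>fps_nth (E x s) i\<bar> * \<bar>fps_nth (avoid f t) (k - i)\<bar>)"
    unfolding fps_mult_nth by (rule order_trans[OF sum_abs]) (simp add: abs_mult)
  also have "\<dots> \<le> (\<Sum>i=0..k. (1 * C1 * V x * e ^ i) * (c * C1 * V t * e ^ (k - i)))"
    by (intro sum_mono mult_mono outside_fps_bound wbound_dirac assms)
       (use C1_nonneg V_pos[of x] e_pos in auto)
  also have "\<dots> = (\<Sum>i=0..k. c * C1\<^sup>2 * V x * V t * e ^ k)"
  proof (rule sum.cong[OF refl])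
    fix i assume "i \<in> {0..k}"
    then have "e ^ k = e ^ i * e ^ (k - i)" by (simp add: power_add [symmetric])
    then show "(1 * C1 * V x * e ^ i) * (c * C1 * V t * e ^ (k - i)) = c * C1\<^sup>2 * V x * V t * e ^ k"
      by (simp add: power2_eq_square mult_ac)
  qed
  also have "\<dots> = (c * C1\<^sup>2 * V x * V t) * ((real k + 1) * e ^ k)"
    by (simp add: algebra_simps)
  finally show ?thesis .
qed

lemma mass_visit:
  assumes "s \<in> K" shows "fps_nth (E x s) k * fps_nth (mass s) n \<le> fps_nth (mass x) (k + n)"
proof -
  have nm: "nonneg_fps (mass y)" for y unfolding mass_def by (rule nonneg_taboo_fps) simp
  have "fps_nth (E x s) k * fps_nth (mass s) n \<le> fps_nth (E x s * mass s) (k + n)"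
    by (intro fps_mult_nth_ge nonneg_G nm)
  also have "\<dots> \<le> (\<Sum>s\<in>K. fps_nth (E x s * mass s) (k + n))"
    using assms finite_K by (intro member_le_sum nonneg_fpsD nonneg_fps_mult nonneg_G nm)
  also have "\<dots> \<le> fps_nth (mass x) (k + n)"
    using decomp_first[OF wbound_one, of x] nonneg_fpsD[OF nonneg_taboo_fps[of "\<lambda>_. 1" "- K" x], of "k + n"]
    by (simp add: mass_def fps_sum_nth)
  finally show ?thesis .
qed

text \<open>An upper bound, unlike an exact rate, is inherited by every state of \<open>K\<close>
  that \<open>x\<close> can reach.\<close>

definition mass_bounded :: "real \<Rightarrow> 'a \<Rightarrow> nat \<Rightarrow> bool" where
  "mass_bounded l x j \<longleftrightarrow> (\<exists>M. \<forall>n\<ge>1. fps_nth (mass x) n \<le> M * growth l j n)"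

lemma mass_bounded_visit:
  assumes "mass_bounded l x j" "s \<in> K" "E x s \<noteq> 0" "0 < l"
  shows "mass_bounded l s j"
proof -
  obtain M where M: "\<And>n. n \<ge> 1 \<Longrightarrow> fps_nth (mass x) n \<le> M * growth l j n"
    using assms(1) by (auto simp: mass_bounded_def)
  obtain k where k: "fps_nth (E x s) k > 0" using nonneg_fps_nonzeroD[OF nonneg_G assms(3)] .
  have "fps_nth (mass s) n \<le> (\<bar>M\<bar> * l ^ k * (real k + 1) ^ j / fps_nth (E x s) k) * growth l j n"
    if n: "n \<ge> 1" for n
  proof -
    have "fps_nth (E x s) k * fps_nth (mass s) n \<le> M * (l ^ (k + n) * real (k + n) ^ j)"
      using order_trans[OF mass_visit[OF assms(2)] M[of "k + n"]] n by simp
    also have "\<dots> \<le> \<bar>M\<bar> * (l ^ (k + n) * real (k + n) ^ j)"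
      using assms by (intro mult_right_mono) auto
    \<comment> \<open>The inequality k + n \<le> (k + 1) n for \<open>n \<ge> 1\<close> turns the
      delay by \<open>k\<close> steps into a constant factor.\<close>
    also have "\<dots> \<le> \<bar>M\<bar> * (l ^ (k + n) * ((real k + 1) * real n) ^ j)"
    proof -
      have "k * 1 \<le> k * n" using n by (intro mult_le_mono) auto
      then have "real (k + n) \<le> (real k + 1) * real n"
        by (simp add: distrib_right flip: of_nat_mult)
      then show ?thesis using assms by (intro mult_left_mono power_mono) auto
    qed
    finally have "fps_nth (mass s) n * fps_nth (E x s) k \<le> \<bar>M\<bar> * l ^ k * (real k + 1) ^ j * growth l j n"
      by (simp add: power_add power_mult_distrib mult_ac)
    then show ?thesis using k by (simp add: pos_le_divide_eq)
  qed
  then show ?thesis unfolding mass_bounded_def by blast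
qed

lemma mass_bounded_growth:
  assumes "mass_bounded l s j" "e < l" "s \<in> K" "t \<in> K"
  shows "\<exists>c. asymp_growth (A s t) l j c"
proof -
  obtain M where M: "\<And>n. n \<ge> 1 \<Longrightarrow> fps_nth (mass s) n \<le> M * growth l j n"
    using assms(1) by (auto simp: mass_bounded_def)
  have "fps_nth (A s t) n \<le> fps_nth (mass s) n" for n
    using taboo_mono[OF wbound_dirac[of t] wbound_one, of UNIV "n - 1" s]
    by (simp add: mass_def taboo_fps_nth dirac_def)
  then show ?thesis
    using regular_growth_bounded[OF K_regular[OF assms(3,4)] e_pos assms(2)] M order_trans by meson
qed

text \<open>In \<open>decomp\<close> only the excursions depend on \<open>x\<close> and
  \<open>f\<close>, and their products are bounded by \<open>c * V x\<close> times one fixed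
  sequence. The finitely many series \<open>A s t\<close> have exact asymptotics, so
  \<open>convolution_uniform_limit\<close> yields errors of the required form.\<close>

theorem uniform_convergence:
  assumes l: "e < l" and H: "\<And>x. x \<in> X \<Longrightarrow> mass_bounded l x (jx x)"
  shows "\<exists>\<Lambda> \<alpha>. \<alpha> \<longlonglongrightarrow> 0 \<and> (\<forall>x\<in>X. \<forall>f c n. wbound f c \<and> n \<ge> 1 \<longrightarrow>
     \<bar>fps_nth (full f x) n / growth l (jx x) n - \<Lambda> x f\<bar> \<le> \<alpha> n * V x * c)"
proof -
  have l0: "0 < l" using l e_pos by simp
  define S where "S = {s \<in> K. \<exists>x\<in>X. E x s \<noteq> 0}"
  have S: "finite S" "S \<subseteq> K" using finite_K by (auto simp: S_def)
  \<comment> \<open>The least order that bounds the mass from \<open>s\<close>; it is at most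
    \<open>jx x\<close> whenever \<open>x\<close> leads to \<open>s\<close>. Only states with
    \<open>js s = jx x\<close> contribute to the limit at \<open>x\<close>.\<close>
  define js where "js s = (LEAST j. mass_bounded l s j)" for s
  have js: "mass_bounded l s (js s)" if s: "s \<in> S" for s
  proof -
    obtain x where "x \<in> X" "E x s \<noteq> 0" "s \<in> K" using s by (auto simp: S_def)
    then have "mass_bounded l s (jx x)" using mass_bounded_visit[OF H] l0 by blast
    then show ?thesis unfolding js_def by (rule LeastI)
  qed
  have js_le: "js s \<le> jx x" if "x \<in> X" "E x s \<noteq> 0" "s \<in> K" for x s
    unfolding js_def using mass_bounded_visit[OF H] l0 that by (intro Least_le) blast
  have "\<forall>p\<in>S \<times> K. \<exists>c. asymp_growth (A (fst p) (snd p)) l (js (fst p)) c"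
    using mass_bounded_growth[OF js l] S by auto
  then obtain c where c: "\<And>p. p \<in> S \<times> K \<Longrightarrow> asymp_growth (A (fst p) (snd p)) l (js (fst p)) (c p)"
    using bchoice[of "S \<times> K"] by metis
  \<comment> \<open>The convolution of two geometric sequences of rate \<open>e\<close>: a common
    majorant for all pairs of excursions, summable after division by \<open>l ^ k\<close>.\<close>
  define m where "m k = (real k + 1) * e ^ k" for k :: nat
  have m0: "0 \<le> m k" for k using e_pos by (simp add: m_def)
  have q: "0 \<le> e / l" "e / l < 1" using l e_pos by auto
  have m_eq: "m k / l ^ k = real k ^ 1 * (e / l) ^ k + real k ^ 0 * (e / l) ^ k" for k
    by (simp add: m_def power_divide distrib_right add_divide_distrib)
  have m_summ: "summable (\<lambda>k. m k / l ^ k)"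
    unfolding m_eq by (intro summable_add summable_poly_geometric q)
  define Q where "Q p \<gamma> \<longleftrightarrow> \<gamma> \<longlonglongrightarrow> 0 \<and>
    (\<forall>w C j' n. js (fst p) \<le> j' \<and> (\<forall>k. \<bar>w k\<bar> \<le> C * m k) \<and> n \<ge> 1 \<longrightarrow>
       \<bar>(\<Sum>k\<le>n. w k * fps_nth (A (fst p) (snd p)) (n - k)) / growth l j' n
          - (if j' = js (fst p) then c p * (\<Sum>k. w k / l ^ k) else 0)\<bar> \<le> C * \<gamma> n)" for p \<gamma>
  have "\<exists>\<gamma>. Q p \<gamma>" if "p \<in> S \<times> K" for p
    unfolding Q_def
    by (rule convolution_uniform_limit[OF l0 c[OF that, unfolded asymp_growth_def] m0 m_summ])
  then obtain \<gamma> where \<gamma>: "\<And>p. p \<in> S \<times> K \<Longrightarrow> Q p (\<gamma> p)" using bchoice[of "S \<times> K" Q] by blast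
  \<comment> \<open>Testing with the zero weight shows that the error bounds are nonnegative, which
    settles the pairs with \<open>E x s = 0\<close>.\<close>
  have \<gamma>_nn: "0 \<le> \<gamma> p n" if "p \<in> S \<times> K" "n \<ge> 1" for p n
    using conjunct2[OF \<gamma>[OF that(1), unfolded Q_def], rule_format, of "js (fst p)" "\<lambda>_. 0" 1 n] m0 that(2)
    by simp
  define w where "w x f s t k = fps_nth (E x s * avoid f t) k" for x f s t k
  define \<Lambda> where "\<Lambda> x f = (\<Sum>s\<in>S. \<Sum>t\<in>K. if jx x = js s then c (s, t) * (\<Sum>k. w x f s t k / l ^ k) else 0)" for x f
  \<comment> \<open>One summand each for paths avoiding \<open>K\<close>, paths with a single visit
    to \<open>K\<close>, and the convolutions with \<open>A s t\<close>.\<close>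
  define \<alpha> where "\<alpha> n = C1 * (e / l) ^ n + (\<Sum>s\<in>K. C1\<^sup>2 * V s * (m n / l ^ n))
    + (\<Sum>s\<in>S. \<Sum>t\<in>K. C1\<^sup>2 * V t * \<gamma> (s, t) n)" for n
  have "\<alpha> \<longlonglongrightarrow> C1 * 0 + (\<Sum>s\<in>K. C1\<^sup>2 * V s * 0) + (\<Sum>s\<in>S. \<Sum>t\<in>K. C1\<^sup>2 * V t * 0)"
    unfolding \<alpha>_def
  proof (intro tendsto_add tendsto_sum tendsto_mult tendsto_const)
    show "(\<lambda>n. (e / l) ^ n) \<longlonglongrightarrow> 0" using q by (intro LIMSEQ_power_zero) auto
    show "(\<lambda>n. m n / l ^ n) \<longlonglongrightarrow> 0" using m_summ by (rule summable_LIMSEQ_zero)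
    show "\<gamma> (s, t) \<longlonglongrightarrow> 0" if "s \<in> S" "t \<in> K" for s t using \<gamma>[of "(s, t)"] that by (simp add: Q_def)
  qed
  then have \<alpha>0: "\<alpha> \<longlonglongrightarrow> 0" by simp
  let ?a2 = "\<lambda>n. \<Sum>s\<in>K. C1\<^sup>2 * V s * (m n / l ^ n)" and ?a3 = "\<lambda>n. \<Sum>s\<in>S. \<Sum>t\<in>K. C1\<^sup>2 * V t * \<gamma> (s, t) n"
  have bound: "\<bar>fps_nth (full f x) n / growth l (jx x) n - \<Lambda> x f\<bar> \<le> \<alpha> n * V x * b"
    if x: "x \<in> X" and f: "wbound f b" and n: "n \<ge> 1" for x f b n
  proof -
    let ?d = "growth l (jx x) n"
    have d: "?d \<ge> l ^ n" "?d > 0" using l0 n by auto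
    have div_le: "\<bar>y / ?d\<bar> \<le> z / l ^ n" if "\<bar>y\<bar> \<le> z" for y z
      using frac_le[of z "\<bar>y\<bar>" "l ^ n" ?d] that d l0 by (simp add: abs_mult)
    have b0: "0 \<le> b" using wbound_nonneg[OF f] .
    let ?T1 = "fps_nth (avoid f x) n / ?d"
    let ?T2 = "(\<Sum>s\<in>K. w x f s s n / ?d)"
    let ?R = "\<lambda>s t. if jx x = js s then c (s, t) * (\<Sum>k. w x f s t k / l ^ k) else 0"
    let ?T3 = "\<lambda>s t. (\<Sum>k\<le>n. w x f s t k * fps_nth (A s t) (n - k)) / ?d"
    have w_bound: "\<bar>w x f s t k\<bar> \<le> (b * C1\<^sup>2 * V x * V t) * m k" for s t k
      unfolding w_def m_def by (rule outside_product_bound[OF f])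
    have w_zero: "w x f s t k = 0" if "E x s = 0" for s t k
      using that by (simp add: w_def)
    have "fps_nth (full f x) n / ?d = ?T1 + ?T2 + (\<Sum>s\<in>K. \<Sum>t\<in>K. ?T3 s t)"
    proof -
      have "fps_nth (E x s * avoid f t * A s t) n = (\<Sum>k\<le>n. w x f s t k * fps_nth (A s t) (n - k))" for s t
        by (simp add: w_def fps_mult_nth[of "E x s * avoid f t"] atMost_atLeast0)
      then show ?thesis
        by (subst decomp[OF f]) (simp add: fps_sum_nth add_divide_distrib sum_divide_distrib w_def)
    qed
    also have "(\<Sum>s\<in>K. \<Sum>t\<in>K. ?T3 s t) = (\<Sum>s\<in>S. \<Sum>t\<in>K. ?T3 s t)"
      using S finite_K x by (intro sum.mono_neutral_right) (auto simp: S_def w_zero)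
    finally have eq: "fps_nth (full f x) n / ?d - \<Lambda> x f = ?T1 + ?T2 +
        (\<Sum>s\<in>S. \<Sum>t\<in>K. ?T3 s t - ?R s t)"
      by (simp add: \<Lambda>_def sum_subtractf)
    have "\<bar>?T1\<bar> \<le> (b * C1 * V x * e ^ n) / l ^ n"
      by (intro div_le outside_fps_bound f)
    then have 1: "\<bar>?T1\<bar> \<le> C1 * (e / l) ^ n * V x * b" by (simp add: power_divide mult_ac)
    have "\<bar>?T2\<bar> \<le> (\<Sum>s\<in>K. (b * C1\<^sup>2 * V x * V s * m n) / l ^ n)"
      by (rule order_trans[OF sum_abs], rule sum_mono, rule div_le, rule w_bound)
    also have "\<dots> = ?a2 n * V x * b"
      unfolding sum_distrib_right by (intro sum.cong refl) (simp add: mult_ac)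
    finally have 2: "\<bar>?T2\<bar> \<le> ?a2 n * V x * b" .
    have "\<bar>?T3 s t - ?R s t\<bar>
        \<le> (b * C1\<^sup>2 * V x * V t) * \<gamma> (s, t) n" if s: "s \<in> S" and t: "t \<in> K" for s t
    proof (cases "E x s = 0")
      case True
      then show ?thesis using b0 V_pos[of x] V_pos[of t] \<gamma>_nn[of "(s, t)" n] s t n
        by (auto simp: w_zero intro!: mult_nonneg_nonneg less_imp_le)
    next
      case False
      then have "js s \<le> jx x" using js_le[OF x] s S by auto
      then show ?thesis using \<gamma>[of "(s, t)"] s t n w_bound unfolding Q_def by auto
    qed
    then have "\<bar>\<Sum>s\<in>S. \<Sum>t\<in>K. ?T3 s t - ?R s t\<bar>
        \<le> (\<Sum>s\<in>S. \<Sum>t\<in>K. (b * C1\<^sup>2 * V x * V t) * \<gamma> (s, t) n)"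
      by (intro order_trans[OF sum_abs] sum_mono) blast
    also have "\<dots> = ?a3 n * V x * b"
      unfolding sum_distrib_right by (intro sum.cong refl) (simp add: mult_ac)
    finally have 3: "\<bar>\<Sum>s\<in>S. \<Sum>t\<in>K. ?T3 s t - ?R s t\<bar>
        \<le> ?a3 n * V x * b" .
    have "\<alpha> n * V x * b = C1 * (e / l) ^ n * V x * b + ?a2 n * V x * b
        + ?a3 n * V x * b"
      by (simp only: \<alpha>_def distrib_right)
    then show ?thesis unfolding eq using 1 2 3 by linarith
  qed
  show ?thesis using \<alpha>0 bound by blast
qed

end

section \<open>Growth rates and the limit measures\<close>

lemma divide_power_mult:
  fixes a t m :: real shows "a / (t ^ n * m) = inverse t ^ n * inverse m * a"
  by (simp only: divide_inverse inverse_mult_distrib power_inverse mult_ac)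

text \<open>\<open>x0_growth\<close> is the form in which the recurrence of \<open>x0\<close> is
  used; \<open>e < l0\<close> places \<open>theta0 P\<close> in the resolved range.\<close>

locale absorbed_kernel = compact_kernel P V C0 e K
  for P :: "'a \<Rightarrow> 'a \<Rightarrow> real" and V C0 e K +
  fixes x0 :: 'a and l0 :: real and j0 :: nat and c0 :: real
  assumes sub_markov: "\<And>x. kop P (\<lambda>_. 1) x \<le> 1"
    and x0_growth: "e < l0" "0 < c0" "asymp_growth (mass x0) l0 j0 c0"
begin

abbreviation surv :: "nat \<Rightarrow> 'a \<Rightarrow> real" where
  "surv n x \<equiv> semigrp P n (\<lambda>_. 1) x"

section \<open>Identification of the growth rate\<close>

definition theta_set :: "'a \<Rightarrow> real set" where
  "theta_set x = {\<theta>. \<theta> > 0 \<and> liminf (\<lambda>n. ereal (inverse \<theta> ^ n * surv n x)) = 0}"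

lemma theta0_eq: "theta0 P = Sup (range (\<lambda>x. Inf (theta_set x)))"
  by (simp add: theta0_def theta_set_def)

lemma surv_mass: "n \<ge> 1 \<Longrightarrow> surv n x = fps_nth (mass x) n"
  unfolding mass_def by (rule semigrp_taboo_fps[OF wbound_one])

lemma surv_nonneg: "0 \<le> surv n x"
  unfolding semigrp_def using kpow_nonneg by (intro infsum_nonneg) simp

lemma surv_le_1: "surv n x \<le> 1"
proof (induction n arbitrary: x)
  case 0 show ?case by (simp add: semigrp_0)
next
  case (Suc n)
  have "surv (Suc n) x = kop P (surv n) x" by (rule semigrp_Suc[OF wbound_one])
  also have "\<dots> \<le> kop P (\<lambda>_. 1) x" by (rule kop_mono[OF wbound_semigrp[OF wbound_one] wbound_one Suc])
  finally show ?case using sub_markov[of x] by simp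
qed

lemma nonneg_mass: "nonneg_fps (mass x)"
  unfolding mass_def by (rule nonneg_taboo_fps) simp

lemma mass_regular: "regular_growth e (mass x)"
  unfolding mass_def by (rule taboo_fps_regular[OF wbound_one]) simp

lemma asymp_growth_surv:
  assumes "asymp_growth (mass x) l j c"
  shows "(\<lambda>n. surv n x / growth l j n) \<longlonglongrightarrow> c"
proof -
  have "eventually (\<lambda>n. fps_nth (mass x) n / growth l j n = surv n x / growth l j n) sequentially"
    using eventually_ge_at_top[of 1] by eventually_elim (simp add: surv_mass)
  then show ?thesis using assms unfolding asymp_growth_def by (rule Lim_transform_eventually[rotated])
qed

lemma liminf_zero: "f \<longlonglongrightarrow> 0 \<Longrightarrow> liminf (\<lambda>n. ereal (f n)) = 0"
  by (intro lim_imp_Liminf) (auto simp: zero_ereal_def)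

lemma liminf_not_zero:
  assumes "eventually (\<lambda>n. f n \<ge> d) sequentially" "d > 0"
  shows "liminf (\<lambda>n. ereal (f n)) \<noteq> 0"
proof -
  have "ereal d \<le> liminf (\<lambda>n. ereal (f n))"
    using assms(1) by (intro Liminf_bounded) (auto elim: eventually_mono)
  then show ?thesis using assms(2) by (auto simp: zero_ereal_def)
qed

text \<open>One expression for both definitions: \<open>r = 0\<close> belongs to
  \<open>theta0\<close>, and \<open>\<theta> = theta0 P\<close> to \<open>jS\<close>.\<close>

definition scaled_surv :: "real \<Rightarrow> real \<Rightarrow> 'a \<Rightarrow> nat \<Rightarrow> real" where
  "scaled_surv r \<theta> x n = real n powr (- r) * inverse \<theta> ^ n * surv n x"

lemma theta_set_iff: "\<theta> \<in> theta_set x \<longleftrightarrow> \<theta> > 0 \<and> liminf (\<lambda>n. ereal (scaled_surv 0 \<theta> x n)) = 0"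
proof -
  \<comment> \<open>Since 0 powr 0 is 0, the two sequences differ at \<open>n = 0\<close>; the lower
    limit does not see this.\<close>
  have "eventually (\<lambda>n. ereal (inverse \<theta> ^ n * surv n x) = ereal (scaled_surv 0 \<theta> x n)) sequentially"
    using eventually_ge_at_top[of 1] by eventually_elim (simp add: scaled_surv_def)
  from Liminf_eq[OF this] show ?thesis by (simp add: theta_set_def)
qed

lemma scaled_surv_null:
  assumes "asymp_growth (mass x) \<theta> 0 0" shows "liminf (\<lambda>n. ereal (scaled_surv 0 \<theta> x n)) = 0"
proof (rule liminf_zero, rule Lim_transform_eventually[OF asymp_growth_surv[OF assms]])
  show "eventually (\<lambda>n. surv n x / growth \<theta> 0 n = scaled_surv 0 \<theta> x n) sequentially"
    using eventually_ge_at_top[of 1]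
    by eventually_elim (subst divide_power_mult, simp add: scaled_surv_def)
qed

lemma scaled_surv_eq:
  assumes "n \<ge> 1" "0 < l"
  shows "scaled_surv r \<theta> x n = surv n x / growth l j n * ((l / \<theta>) ^ n * real n powr (real j - r))"
proof -
  have ratio: "(l / \<theta>) ^ n = inverse \<theta> ^ n * l ^ n"
    by (simp only: divide_inverse power_mult_distrib mult.commute)
  have pow: "real n powr (real j - r) = real n ^ j * real n powr (- r)"
    using assms(1) by (simp add: powr_realpow [symmetric] powr_add [symmetric])
  have "inverse l ^ n * l ^ n = 1" using assms(2) by (simp add: power_mult_distrib [symmetric])
  moreover have "inverse (real n ^ j) * real n ^ j = 1" using assms(1) by simp
  moreover have "q * i * a = il * v * a * (i * t * (m * q))" if "il * t = 1" "v * m = 1" for q i a il v t m :: real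
  proof -
    have "il * v * a * (i * t * (m * q)) = (il * t) * (v * m) * (q * i * a)" by (simp only: mult_ac)
    then show ?thesis by (simp only: that mult_1)
  qed
  ultimately show ?thesis unfolding scaled_surv_def divide_power_mult ratio pow by blast
qed

lemma scaled_surv_lower:
  assumes "asymp_growth (mass x) l j c" "0 < c" "0 < \<theta>" "\<theta> \<le> l" "r \<le> real j"
  shows "liminf (\<lambda>n. ereal (scaled_surv r \<theta> x n)) \<noteq> 0"
proof (rule liminf_not_zero)
  have "eventually (\<lambda>n. c / 2 < surv n x / growth l j n) sequentially"
    using asymp_growth_surv[OF assms(1)] by (rule order_tendstoD) (use assms in simp)
  then show "eventually (\<lambda>n. scaled_surv r \<theta> x n \<ge> c / 2) sequentially"
    using eventually_ge_at_top[of 1]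
  proof eventually_elim
    case (elim n)
    have "1 \<le> (l / \<theta>) ^ n" using assms by (intro one_le_power) simp
    moreover have "1 \<le> real n powr (real j - r)" using assms elim by (intro ge_one_powr_ge_zero) auto
    ultimately have "1 \<le> (l / \<theta>) ^ n * real n powr (real j - r)"
      using mult_mono[of 1 "(l / \<theta>) ^ n" 1 "real n powr (real j - r)"] by simp
    moreover have "c / 2 \<le> surv n x / growth l j n" "0 \<le> surv n x / growth l j n"
      using elim(1) assms(2) by linarith+
    ultimately have "c / 2 * 1 \<le> surv n x / growth l j n * ((l / \<theta>) ^ n * real n powr (real j - r))"
      by (intro mult_mono) simp_all
    then show ?case using scaled_surv_eq[OF elim(2), of l r \<theta> x j] assms by simp
  qed
qed (use assms in simp)

text \<open>Survival probabilities are at most 1. This makes every \<open>theta_set\<close> nonempty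
  and bounds the supremum that defines \<open>theta0\<close>.\<close>

lemma theta_set_gt_1: "1 < \<theta> \<Longrightarrow> \<theta> \<in> theta_set x"
proof -
  assume \<theta>: "1 < \<theta>"
  have "(\<lambda>n. inverse \<theta> ^ n * surv n x) \<longlonglongrightarrow> 0"
  proof (rule Lim_null_comparison)
    show "(\<lambda>n. inverse \<theta> ^ n) \<longlonglongrightarrow> 0" using \<theta> by (intro LIMSEQ_power_zero) (simp add: field_simps)
    show "eventually (\<lambda>n. norm (inverse \<theta> ^ n * surv n x) \<le> inverse \<theta> ^ n) sequentially"
      using surv_nonneg surv_le_1 \<theta> by (intro always_eventually allI) (simp add: mult_left_le)
  qed
  then show ?thesis using \<theta> liminf_zero by (simp add: theta_set_def)
qed

lemma Inf_theta_set_le_1: "Inf (theta_set x) \<le> 1"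
proof -
  have "bdd_below (theta_set x)" by (auto simp: theta_set_def bdd_below_def intro: exI[of _ 0])
  then have "Inf (theta_set x) \<le> Inf {1<..}"
    using theta_set_gt_1 by (intro cInf_superset_mono) auto
  then show ?thesis by simp
qed

lemma theta_le_theta0: "Inf (theta_set x) \<le> theta0 P"
  unfolding theta0_eq using Inf_theta_set_le_1
  by (intro cSup_upper) (auto simp: bdd_above_def)

lemma theta0_le_1: "theta0 P \<le> 1"
  unfolding theta0_eq using Inf_theta_set_le_1 by (intro cSup_least) auto

lemma Inf_theta_set_asymp:
  assumes "asymp_growth (mass x) l j c" "0 < c" "e < l"
  shows "Inf (theta_set x) = l"
proof -
  have l: "0 < l" using assms e_pos by simp
  have "\<theta> \<in> theta_set x \<longleftrightarrow> l < \<theta>" for \<theta>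
  proof (cases "l < \<theta>")
    case True
    then have "asymp_growth (mass x) \<theta> 0 0"
      by (intro asymp_growth_trans[OF assms(1) l] growth_ratio_less[OF l])
    then show ?thesis using True l scaled_surv_null by (simp add: theta_set_iff)
  next
    case False
    then show ?thesis using scaled_surv_lower[OF assms(1,2), of \<theta> 0] by (simp add: theta_set_iff)
  qed
  then have "theta_set x = {l<..}" by auto
  then show ?thesis by simp
qed

lemma theta0_gt_e: "e < theta0 P"
  using Inf_theta_set_asymp[OF x0_growth(3,2,1)] theta_le_theta0[of x0] x0_growth(1) by simp

lemma theta0_pos: "0 < theta0 P"
  using theta0_gt_e e_pos by simp

lemma mass_bounded_asymp:
  assumes "asymp_growth (mass x) l j c" "0 < l" shows "mass_bounded l x j"
proof -
  obtain B where "\<And>n. n \<ge> 1 \<Longrightarrow> \<bar>fps_nth (mass x) n\<bar> \<le> B * growth l j n"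
    using asymp_growth_bounded[OF assms] by blast
  then show ?thesis unfolding mass_bounded_def using abs_le_D1 by blast
qed

section \<open>Identification of the polynomial order\<close>

definition jS_set :: "'a \<Rightarrow> real set" where
  "jS_set x = {r. r \<ge> 0 \<and> liminf (\<lambda>n. ereal (scaled_surv r (theta0 P) x n)) = 0}"

lemma jS_eq: "jS P x = (if jS_set x = {} then 0 else Inf (jS_set x))"
  by (simp only: jS_def jS_set_def scaled_surv_def Let_def)

lemma jS_null:
  assumes "asymp_growth (mass x) (theta0 P) 0 0" shows "jS P x = 0"
proof -
  have "0 \<in> jS_set x" unfolding jS_set_def using scaled_surv_null[OF assms] by simp
  then have "Inf (jS_set x) = 0" by (intro cInf_eq_minimum) (auto simp: jS_set_def)
  then show ?thesis by (simp add: jS_eq)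
qed

lemma jS_asymp:
  assumes "asymp_growth (mass x) (theta0 P) j c" "0 < c" shows "jS P x = real j"
proof -
  have "r \<in> jS_set x \<longleftrightarrow> real j < r" for r
  proof (cases "real j < r")
    case True
    have "(\<lambda>n. surv n x / growth (theta0 P) j n * ((theta0 P / theta0 P) ^ n * real n powr (real j - r))) \<longlonglongrightarrow> c * (1 * 0)"
      using True theta0_pos
      by (intro tendsto_mult asymp_growth_surv assms(1) tendsto_neg_powr filterlim_real_sequentially) auto
    moreover have "eventually (\<lambda>n. surv n x / growth (theta0 P) j n * ((theta0 P / theta0 P) ^ n * real n powr (real j - r)) =
        scaled_surv r (theta0 P) x n) sequentially"
      using eventually_ge_at_top[of 1] by eventually_elim (rule scaled_surv_eq[OF _ theta0_pos, symmetric])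
    ultimately have "(\<lambda>n. scaled_surv r (theta0 P) x n) \<longlonglongrightarrow> c * (1 * 0)"
      by (rule Lim_transform_eventually)
    then show ?thesis using True liminf_zero by (simp add: jS_set_def)
  next
    case False
    then show ?thesis using scaled_surv_lower[OF assms theta0_pos order_refl, of r] by (simp add: jS_set_def)
  qed
  then have "jS_set x = {real j<..}" by auto
  then show ?thesis by (simp add: jS_eq)
qed

text \<open>The rate of \<open>x\<close> cannot exceed the supremum \<open>theta0 P\<close>. If it
  equals \<open>theta0 P\<close>, the degree of the growth is \<open>jS\<close>. If it is smaller,
  or unresolved and thus null against \<open>theta0 P > e\<close>, the order 0 serves.\<close>

lemma jS_nat: "\<exists>j. jS P x = real j \<and> mass_bounded (theta0 P) x j"
proof -
  note pos = theta0_pos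
  have null: ?thesis if "asymp_growth (mass x) (theta0 P) 0 0"
    using jS_null[OF that] mass_bounded_asymp[OF that pos] by (intro exI[of _ 0]) simp
  show ?thesis using mass_regular[of x]
  proof (cases rule: regular_growth_cases)
    case small
    have "1 / theta0 P < 1 / e" using theta0_gt_e e_pos by (simp add: divide_strict_left_mono)
    then have "fps_summable (mass x) (1 / theta0 P)" using small pos by simp
    then show ?thesis using null asymp_growth_null_summable[OF nonneg_mass pos] by blast
  next
    case (asymp l j c)
    have "l \<le> theta0 P" using Inf_theta_set_asymp[OF asymp(3,2,1)] theta_le_theta0[of x] by simp
    moreover have "0 < l" using asymp e_pos by simp
    moreover have ?thesis if "l < theta0 P"
      using null asymp_growth_trans[OF asymp(3) \<open>0 < l\<close> growth_ratio_less[OF \<open>0 < l\<close> that]] by blast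
    moreover have ?thesis if "l = theta0 P"
      using jS_asymp[of x j c] mass_bounded_asymp[of x "theta0 P" j c] asymp pos that by blast
    ultimately show ?thesis using order_le_less by blast
  qed
qed

text \<open>\<open>weighted_l1_limit\<close> for the kernel powers divided by the growth: the
  abstract limit functional becomes integration against a nonnegative measure.\<close>

lemma scaled_limit:
  assumes conv: "\<forall>f b n. wbound f b \<and> n \<ge> 1 \<longrightarrow>
      \<bar>fps_nth (full f x) n / growth l j n - \<Lambda> f\<bar> \<le> \<alpha> n * V x * b"
    and \<alpha>: "\<alpha> \<longlonglongrightarrow> 0" and l: "0 < l"
  defines "L \<equiv> \<lambda>y. \<Lambda> (dirac y)"
  shows "0 \<le> L y"
    and "wbound f b \<Longrightarrow> (\<lambda>y. L y * f y) summable_on UNIV"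
    and "wbound f b \<Longrightarrow> \<Lambda> f = (\<Sum>\<^sub>\<infinity>y. L y * f y)"
    and "wbound f b \<Longrightarrow> n \<ge> 1 \<Longrightarrow> \<bar>semigrp P n f x / growth l j n - \<Lambda> f\<bar> \<le> \<alpha> n * V x * b"
    and "wbound f b \<Longrightarrow> (\<lambda>n. semigrp P n f x / growth l j n) \<longlonglongrightarrow> \<Lambda> f"
proof -
  show semi: "\<bar>semigrp P n f x / growth l j n - \<Lambda> f\<bar> \<le> \<alpha> n * V x * b"
    if "wbound f b" "n \<ge> 1" for f b n
    using conv semigrp_taboo_fps[OF that] that by simp
  define p where "p n y = kpow P n x y / growth l j n" for n y
  have p_sum: "(\<Sum>\<^sub>\<infinity>y. p n y * f y) = semigrp P n f x / growth l j n" for n f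
  proof -
    have "p n y * f y = inverse (growth l j n) * (kpow P n x y * f y)" for y
      by (simp add: p_def divide_inverse)
    then have "(\<Sum>\<^sub>\<infinity>y. p n y * f y) = inverse (growth l j n) * semigrp P n f x"
      by (simp only: infsum_cmult_right' semigrp_def)
    then show ?thesis by (simp add: divide_inverse mult.commute)
  qed
  have summ: "\<forall>n f b. wbound f b \<longrightarrow> (\<lambda>y. p n y * f y) summable_on UNIV"
  proof (intro allI impI)
    fix n f b assume f: "wbound f b"
    show "(\<lambda>y. p n y * f y) summable_on UNIV"
    using summable_on_cmult_left[OF kpow_summable[OF f, of n x], of "inverse (growth l j n)"]
    by (simp only: p_def divide_inverse mult_ac)
  qed
  have a: "(\<lambda>n. \<alpha> n * V x) \<longlonglongrightarrow> 0" using \<alpha> by (rule tendsto_mult_left_zero)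
  have cv: "\<forall>f b n. wbound f b \<and> n \<ge> 1 \<longrightarrow> \<bar>(\<Sum>\<^sub>\<infinity>y. p n y * f y) - \<Lambda> f\<bar> \<le> \<alpha> n * V x * b"
    using semi by (simp add: p_sum)
  have L_eq: "\<Lambda> (dirac y) = L y" for y by (simp add: L_def)
  note lim = weighted_l1_limit[where p = p and \<Lambda> = \<Lambda> and a = "\<lambda>n. \<alpha> n * V x", OF summ cv a, unfolded L_eq]
  show "0 \<le> L y"
    by (rule LIMSEQ_le_const[OF lim(5)]) (auto simp: p_def kpow_nonneg l less_imp_le)
  show "(\<lambda>y. L y * f y) summable_on UNIV" if "wbound f b" for f b using that by (rule lim(1))
  show "\<Lambda> f = (\<Sum>\<^sub>\<infinity>y. L y * f y)" if "wbound f b" for f b using that by (rule lim(2))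
  show "(\<lambda>n. semigrp P n f x / growth l j n) \<longlonglongrightarrow> \<Lambda> f" if "wbound f b"
  proof (rule LIM_zero_cancel, rule Lim_null_comparison)
    show "(\<lambda>n. \<alpha> n * V x * b) \<longlonglongrightarrow> 0" using a by (rule tendsto_mult_left_zero)
    show "eventually (\<lambda>n. norm (semigrp P n f x / growth l j n - \<Lambda> f) \<le> \<alpha> n * V x * b) sequentially"
      using semi[OF that] by (auto simp: eventually_sequentially)
  qed
qed

lemma wbound_wnorm: assumes "Linf V f" shows "wbound f (wnorm V f)"
  unfolding wbound_def
proof
  fix x
  obtain C where C: "\<And>x. \<bar>f x\<bar> \<le> C * V x" using assms by (auto simp: Linf_def)
  have "bdd_above (range (\<lambda>x. \<bar>f x\<bar> / V x))"
    using C V_pos by (auto simp: bdd_above_def pos_divide_le_eq intro!: exI[of _ C])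
  then have "\<bar>f x\<bar> / V x \<le> wnorm V f" unfolding wnorm_def by (intro cSup_upper) auto
  then show "\<bar>f x\<bar> \<le> wnorm V f * V x" using V_pos[of x] by (simp add: pos_divide_le_eq)
qed

end

text \<open>The index i encodes a starting point x: the functions eta are supported in single points and
  nu is the normalised limit measure seen from x, so that no spectral projections are needed.\<close>

lemma (in absorbed_kernel) assumption_A_holds:
  assumes count: "inj (enc :: 'a \<Rightarrow> nat)"
  shows "assumption_A P V"
proof -
  define \<theta> where "\<theta> = theta0 P"
  have \<theta>: "0 < \<theta>" "\<theta> \<le> 1" "e < \<theta>" using theta0_pos theta0_le_1 theta0_gt_e by (auto simp: \<theta>_def)
  have "\<forall>x. \<exists>j. jS P x = real j \<and> mass_bounded \<theta> x j"
    using jS_nat by (simp add: \<theta>_def)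
  from choice[OF this] obtain j
    where j: "\<And>x. jS P x = real (j x)" "\<And>x. mass_bounded \<theta> x (j x)" by blast
  obtain \<Lambda> \<alpha> where \<alpha>: "\<alpha> \<longlonglongrightarrow> 0" and conv: "\<And>x. \<forall>f c n. wbound f c \<and> n \<ge> 1 \<longrightarrow>
     \<bar>fps_nth (full f x) n / growth \<theta> (j x) n - \<Lambda> x f\<bar> \<le> \<alpha> n * V x * c"
    using uniform_convergence[OF \<theta>(3), of UNIV j] j(2) by blast
  define L where "L x y = \<Lambda> x (dirac y)" for x y
  note lim = scaled_limit[OF conv \<alpha> \<theta>(1), folded L_def]
  have L_nn: "0 \<le> L x y" for x y by (rule lim(1))
  have L_summ: "(\<lambda>y. L x y * f y) summable_on UNIV" if "wbound f b" for x f b using that by (rule lim(2))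
  have \<Lambda>_eq: "\<Lambda> x f = (\<Sum>\<^sub>\<infinity>y. L x y * f y)" if "wbound f b" for x f b using that by (rule lim(3))
  have semi: "\<bar>semigrp P n f x / growth \<theta> (j x) n - \<Lambda> x f\<bar> \<le> \<alpha> n * V x * b"
    if "wbound f b" "n \<ge> 1" for n f b x using that by (rule lim(4))
  define Z where "Z x = \<Lambda> x (\<lambda>_. 1)" for x
  have L1: "L x summable_on UNIV" for x using L_summ[OF wbound_one] by simp
  have Z_eq: "Z x = (\<Sum>\<^sub>\<infinity>y. L x y)" for x using \<Lambda>_eq[OF wbound_one] by (simp add: Z_def)
  have Z_nn: "0 \<le> Z x" for x unfolding Z_eq by (intro infsum_nonneg L_nn)
  \<comment> \<open>A nonnegative measure of mass 0 vanishes, so states with \<open>Z x = 0\<close>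
    can be left out of the index set.\<close>
  have Z_zero: "\<Lambda> x f = 0" if "Z x = 0" "wbound f b" for x f b
  proof -
    have "L x y = 0" for y
      using nonneg_infsum_le_0D[of "L x" UNIV y] that(1) L1 L_nn by (simp add: Z_eq)
    then show ?thesis using \<Lambda>_eq[OF that(2)] by simp
  qed
  define I where "I = enc ` {x. Z x > 0}"
  define dec where "dec = inv enc"
  have dec: "dec (enc x) = x" for x using count by (simp add: dec_def)
  define \<nu> where "\<nu> i y = L (dec i) y / Z (dec i)" for i :: nat and y
  define \<eta> where "\<eta> i x = (if x = dec i then Z x else 0)" for i :: nat and x
  have ZI: "Z (dec i) > 0" if "i \<in> I" for i using that by (auto simp: I_def dec)
  have \<nu>_mult: "\<nu> i y * f y = (1 / Z (dec i)) * (L (dec i) y * f y)" for i y f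
    by (simp add: \<nu>_def)
  have integ_\<nu>: "integ (\<nu> i) f = \<Lambda> (dec i) f / Z (dec i)" if "wbound f b" for i f b
    using \<Lambda>_eq[OF that] by (simp only: integ_def \<nu>_mult infsum_cmult_right') simp
  have \<nu>_summ: "(\<lambda>y. \<nu> i y * f y) summable_on UNIV" if "wbound f b" for i f b
    unfolding \<nu>_mult by (intro summable_on_cmult_right L_summ[OF that])
  have prob: "prob_in_MV V (\<nu> i)" if i: "i \<in> I" for i
  proof -
    have "(\<Sum>\<^sub>\<infinity>y. \<nu> i y) = integ (\<nu> i) (\<lambda>_. 1)" by (simp add: integ_def)
    also have "\<dots> = 1" using integ_\<nu>[OF wbound_one] ZI[OF i] by (simp add: Z_def)
    moreover have "\<nu> i summable_on UNIV" using \<nu>_summ[OF wbound_one, of i] by simp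
    moreover have "0 \<le> \<nu> i y" for y using L_nn Z_nn by (simp add: \<nu>_def)
    ultimately show ?thesis using \<nu>_summ[OF wbound_V, of i] by (simp add: prob_in_MV_def)
  qed
  have \<eta>_prop: "(\<forall>x. 0 \<le> \<eta> i x) \<and> (\<exists>x. \<eta> i x \<noteq> 0) \<and> Linf V (\<eta> i)" if i: "i \<in> I" for i
  proof (intro conjI)
    show "\<forall>x. 0 \<le> \<eta> i x" using Z_nn by (simp add: \<eta>_def)
    show "\<exists>x. \<eta> i x \<noteq> 0" using ZI[OF i] by (intro exI[of _ "dec i"]) (simp add: \<eta>_def)
    have "\<bar>\<eta> i x\<bar> \<le> Z (dec i) * V x" for x
      using Z_nn[of "dec i"] V_pos[of x] mult_left_mono[OF V_ge1[of x] Z_nn[of "dec i"]]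
      by (cases "x = dec i") (simp_all add: \<eta>_def)
    then show "Linf V (\<eta> i)" by (auto simp: Linf_def)
  qed
  have zero: "\<eta> i x * r = 0" if "i \<in> I - {enc x}" for i x r
    using that by (auto simp: \<eta>_def I_def dec)
  have \<eta>_summ: "(\<lambda>i. \<eta> i x * r i) summable_on I" for x r
  proof -
    have "(\<lambda>i. \<eta> i x * r i) summable_on (I \<inter> {enc x})" by simp
    then show ?thesis
      by (rule summable_on_cong_neutral[THEN iffD1, rotated 3]) (use zero in auto)
  qed
  \<comment> \<open>At \<open>x\<close> only the index \<open>enc x\<close> can contribute, where
    the factor \<open>Z x\<close> undoes the normalisation.\<close>
  have \<eta>_sum: "(\<Sum>\<^sub>\<infinity>i\<in>I. \<eta> i x * integ (\<nu> i) f) = \<Lambda> x f" if f: "wbound f b" for x f b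
  proof -
    have "(\<Sum>\<^sub>\<infinity>i\<in>I. \<eta> i x * integ (\<nu> i) f) = (\<Sum>\<^sub>\<infinity>i\<in>I \<inter> {enc x}. \<eta> i x * integ (\<nu> i) f)"
      by (rule infsum_cong_neutral) (use zero in auto)
    also have "\<dots> = \<Lambda> x f"
    proof (cases "Z x > 0")
      case True
      then have "I \<inter> {enc x} = {enc x}" by (auto simp: I_def)
      then show ?thesis using True integ_\<nu>[OF f] by (simp add: \<eta>_def dec)
    next
      case False
      then have "enc x \<notin> I" using dec ZI[of "enc x"] by auto
      moreover have "Z x = 0" using False Z_nn[of x] by simp
      ultimately show ?thesis using Z_zero[OF _ f] by simp
    qed
    finally show ?thesis .
  qed
  \<comment> \<open>The uniform estimate at \<open>n = 1\<close>, combined with the one-step bound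
    \<open>C0\<close>, controls the limit functional on \<open>V\<close>.\<close>
  have "\<bar>\<Lambda> x V\<bar> \<le> (\<alpha> 1 + C0 / \<theta>) * V x" for x
  proof -
    have "semigrp P 1 V x = kop P V x"
      using semigrp_Suc[OF wbound_V, of 0 x] by (simp add: semigrp_0 [abs_def])
    moreover have "0 \<le> kop P V x" using V_pos by (intro kop_nonneg less_imp_le)
    moreover have "kop P V x / \<theta> \<le> C0 * V x / \<theta>" using PV_le[of x] \<theta> by (intro divide_right_mono) auto
    moreover have "0 \<le> kop P V x / \<theta>" using calculation \<theta> by simp
    moreover have "\<bar>kop P V x / \<theta> - \<Lambda> x V\<bar> \<le> \<alpha> 1 * V x"
      using semi[OF wbound_V, of 1 x] calculation(1) by simp
    ultimately have "\<bar>\<Lambda> x V\<bar> \<le> \<alpha> 1 * V x + C0 * V x / \<theta>" by linarith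
    then show ?thesis by (simp add: distrib_right)
  qed
  then have LV: "Linf V (\<lambda>x. \<Sum>\<^sub>\<infinity>i\<in>I. \<eta> i x * integ (\<nu> i) V)"
    unfolding \<eta>_sum[OF wbound_V] Linf_def by blast
  have main: "\<bar>inverse \<theta> ^ n * real n powr (- jS P x) * semigrp P n f x
      - (\<Sum>\<^sub>\<infinity>i\<in>I. \<eta> i x * integ (\<nu> i) f)\<bar> \<le> \<alpha> n * V x * wnorm V f" if "Linf V f" "n \<ge> 1" for f n x
  proof -
    note f = wbound_wnorm[OF that(1)]
    have "inverse \<theta> ^ n * real n powr (- jS P x) * semigrp P n f x = semigrp P n f x / growth \<theta> (j x) n"
    proof -
      have "real n powr (- jS P x) = inverse (real n ^ j x)"
        using that by (simp add: j(1) powr_minus powr_realpow)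
      then show ?thesis by (simp only: divide_power_mult)
    qed
    then show ?thesis using semi[OF f that(2), of x] by (simp add: \<eta>_sum[OF f])
  qed
  have jS: "\<forall>x. jS P x \<in> \<nat>" by (simp add: j(1))
  have summ: "\<forall>f n x. Linf V f \<longrightarrow> (\<lambda>y. kpow P n x y * f y) summable_on UNIV"
    using kpow_summable[OF wbound_wnorm] by blast
  have prob': "\<forall>i\<in>I. prob_in_MV V (\<nu> i)" and V1: "\<forall>x. 1 \<le> V x"
    and \<eta>_prop': "\<forall>i\<in>I. (\<forall>x. 0 \<le> \<eta> i x) \<and> (\<exists>x. \<eta> i x \<noteq> 0) \<and> Linf V (\<eta> i)"
    using prob V_ge1 \<eta>_prop by blast+
  have \<eta>_summ': "\<forall>x. (\<lambda>i. \<eta> i x * integ (\<nu> i) V) summable_on I"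
    by (intro allI \<eta>_summ)
  have main': "\<forall>f n x. Linf V f \<and> n \<ge> 1 \<longrightarrow>
      \<bar>inverse \<theta> ^ n * real n powr (- jS P x) * semigrp P n f x
        - (\<Sum>\<^sub>\<infinity>i\<in>I. \<eta> i x * integ (\<nu> i) f)\<bar> \<le> \<alpha> n * V x * wnorm V f"
    using main by blast
  show ?thesis
    unfolding assumption_A_def \<theta>_def [symmetric]
    by (intro conjI \<theta>(1,2) jS V1 summ exI[of _ I] exI[of _ \<nu>] exI[of _ \<eta>] exI[of _ \<alpha>]
        prob' \<eta>_prop' \<eta>_summ' LV \<alpha> main')
qed

text \<open>Comparing \<open>n\<close> and \<open>n + m\<close> steps from \<open>x0\<close> shows
  that the limit measure is a left eigenvector of \<open>m\<close> steps with eigenvalue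
  \<open>l0 ^ m\<close>; normalised by its mass \<open>c0\<close> it is quasi-stationary. As the
  scaled survival probability tends to \<open>c0 > 0\<close>, the convergence carries over to the
  conditional laws.\<close>

lemma (in absorbed_kernel) qsd_limit:
  shows "\<exists>\<nu>. is_QSD P \<nu> \<and> (\<lambda>y. \<nu> y * V y) summable_on UNIV \<and>
       (\<forall>n. (\<lambda>y. \<bar>cond_law P x0 n y - \<nu> y\<bar> * V y) summable_on UNIV) \<and>
       (\<lambda>n. \<Sum>\<^sub>\<infinity>y. \<bar>cond_law P x0 n y - \<nu> y\<bar> * V y) \<longlonglongrightarrow> 0"
proof -
  have l0: "0 < l0" using x0_growth(1) e_pos by simp
  have "mass_bounded l0 x j0" if "x \<in> {x0}" for x
    using mass_bounded_asymp[OF x0_growth(3) l0] that by simp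
  from uniform_convergence[OF x0_growth(1), of "{x0}" "\<lambda>_. j0", OF this]
  obtain \<Lambda>' \<alpha> where \<alpha>: "\<alpha> \<longlonglongrightarrow> 0" and conv': "\<forall>f c n. wbound f c \<and> n \<ge> 1 \<longrightarrow>
     \<bar>fps_nth (full f x0) n / growth l0 j0 n - \<Lambda>' x0 f\<bar> \<le> \<alpha> n * V x0 * c"
    by blast
  define \<Lambda> where "\<Lambda> = \<Lambda>' x0"
  define L where "L y = \<Lambda> (dirac y)" for y
  define g where "g n = growth l0 j0 n" for n
  note lim = scaled_limit[OF conv'[folded \<Lambda>_def] \<alpha> l0, folded L_def g_def]
  have L_nn: "0 \<le> L y" for y by (rule lim(1))
  have L_summ: "(\<lambda>y. L y * f y) summable_on UNIV" if "wbound f b" for f b using that by (rule lim(2))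
  have \<Lambda>_eq: "\<Lambda> f = (\<Sum>\<^sub>\<infinity>y. L y * f y)" if "wbound f b" for f b using that by (rule lim(3))
  have semi: "\<bar>semigrp P n f x0 / g n - \<Lambda> f\<bar> \<le> \<alpha> n * V x0 * b"
    if "wbound f b" "n \<ge> 1" for n f b using that by (rule lim(4))
  have semi_lim: "(\<lambda>n. semigrp P n f x0 / g n) \<longlonglongrightarrow> \<Lambda> f" if "wbound f b" for f b
    using that by (rule lim(5))
  have s_lim: "(\<lambda>n. surv n x0 / g n) \<longlonglongrightarrow> c0"
    using asymp_growth_surv[OF x0_growth(3)] by (simp add: g_def)
  have \<Lambda>1: "\<Lambda> (\<lambda>_. 1) = c0" using LIMSEQ_unique[OF semi_lim[OF wbound_one] s_lim] .
  define \<nu> where "\<nu> y = L y / c0" for y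
  have \<nu>_mult: "\<nu> y * f y = (1 / c0) * (L y * f y)" for y f by (simp add: \<nu>_def)
  have integ_\<nu>: "integ \<nu> f = \<Lambda> f / c0" if "wbound f b" for f b
    using \<Lambda>_eq[OF that] by (simp only: integ_def \<nu>_mult infsum_cmult_right') simp
  have \<nu>_summ: "(\<lambda>y. \<nu> y * f y) summable_on UNIV" if "wbound f b" for f b
    unfolding \<nu>_mult by (intro summable_on_cmult_right L_summ[OF that])
  have eigen: "integ \<nu> (semigrp P m f) = l0 ^ m * integ \<nu> f" if f: "wbound f b" for m f b
  proof -
    have 1: "(\<lambda>n. semigrp P n (semigrp P m f) x0 / g n) \<longlonglongrightarrow> \<Lambda> (semigrp P m f)"
      by (rule semi_lim[OF wbound_semigrp[OF f]])
    \<comment> \<open>The same sequence written at time \<open>n + m\<close>, with the factor that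
      corrects the normalisation; its polynomial part tends to 1.\<close>
    have 2: "(\<lambda>n. semigrp P (n + m) f x0 / g (n + m) * (l0 ^ m / (real n / real (n + m)) ^ j0))
        \<longlonglongrightarrow> \<Lambda> f * (l0 ^ m / 1)"
    proof (intro tendsto_mult tendsto_divide tendsto_const)
      show "(\<lambda>n. semigrp P (n + m) f x0 / g (n + m)) \<longlonglongrightarrow> \<Lambda> f"
        using LIMSEQ_ignore_initial_segment[OF semi_lim[OF f], of m] .
      show "(\<lambda>n. (real n / real (n + m)) ^ j0) \<longlonglongrightarrow> 1"
        using LIMSEQ_ignore_initial_segment[OF quot_pow_tendsto_1[of m j0], of m] by simp
    qed simp
    have 3: "eventually (\<lambda>n. semigrp P (n + m) f x0 / g (n + m) * (l0 ^ m / (real n / real (n + m)) ^ j0)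
        = semigrp P n (semigrp P m f) x0 / g n) sequentially"
      using eventually_ge_at_top[of 1]
    proof eventually_elim
      case (elim n)
      then show ?case using l0
        by (simp add: semigrp_add_steps[OF f] g_def power_add power_divide)
    qed
    have "\<Lambda> (semigrp P m f) = \<Lambda> f * (l0 ^ m / 1)"
      by (rule LIMSEQ_unique[OF 1 Lim_transform_eventually[OF 2 3]])
    then show ?thesis
      by (simp add: integ_\<nu>[OF f] integ_\<nu>[OF wbound_semigrp[OF f]])
  qed
  have \<nu>1: "integ \<nu> (\<lambda>_. 1) = 1" using integ_\<nu>[OF wbound_one] \<Lambda>1 x0_growth(2) by simp
  have qsd: "is_QSD P \<nu>" unfolding is_QSD_def
  proof (intro conjI allI)
    show "0 \<le> \<nu> y" for y using L_nn x0_growth(2) by (simp add: \<nu>_def)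
    show "\<nu> summable_on UNIV" using \<nu>_summ[OF wbound_one] by simp
    show "(\<Sum>\<^sub>\<infinity>y. \<nu> y) = 1" using \<nu>1 by (simp add: integ_def)
    fix n
    have s: "integ \<nu> (semigrp P n (\<lambda>_. 1)) = l0 ^ n" using eigen[OF wbound_one] \<nu>1 by simp
    then show "0 < integ \<nu> (semigrp P n (\<lambda>_. 1))" using l0 by simp
    fix y
    have "integ \<nu> (dirac y) = \<nu> y"
    proof -
      have "integ \<nu> (dirac y) = (\<Sum>\<^sub>\<infinity>z\<in>{y}. \<nu> z * dirac y z)"
        unfolding integ_def by (rule infsum_cong_neutral) (auto simp: dirac_def)
      then show ?thesis by (simp add: dirac_def)
    qed
    moreover have "semigrp P n (dirac y) = (\<lambda>x. kpow P n x y)" by (simp add: fun_eq_iff semigrp_dirac)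
    ultimately have "integ \<nu> (\<lambda>x. kpow P n x y) = l0 ^ n * \<nu> y" using eigen[OF wbound_dirac, of n y] by simp
    then show "integ \<nu> (\<lambda>x. kpow P n x y) / integ \<nu> (semigrp P n (\<lambda>_. 1)) = \<nu> y" using s l0 by simp
  qed
  define p where "p n y = cond_law P x0 n y" for n y
  define s where "s n = surv n x0 / g n" for n
  \<comment> \<open>The two errors of a quotient: that of the numerator, and that of replacing
    \<open>1 / s n\<close> by \<open>1 / c0\<close>.\<close>
  define a where "a n = \<alpha> n * V x0 * \<bar>1 / s n\<bar> + \<Lambda> V * \<bar>1 / s n - 1 / c0\<bar>" for n
  have p_mult: "p n y * f y = (1 / surv n x0) * (kpow P n x0 y * f y)" for n y f
    by (simp add: p_def cond_law_def)
  have p_summ: "\<forall>n f b. wbound f b \<longrightarrow> (\<lambda>y. p n y * f y) summable_on UNIV"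
    unfolding p_mult by (intro allI impI, rule summable_on_cmult_right, rule kpow_summable)
  have p_sum: "(\<Sum>\<^sub>\<infinity>y. p n y * f y) = (semigrp P n f x0 / g n) * (1 / s n)" if "n \<ge> 1" for n f
  proof -
    have "g n \<noteq> 0" using l0 that by (simp add: g_def)
    then show ?thesis unfolding p_mult infsum_cmult_right' by (simp add: s_def semigrp_def)
  qed
  have \<Lambda>_bound: "\<bar>\<Lambda> f\<bar> \<le> b * \<Lambda> V" if f: "wbound f b" for f b
    unfolding \<Lambda>_eq[OF f] \<Lambda>_eq[OF wbound_V] by (rule weighted_infsum_le[OF L_nn L_summ[OF wbound_V] f])
  have s0: "s \<longlonglongrightarrow> c0" using s_lim by (simp add: s_def [abs_def])
  have "a \<longlonglongrightarrow> 0 * V x0 * \<bar>1 / c0\<bar> + \<Lambda> V * \<bar>1 / c0 - 1 / c0\<bar>"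
    unfolding a_def using x0_growth(2) by (intro tendsto_intros \<alpha> s0) auto
  then have a0: "a \<longlonglongrightarrow> 0" by simp
  have p_conv: "\<bar>(\<Sum>\<^sub>\<infinity>y. p n y * f y) - \<Lambda> f / c0\<bar> \<le> a n * b" if f: "wbound f b" and n: "n \<ge> 1" for f b n
  proof -
    have "(\<Sum>\<^sub>\<infinity>y. p n y * f y) - \<Lambda> f / c0 =
        (semigrp P n f x0 / g n - \<Lambda> f) * (1 / s n) + \<Lambda> f * (1 / s n - 1 / c0)"
      unfolding p_sum[OF n] left_diff_distrib right_diff_distrib by simp
    also have "\<bar>\<dots>\<bar> \<le> \<bar>semigrp P n f x0 / g n - \<Lambda> f\<bar> * \<bar>1 / s n\<bar> + \<bar>\<Lambda> f\<bar> * \<bar>1 / s n - 1 / c0\<bar>"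
      by (rule order_trans[OF abs_triangle_ineq]) (simp only: abs_mult order_refl)
    also have "\<dots> \<le> (\<alpha> n * V x0 * b) * \<bar>1 / s n\<bar> + (b * \<Lambda> V) * \<bar>1 / s n - 1 / c0\<bar>"
      by (intro add_mono mult_right_mono semi[OF f n] \<Lambda>_bound[OF f]) auto
    also have "\<dots> = a n * b" unfolding a_def by (simp only: distrib_right) (simp only: mult_ac)
    finally show ?thesis .
  qed
  note plim = weighted_l1_limit[where p = p and \<Lambda> = "\<lambda>f. \<Lambda> f / c0" and a = a, OF p_summ _ a0, folded L_def, folded \<nu>_def]
  let ?d = "\<lambda>n y. \<bar>p n y - \<nu> y\<bar> * V y"
  have sum_le: "(\<Sum>\<^sub>\<infinity>y. ?d n y) \<le> a n" if "n \<ge> 1" for n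
    using p_conv that by (intro plim(4)) auto
  \<comment> \<open>Proved directly for all \<open>n\<close>, because
    \<open>weighted_l1_limit\<close> covers only \<open>n \<ge> 1\<close>.\<close>
  have summ: "(\<lambda>y. ?d n y) summable_on UNIV" for n
  proof -
    have "(\<lambda>y. p n y * V y + - (\<nu> y * V y)) summable_on UNIV"
      by (intro summable_on_add summable_on_uminus[THEN iffD2] p_summ[rule_format, OF wbound_V] \<nu>_summ[OF wbound_V])
    then have "(\<lambda>y. norm (p n y * V y + - (\<nu> y * V y))) summable_on UNIV"
      by (rule summable_on_iff_abs_summable_on_real[THEN iffD1])
    moreover have "norm (p n y * V y + - (\<nu> y * V y)) = ?d n y" for y
      using V_pos[of y] by (simp add: left_diff_distrib [symmetric] abs_mult)
    ultimately show ?thesis by simp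
  qed
  have "(\<lambda>n. \<Sum>\<^sub>\<infinity>y. ?d n y) \<longlonglongrightarrow> 0"
  proof (rule Lim_null_comparison[OF _ a0])
    have "0 \<le> (\<Sum>\<^sub>\<infinity>y. ?d n y)" for n
      using V_pos by (intro infsum_nonneg) (simp add: less_imp_le)
    then show "eventually (\<lambda>n. norm (\<Sum>\<^sub>\<infinity>y. ?d n y) \<le> a n) sequentially"
      using sum_le by (auto simp: eventually_sequentially)
  qed
  then show ?thesis using qsd \<nu>_summ[OF wbound_V] summ unfolding p_def by blast
qed

section \<open>The chain with a Lyapunov function\<close>

context weighted_kernel
begin

lemma kpow_return_supermult: "kpow P a x x * kpow P b x x \<le> kpow P (a + b) x x"
proof -
  have bd: "wbound (\<lambda>y. kpow P b y x) (1 * C0 ^ b)"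
    using wbound_semigrp[OF wbound_dirac[of x], of b] by (simp only: semigrp_dirac [abs_def])
  have "(\<Sum>y\<in>{x}. kpow P a x y * kpow P b y x) \<le> (\<Sum>\<^sub>\<infinity>y. kpow P a x y * kpow P b y x)"
    by (rule finite_sum_le_infsum[OF kpow_summable[OF bd]]) (auto simp: kpow_nonneg)
  also have "\<dots> = kpow P (a + b) x x"
    using semigrp_add_steps[OF wbound_dirac[of x], of a b x]
    by (simp add: semigrp_dirac [abs_def]) (simp add: semigrp_def)
  finally show ?thesis by simp
qed

lemma kpow_return_power: "kpow P m x x ^ k \<le> kpow P (k * m) x x"
proof (induction k)
  case (Suc k)
  have "kpow P m x x * kpow P m x x ^ k \<le> kpow P m x x * kpow P (k * m) x x"
    by (intro mult_left_mono Suc kpow_nonneg)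
  also have "\<dots> \<le> kpow P (m + k * m) x x" by (rule kpow_return_supermult)
  finally show ?case by simp
qed simp

lemma kpow_le_semigrp: "kpow P n x y \<le> semigrp P n (\<lambda>_. 1) x"
proof -
  have "(\<Sum>z\<in>{y}. kpow P n x z * 1) \<le> (\<Sum>\<^sub>\<infinity>z. kpow P n x z * 1)"
    by (rule finite_sum_le_infsum[OF kpow_summable[OF wbound_one]]) (auto simp: kpow_nonneg)
  then show ?thesis by (simp add: semigrp_def)
qed

end

text \<open>Returns at multiples of \<open>m\<close> bound the survival probabilities below by
  powers of \<open>kpow P m x x\<close>, so the terms of the mass series at \<open>t\<close> do not
  tend to 0. Divergence before 1/e leaves only the alternative with an exact rate.\<close>

lemma (in compact_kernel) recurrent_growth:
  assumes "m \<ge> 1" and t: "1 \<le> t" "t < 1 / e" "1 \<le> kpow P m x x * t"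
  obtains l j c where "e < l" "0 < c" "asymp_growth (mass x) l j c"
proof -
  have reg: "regular_growth e (mass x)"
    unfolding mass_def by (rule taboo_fps_regular[OF wbound_one]) simp
  show ?thesis using reg
  proof (cases rule: regular_growth_cases)
    case small
    then have "fps_summable (mass x) t" using t by simp
    then have "(\<lambda>n. fps_nth (mass x) n * t ^ n) \<longlonglongrightarrow> 0"
      unfolding fps_summable_def by (rule summable_LIMSEQ_zero)
    moreover have "filterlim (\<lambda>k. Suc k * m) at_top sequentially"
    proof (rule filterlim_at_top_mono[OF filterlim_ident])
      show "eventually (\<lambda>k. k \<le> Suc k * m) sequentially"
      proof (intro always_eventually allI)
        fix k
        have "k * 1 \<le> Suc k * m" using assms(1) by (intro mult_le_mono) auto
        then show "k \<le> Suc k * m" by simp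
      qed
    qed
    ultimately have lim: "(\<lambda>k. fps_nth (mass x) (Suc k * m) * t ^ (Suc k * m)) \<longlonglongrightarrow> 0"
      by (rule filterlim_compose)
    have "1 \<le> fps_nth (mass x) (Suc k * m) * t ^ (Suc k * m)" for k
    proof -
      let ?n = "Suc k * m"
      have n1: "?n \<ge> 1" using assms(1) by simp
      \<comment> \<open>As \<open>t \<ge> 1\<close>, the assumption on
        \<open>kpow P m x x * t\<close> also holds with \<open>t ^ m\<close>, the factor belonging
        to \<open>m\<close> steps.\<close>
      have "t ^ 1 \<le> t ^ m" using assms(1) t by (intro power_increasing) auto
      then have "1 \<le> kpow P m x x * t ^ m"
        using t(3) mult_left_mono[OF _ kpow_nonneg, of "t ^ 1" "t ^ m" m x x] by simp
      then have "1 \<le> (kpow P m x x * t ^ m) ^ Suc k" by (rule one_le_power)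
      also have "\<dots> = kpow P m x x ^ Suc k * t ^ ?n"
        by (simp only: power_mult_distrib power_mult [symmetric] mult.commute)
      also have "\<dots> \<le> kpow P ?n x x * t ^ ?n"
        using t by (intro mult_right_mono kpow_return_power) auto
      also have "\<dots> \<le> semigrp P ?n (\<lambda>_. 1) x * t ^ ?n"
        using t by (intro mult_right_mono kpow_le_semigrp) auto
      also have "semigrp P ?n (\<lambda>_. 1) x = fps_nth (mass x) ?n"
        unfolding mass_def by (rule semigrp_taboo_fps[OF wbound_one n1])
      finally show ?thesis .
    qed
    then have "(1::real) \<le> 0" by (intro LIMSEQ_le_const[OF lim]) auto
    then show ?thesis by simp
  next
    case (asymp l j c)
    then show ?thesis by (rule that)
  qed
qed

theorem theorem5p1:
  fixes P :: "'a::countable \<Rightarrow> 'a \<Rightarrow> real" and V :: "'a \<Rightarrow> real" and x0 :: 'a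
  assumes kernel: "sub_stochastic P"
    and aperiodic: "\<forall>x. aperiodic_state P x"
    and recurrent_x0: "\<exists>n\<ge>1. kpow P n x0 x0 > 0"
    and V_ge1: "\<forall>x. V x \<ge> 1"
    and V_levels: "\<forall>c>0. finite {x. V x \<le> c}"
    and PV_finite: "\<forall>x. (\<lambda>y. P x y * V y) summable_on UNIV"
    and Lyap: "((\<lambda>x. (\<Sum>\<^sub>\<infinity>y. P x y * V y) / V x) \<longlongrightarrow> 0) (filtercomap V at_top)"
  shows "assumption_A P V \<and> (\<exists>\<nu>. is_QSD P \<nu>) \<and>
    (\<exists>\<nu>. is_QSD P \<nu> \<and> (\<lambda>y. \<nu> y * V y) summable_on UNIV \<and>
       (\<forall>n. (\<lambda>y. \<bar>cond_law P x0 n y - \<nu> y\<bar> * V y) summable_on UNIV) \<and>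
       (\<lambda>n. \<Sum>\<^sub>\<infinity>y. \<bar>cond_law P x0 n y - \<nu> y\<bar> * V y) \<longlonglongrightarrow> 0)"
proof -
  have P_nn: "0 \<le> P x y" for x y using kernel by (simp add: sub_stochastic_def)
  have V1: "1 \<le> V x" for x using V_ge1 by simp
  have V0: "0 < V x" for x using V1[of x] by simp
  obtain m where m: "m \<ge> 1" "kpow P m x0 x0 > 0" using recurrent_x0 by blast
  \<comment> \<open>With \<open>e = q / 4\<close>, the point \<open>t = 2 / q\<close> lies between 1
    and \<open>1 / e = 4 / q\<close>, and the return probability times \<open>t\<close> is at least
    2. This meets the hypotheses of \<open>recurrent_growth\<close>.\<close>
  define q where "q = min 1 (kpow P m x0 x0)"
  define e where "e = q / 4"
  have q: "0 < q" "q \<le> 1" "q \<le> kpow P m x0 x0" using m by (auto simp: q_def)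
  have e: "0 < e" using q by (simp add: e_def)
  have "eventually (\<lambda>x. kop P V x / V x < e) (filtercomap V at_top)"
    using order_tendstoD(2)[OF Lyap e] by (simp add: kop_def)
  then obtain N where N: "\<And>x. N \<le> V x \<Longrightarrow> kop P V x / V x < e"
    by (auto simp: eventually_filtercomap_at_top_linorder)
  \<comment> \<open>\<open>max N 1\<close> is positive, as \<open>V_levels\<close> demands of a
    level.\<close>
  define K where "K = {x. V x \<le> max N 1}"
  have K: "finite K" using V_levels by (simp add: K_def)
  have contract: "kop P V x \<le> e * V x" if "x \<notin> K" for x
    using N[of x] that V0[of x] by (simp add: K_def pos_divide_less_eq less_imp_le)
  have kop_nn: "0 \<le> kop P V x" for x
    unfolding kop_def by (intro infsum_nonneg mult_nonneg_nonneg P_nn less_imp_le[OF V0])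
  \<comment> \<open>\<open>e\<close> serves outside \<open>K\<close>; on the finite set
    \<open>K\<close> the sum of all values is a bound because \<open>V \<ge> 1\<close>.\<close>
  define C0 where "C0 = e + (\<Sum>x\<in>K. kop P V x)"
  have PV_le: "kop P V x \<le> C0 * V x" for x
  proof (cases "x \<in> K")
    case True
    have "kop P V x \<le> (\<Sum>x\<in>K. kop P V x)" using True K kop_nn by (intro member_le_sum) auto
    then have "kop P V x \<le> C0" using e by (simp add: C0_def)
    moreover have "0 \<le> C0" using e kop_nn by (auto simp: C0_def intro!: add_nonneg_nonneg sum_nonneg)
    ultimately show ?thesis using mult_left_mono[OF V1[of x], of C0] by simp
  next
    case False
    have "0 \<le> (\<Sum>x\<in>K. kop P V x)" using kop_nn by (intro sum_nonneg)
    then have "e * V x \<le> C0 * V x" using V0[of x] by (intro mult_right_mono) (auto simp: C0_def)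
    then show ?thesis using contract[OF False] by simp
  qed
  interpret compact_kernel P V C0 e K
    using P_nn V1 PV_finite PV_le e K contract aperiodic by unfold_locales auto
  have "1 \<le> 2 / q" "2 / q < 1 / e" using q by (auto simp: e_def field_simps)
  moreover have "1 \<le> kpow P m x0 x0 * (2 / q)"
    using mult_right_mono[OF q(3), of "2 / q"] q by simp
  ultimately obtain l j c where g: "e < l" "0 < c" "asymp_growth (mass x0) l j c"
    using recurrent_growth[OF m(1)] by blast
  interpret absorbed_kernel P V C0 e K x0 l j c
  proof
    show "kop P (\<lambda>_. 1) x \<le> 1" for x using kernel by (simp add: kop_def sub_stochastic_def)
  qed (use g in auto)
  have "assumption_A P V" by (rule assumption_A_holds[OF inj_to_nat])
  then show ?thesis using qsd_limit by blast
qed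

end
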